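(* Let $M$ be a Riemannian manifold, let $\gamma:[0,l]\to M$ be a normal geodesic, let $W$ be a piecewise smooth vector field along $\gamma$, and let $B$ be a symmetric linear transformation on the tangent space $M_{\gamma(0)}$. If there is no focal point of $\gamma(0)$ with respect to $B$ on $\gamma$, then there is a unique Jacobi field $V$ along $\gamma$ such that $V(l)=W(l)$ and $V'(0)=B(V(0))$. Moreover, $$I_B(V,V)\leq I_B(W,W),$$ and equality holds only if $V=W$.
   Context: $M_x$ denotes the tangent space of $M$ at $x$. A normal geodesic is a geodesic parametrized by arc length ($\|\gamma'\|=1$), with $l>0$. A prime on a vector field along $\gamma$ denotes covariant derivative along $\gamma$. "Piecewise smooth vector field along $\gamma$" means continuous on $[0,l]$ and smooth on each piece of some finite subdivision of $[0,l]$. Focal points: for a symmetric linear transformation $B$ on $M_{\gamma(0)}$ and $t\in(0,l]$, the point $\gamma(t)$ is a focal point of $\gamma(0)$ with respect to $B$ on $\gamma$ if there is a Jacobi field $J$ along $\gamma|_{[0,t]}$ with $J(t)=0$, $0\neq J(0)\in M_{\gamma(0)}$ and $J'(0)=B(J(0))$. "No focal point of $\gamma(0)$ with respect to $B$ on $\gamma$" means that no $t\in(0,l]$ has this property. Index form: for a piecewise smooth vector field $Z$ along $\gamma$, $$I_B(Z,Z)=\langle B(Z(0)),Z(0)\rangle+\int_0^l\left(\langle Z',Z'\rangle+\langle R(\gamma',Z)\gamma',Z\rangle\right)dt,$$ where the sign convention for the curvature tensor is such that for orthonormal $X,Y$ the sectional curvature is $K(X,Y)=\langle R(X,Y)Y,X\rangle$;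 thus $\langle R(\gamma',Z)\gamma',Z\rangle=-K(\gamma',Z)\,\|\gamma'\wedge Z\|^2$. *)

theory Defs
  imports "HOL-Analysis.Analysis"
begin

section \<open>Smooth maps\<close>

text \<open>
  Derivatives are taken within \<open>S\<close>. For open \<open>S\<close> this is the usual notion of a \<open>C\<^sup>k\<close> map; for a
  relatively open subset \<open>S\<close> of a nondegenerate real interval it uses one-sided derivatives at the
  end points. Only such sets \<open>S\<close> occur below (on other sets the derivative need not be unique).
\<close>

primrec Ck_on ::
  "nat \<Rightarrow> 'a::real_normed_vector set \<Rightarrow> ('a \<Rightarrow> 'b::real_normed_vector) \<Rightarrow> bool" where
  "Ck_on 0 S f \<longleftrightarrow> continuous_on S f"
| "Ck_on (Suc k) S f \<longleftrightarrow>
     f differentiable_on S \<and> (\<forall>v. Ck_on k S (\<lambda>x. frechet_derivative f (at x within S) v))"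

definition smooth_on ::
  "'a::real_normed_vector set \<Rightarrow> ('a \<Rightarrow> 'b::real_normed_vector) \<Rightarrow> bool" where
  "smooth_on S f \<longleftrightarrow> (\<forall>k. Ck_on k S f)"


section \<open>Smooth manifolds and tangent vectors\<close>

type_synonym ('a, 'n) chart = "'a set \<times> ('a \<Rightarrow> real ^ 'n)"

definition chart_inv :: "('a, 'n::finite) chart \<Rightarrow> real ^ 'n \<Rightarrow> 'a" where
  "chart_inv c = inv_into (fst c) (snd c)"

definition transition ::
  "('a, 'n::finite) chart \<Rightarrow> ('a, 'n) chart \<Rightarrow> real ^ 'n \<Rightarrow> real ^ 'n" where
  "transition c d = snd d \<circ> chart_inv c"

locale smooth_manifold =
  fixes X :: "'a topology" and A :: "('a, 'n::finite) chart set"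
  assumes hausdorff: "Hausdorff_space X"
    and second_countable: "second_countable X"
    and charts_cover: "(\<Union>c\<in>A. fst c) = topspace X"
    and chart_dom_open: "c \<in> A \<Longrightarrow> openin X (fst c)"
    and chart_img_open: "c \<in> A \<Longrightarrow> open (snd c ` fst c)"
    and chart_homeo: "c \<in> A \<Longrightarrow>
      homeomorphic_map (subtopology X (fst c)) (top_of_set (snd c ` fst c)) (snd c)"
    and transition_smooth: "c \<in> A \<Longrightarrow> d \<in> A \<Longrightarrow>
      smooth_on (snd c ` (fst c \<inter> fst d)) (transition c d)"

text \<open>
  A tangent vector at \<open>p\<close> is the family of its coordinate vectors in all charts around \<open>p\<close>, related
  by the differentials of the transition maps. The entries belonging to all other charts are fixed
  to be 0, so that equality of tangent vectors is equality of functions. The vector space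
  operations are pointwise.
\<close>

type_synonym ('a, 'n) tvec = "('a, 'n) chart \<Rightarrow> real ^ 'n"

definition tangent_space ::
  "('a, 'n::finite) chart set \<Rightarrow> 'a \<Rightarrow> ('a, 'n) tvec set" where
  "tangent_space A p = {v.
     (\<forall>c\<in>A. \<forall>d\<in>A. p \<in> fst c \<and> p \<in> fst d \<longrightarrow>
        v d = frechet_derivative (transition c d) (at (snd c p)) (v c)) \<and>
     (\<forall>c. \<not> (c \<in> A \<and> p \<in> fst c) \<longrightarrow> v c = 0)}"

text \<open>The tangent vector at \<open>p\<close> with coordinates \<open>v\<close> in the chart \<open>c\<close>:\<close>

definition coord_vec ::
  "('a, 'n::finite) chart set \<Rightarrow> ('a, 'n) chart \<Rightarrow> 'a \<Rightarrow> real ^ 'n \<Rightarrow> ('a, 'n) tvec" where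
  "coord_vec A c p v = (\<lambda>d.
     if d \<in> A \<and> p \<in> fst d then frechet_derivative (transition c d) (at (snd c p)) v else 0)"

definition linear_on_tangent_space ::
  "('a, 'n::finite) chart set \<Rightarrow> 'a \<Rightarrow> (('a, 'n) tvec \<Rightarrow> ('a, 'n) tvec) \<Rightarrow> bool" where
  "linear_on_tangent_space A p B \<longleftrightarrow>
     (\<forall>u\<in>tangent_space A p. B u \<in> tangent_space A p) \<and>
     (\<forall>u\<in>tangent_space A p. \<forall>v\<in>tangent_space A p. \<forall>a b.
        B (\<lambda>c. a *\<^sub>R u c + b *\<^sub>R v c) = (\<lambda>c. a *\<^sub>R B u c + b *\<^sub>R B v c))"


section \<open>Riemannian metrics, Christoffel symbols and curvature\<close>

type_synonym ('a, 'n) metric_tensor = "'a \<Rightarrow> ('a, 'n) tvec \<Rightarrow> ('a, 'n) tvec \<Rightarrow> real"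

definition metric_coeff ::
  "('a, 'n::finite) chart set \<Rightarrow> ('a, 'n) metric_tensor \<Rightarrow> ('a, 'n) chart \<Rightarrow>
    real ^ 'n \<Rightarrow> real ^ 'n ^ 'n" where
  "metric_coeff A g c x = (\<chi> i j.
     g (chart_inv c x) (coord_vec A c (chart_inv c x) (axis i 1))
                       (coord_vec A c (chart_inv c x) (axis j 1)))"

locale riemannian_manifold = smooth_manifold X A
  for X :: "'a topology" and A :: "('a, 'n::finite) chart set" +
  fixes g :: "('a, 'n) metric_tensor"
  assumes metric_linear: "\<lbrakk>p \<in> topspace X; u \<in> tangent_space A p; v \<in> tangent_space A p;
        w \<in> tangent_space A p\<rbrakk>
      \<Longrightarrow> g p (\<lambda>c. a *\<^sub>R u c + b *\<^sub>R v c) w = a * g p u w + b * g p v w"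
    and metric_sym: "\<lbrakk>p \<in> topspace X; u \<in> tangent_space A p; v \<in> tangent_space A p\<rbrakk>
      \<Longrightarrow> g p u v = g p v u"
    and metric_pos: "\<lbrakk>p \<in> topspace X; u \<in> tangent_space A p; u \<noteq> (\<lambda>_. 0)\<rbrakk> \<Longrightarrow> g p u u > 0"
    and metric_smooth: "c \<in> A \<Longrightarrow> smooth_on (snd c ` fst c) (metric_coeff A g c)"

definition pderiv_at ::
  "(real ^ 'n \<Rightarrow> real) \<Rightarrow> 'n::finite \<Rightarrow> real ^ 'n \<Rightarrow> real" where
  "pderiv_at f i x = frechet_derivative f (at x) (axis i 1)"

text \<open>
  \<open>christoffel A g c x k i j\<close> is the symbol of the Levi-Civita connection with upper index \<open>k\<close> and
  lower indices \<open>i\<close>, \<open>j\<close>, at the point with coordinates \<open>x\<close> in the chart \<open>c\<close>.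
\<close>

definition christoffel ::
  "('a, 'n::finite) chart set \<Rightarrow> ('a, 'n) metric_tensor \<Rightarrow> ('a, 'n) chart \<Rightarrow>
    real ^ 'n \<Rightarrow> 'n \<Rightarrow> 'n \<Rightarrow> 'n \<Rightarrow> real" where
  "christoffel A g c x k i j = (\<Sum>m\<in>UNIV. matrix_inv (metric_coeff A g c x) $ k $ m *
     (pderiv_at (\<lambda>y. metric_coeff A g c y $ j $ m) i x
    + pderiv_at (\<lambda>y. metric_coeff A g c y $ i $ m) j x
    - pderiv_at (\<lambda>y. metric_coeff A g c y $ i $ j) m x)) / 2"

text \<open>
  The following facts justify the name Levi-Civita connection: \<open>christoffel\<close> is symmetric in the
  lower indices and compatible with the metric.
\<close>

context smooth_manifold begin

lemma inj_chart:
  assumes "c \<in> A" shows "inj_on (snd c) (fst c)"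
  using homeomorphic_imp_injective_map[OF chart_homeo[OF assms]]
    openin_subset[OF chart_dom_open[OF assms]]
  by (simp add: Int_absorb1)

lemma chart_inv_left: "c \<in> A \<Longrightarrow> p \<in> fst c \<Longrightarrow> chart_inv c (snd c p) = p"
  by (simp add: chart_inv_def inj_chart)

lemma overlap_open:
  assumes c: "c \<in> A" and V: "openin X V" shows "open (snd c ` (fst c \<inter> V))"
proof -
  have "openin (subtopology X (fst c)) (fst c \<inter> V)"
    using V by (metis inf_commute openin_subtopology)
  then have "openin (top_of_set (snd c ` fst c)) (snd c ` (fst c \<inter> V))"
    using homeomorphic_imp_open_map[OF chart_homeo[OF c]] unfolding open_map_def by blast
  then show ?thesis using chart_img_open[OF c] openin_open_trans by blast
qed

lemma transition_diff:
  assumes "c \<in> A" "d \<in> A" "p \<in> fst c" "p \<in> fst d"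
  shows "(transition c d has_derivative frechet_derivative (transition c d) (at (snd c p))) (at (snd c p))"
proof -
  have "transition c d differentiable_on (snd c ` (fst c \<inter> fst d))"
    using transition_smooth[OF assms(1,2)] unfolding smooth_on_def by (metis Ck_on.simps(2))
  moreover have "open (snd c ` (fst c \<inter> fst d))"
    using overlap_open assms chart_dom_open by blast
  ultimately have "transition c d differentiable (at (snd c p))"
    using assms differentiable_on_eq_differentiable_at by blast
  then show ?thesis using frechet_derivative_works by blast
qed

lemma chain:
  assumes "c \<in> A" "d \<in> A" "e \<in> A" "p \<in> fst c" "p \<in> fst d" "p \<in> fst e"
  shows "frechet_derivative (transition c e) (at (snd c p)) v =
     frechet_derivative (transition d e) (at (snd d p)) (frechet_derivative (transition c d) (at (snd c p)) v)"
proof -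
  have t: "transition c d (snd c p) = snd d p"
    using assms by (simp add: transition_def chart_inv_left)
  let ?S = "snd c ` (fst c \<inter> (fst d \<inter> fst e))"
  have S: "open ?S" using overlap_open assms chart_dom_open by blast
  have "(transition d e \<circ> transition c d has_derivative
     frechet_derivative (transition d e) (at (snd d p)) \<circ> frechet_derivative (transition c d) (at (snd c p))) (at (snd c p))"
    by (rule diff_chain_at) (use transition_diff assms t in auto)
  note D = this
  have "(transition d e \<circ> transition c d) x = transition c e x" if "x \<in> ?S" for x
    using that assms by (auto simp: transition_def chart_inv_left)
  note E = this
  have "(transition c e has_derivative
     frechet_derivative (transition d e) (at (snd d p)) \<circ> frechet_derivative (transition c d) (at (snd c p))) (at (snd c p))"
    by (rule has_derivative_transform_within_open[OF D S _ E]) (use assms in auto)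
  from frechet_derivative_at[OF this] show ?thesis by (simp add: fun_eq_iff)
qed

lemma coord_vec_tangent:
  assumes c: "c \<in> A" and p: "p \<in> fst c" shows "coord_vec A c p v \<in> tangent_space A p"
proof -
  have "coord_vec A c p v e = frechet_derivative (transition d e) (at (snd d p)) (coord_vec A c p v d)"
    if "d \<in> A" "e \<in> A" "p \<in> fst d" "p \<in> fst e" for d e
    using that chain[OF c that(1,2) p that(3,4), of v] by (simp only: coord_vec_def simp_thms if_True)
  moreover have "coord_vec A c p v d = 0" if "\<not> (d \<in> A \<and> p \<in> fst d)" for d
    unfolding coord_vec_def using that by (rule if_not_P)
  ultimately show ?thesis unfolding tangent_space_def by blast
qed

lemma coord_vec_self:
  assumes "c \<in> A" "p \<in> fst c" shows "coord_vec A c p v c = v"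
proof -
  have S: "open (snd c ` fst c)" using chart_img_open assms by blast
  have "(transition c c has_derivative id) (at (snd c p))"
    by (rule has_derivative_transform_within_open[OF has_derivative_id S])
       (use assms in \<open>auto simp: transition_def chart_inv_left\<close>)
  then have "frechet_derivative (transition c c) (at (snd c p)) = id"
    by (rule frechet_derivative_at[symmetric])
  then show ?thesis using assms by (simp add: coord_vec_def)
qed

lemma coord_vec_sum:
  assumes "c \<in> A" "p \<in> fst c"
  shows "coord_vec A c p (a *\<^sub>R u + b *\<^sub>R v) = (\<lambda>d. a *\<^sub>R coord_vec A c p u d + b *\<^sub>R coord_vec A c p v d)"
proof
  fix d
  show "coord_vec A c p (a *\<^sub>R u + b *\<^sub>R v) d = a *\<^sub>R coord_vec A c p u d + b *\<^sub>R coord_vec A c p v d"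
  proof (cases "d \<in> A \<and> p \<in> fst d")
    case True
    then interpret bounded_linear "frechet_derivative (transition c d) (at (snd c p))"
      using transition_diff assms has_derivative_bounded_linear by blast
    show ?thesis using True by (simp add: coord_vec_def add scaleR)
  next
    case False
    then have "coord_vec A c p z d = 0" for z unfolding coord_vec_def by (rule if_not_P)
    then show ?thesis by simp
  qed
qed

end

context riemannian_manifold begin

lemma gform:
  assumes c: "c \<in> A" and p: "p \<in> fst c"
  shows "g p (coord_vec A c p u) (coord_vec A c p v)
    = (\<Sum>i\<in>UNIV. \<Sum>j\<in>UNIV. metric_coeff A g c (snd c p) $ i $ j * u $ i * v $ j)"
proof -
  have pX: "p \<in> topspace X" using charts_cover c p by blast
  let ?h = "\<lambda>u v. g p (coord_vec A c p u) (coord_vec A c p v)"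
  have l: "?h (a *\<^sub>R u + b *\<^sub>R v) w = a * ?h u w + b * ?h v w" for a b u v w
    using metric_linear[OF pX] coord_vec_tangent[OF c p] coord_vec_sum[OF c p] by simp
  have s: "?h u v = ?h v u" for u v
    using metric_sym[OF pX] coord_vec_tangent[OF c p] by blast
  have l1: "linear (\<lambda>u. ?h u v)" for v
    by (rule linearI) (use l[of 1 _ 1] l[of _ _ 0] in auto)
  have l2: "linear (\<lambda>v. ?h u v)" for u
    unfolding s[of u] by (rule l1)
  have "?h u v = ?h (\<Sum>i\<in>UNIV. u $ i *\<^sub>R axis i 1) (\<Sum>j\<in>UNIV. v $ j *\<^sub>R axis j 1)"
    using basis_expansion[of u] basis_expansion[of v] by (simp add: scalar_mult_eq_scaleR)
  also have "\<dots> = (\<Sum>i\<in>UNIV. \<Sum>j\<in>UNIV. u $ i * (v $ j * ?h (axis i 1) (axis j 1)))"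
    by (simp add: linear_sum[OF l1] linear_sum[OF l2] linear_cmul[OF l1] linear_cmul[OF l2] sum_distrib_left)
       (subst sum.swap, simp add: mult_ac)
  finally show ?thesis
    using c p by (simp add: metric_coeff_def chart_inv_left mult_ac)
qed

lemma metric_coeff_sym:
  assumes c: "c \<in> A" and p: "p \<in> fst c"
  shows "metric_coeff A g c (snd c p) $ i $ j = metric_coeff A g c (snd c p) $ j $ i"
proof -
  have pX: "p \<in> topspace X" using charts_cover c p by blast
  have "metric_coeff A g c (snd c p) $ i $ j =
      g p (coord_vec A c p (axis i 1)) (coord_vec A c p (axis j 1))" for i j
    by (simp add: metric_coeff_def chart_inv_left[OF c p])
  then show ?thesis
    using metric_sym[OF pX coord_vec_tangent[OF c p] coord_vec_tangent[OF c p]] by metis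
qed

lemma pderiv_metric_coeff_sym:
  assumes c: "c \<in> A" and x: "x \<in> snd c ` fst c"
  shows "pderiv_at (\<lambda>y. metric_coeff A g c y $ i $ j) m x =
    pderiv_at (\<lambda>y. metric_coeff A g c y $ j $ i) m x"
proof -
  have S: "open (snd c ` fst c)" using chart_img_open c by blast
  have sym: "metric_coeff A g c y $ i $ j = metric_coeff A g c y $ j $ i"
    if "y \<in> snd c ` fst c" for y i j
    using that metric_coeff_sym[OF c] by blast
  have "((\<lambda>y. metric_coeff A g c y $ j $ i) has_derivative D) (at x)"
    if "((\<lambda>y. metric_coeff A g c y $ i $ j) has_derivative D) (at x)" for D i j
    by (rule has_derivative_transform_within_open[OF that S x]) (rule sym)
  then have "((\<lambda>y. metric_coeff A g c y $ i $ j) has_derivative D) (at x) \<longleftrightarrow>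
      ((\<lambda>y. metric_coeff A g c y $ j $ i) has_derivative D) (at x)" for D
    by blast
  then show ?thesis unfolding pderiv_at_def frechet_derivative_def by presburger
qed

lemma metric_coeff_inv:
  assumes c: "c \<in> A" and p: "p \<in> fst c"
  shows "invertible (metric_coeff A g c (snd c p))"
proof -
  let ?G = "metric_coeff A g c (snd c p)"
  have pX: "p \<in> topspace X" using charts_cover c p by blast
  have "v = 0" if "?G *v v = 0" for v
  proof (rule ccontr)
    assume "v \<noteq> 0"
    then have "coord_vec A c p v \<noteq> (\<lambda>_. 0)" using coord_vec_self[OF c p, of v] by metis
    then have "g p (coord_vec A c p v) (coord_vec A c p v) > 0"
      using metric_pos pX coord_vec_tangent[OF c p] by blast
    moreover have "g p (coord_vec A c p v) (coord_vec A c p v) = v \<bullet> (?G *v v)"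
      unfolding gform[OF c p] by (simp add: inner_vec_def matrix_vector_mult_def sum_distrib_left mult_ac)
    ultimately show False using that by simp
  qed
  then show ?thesis
    using matrix_left_invertible_ker[of ?G] invertible_left_inverse by blast
qed

lemma christoffel_torsion_free:
  assumes c: "c \<in> A" and x: "x \<in> snd c ` fst c"
  shows "christoffel A g c x k i j = christoffel A g c x k j i"
  unfolding christoffel_def pderiv_metric_coeff_sym[OF c x, of i j]
  by (simp only: add.commute)

lemma christoffel_metric:
  assumes c: "c \<in> A" and x: "x \<in> snd c ` fst c"
  shows "pderiv_at (\<lambda>y. metric_coeff A g c y $ i $ j) k x
    = (\<Sum>l\<in>UNIV. christoffel A g c x l k i * metric_coeff A g c x $ l $ j
              + christoffel A g c x l k j * metric_coeff A g c x $ i $ l)"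
proof -
  let ?G = "metric_coeff A g c x"
  define P where "P i j m = pderiv_at (\<lambda>y. metric_coeff A g c y $ i $ j) m x" for i j m
  obtain p where p: "p \<in> fst c" "x = snd c p" using x by blast
  have Gs: "?G $ i $ l = ?G $ l $ i" for i l
    unfolding p(2) by (rule metric_coeff_sym[OF c p(1)])
  have Ps: "P i j m = P j i m" for i j m
    unfolding P_def by (rule pderiv_metric_coeff_sym[OF c x])
  have I: "?G ** matrix_inv ?G = mat 1"
    using someI_ex[OF metric_coeff_inv[OF c p(1), unfolded invertible_def]]
    unfolding matrix_inv_def p(2) by (rule conjunct1)
  have low: "(\<Sum>l\<in>UNIV. ?G $ j $ l * christoffel A g c x l k i) = (P i j k + P k j i - P k i j) / 2" for i j k
  proof -
    have "(\<Sum>l\<in>UNIV. ?G $ j $ l * christoffel A g c x l k i)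
       = (\<Sum>l\<in>UNIV. \<Sum>m\<in>UNIV. ?G $ j $ l * matrix_inv ?G $ l $ m * (P i m k + P k m i - P k i m) / 2)"
      by (simp add: christoffel_def P_def sum_distrib_left sum_divide_distrib mult.assoc)
    also have "\<dots> = (\<Sum>m\<in>UNIV. (?G ** matrix_inv ?G) $ j $ m * (P i m k + P k m i - P k i m) / 2)"
      by (subst sum.swap) (simp add: matrix_matrix_mult_def sum_distrib_right sum_divide_distrib)
    also have "\<dots> = (P i j k + P k j i - P k i j) / 2"
      unfolding I by (simp add: mat_def if_distrib if_distribR sum.delta cong: if_cong)
    finally show ?thesis .
  qed
  have "(\<Sum>l\<in>UNIV. christoffel A g c x l k i * ?G $ l $ j + christoffel A g c x l k j * ?G $ i $ l)
    = (\<Sum>l\<in>UNIV. ?G $ j $ l * christoffel A g c x l k i) + (\<Sum>l\<in>UNIV. ?G $ i $ l * christoffel A g c x l k j)"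
    by (simp add: sum.distrib Gs[of _ j] mult.commute)
  also have "\<dots> = P i j k" unfolding low Ps[of j i k] by (simp add: field_simps)
  finally show ?thesis by (simp add: P_def)
qed
end

text \<open>
  Coordinate expression of \<open>R(u,v)w = \<nabla>\<^sub>u\<nabla>\<^sub>vw - \<nabla>\<^sub>v\<nabla>\<^sub>uw - \<nabla>\<^bsub>[u,v]\<^esub>w\<close>. With this sign the sectional
  curvature of orthonormal \<open>u\<close>, \<open>v\<close> is \<open>g(R(u,v)v, u)\<close>.
\<close>

definition curvature ::
  "('a, 'n::finite) chart set \<Rightarrow> ('a, 'n) metric_tensor \<Rightarrow> 'a \<Rightarrow>
    ('a, 'n) tvec \<Rightarrow> ('a, 'n) tvec \<Rightarrow> ('a, 'n) tvec \<Rightarrow> ('a, 'n) tvec" where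
  "curvature A g p u v w = (\<lambda>c. if c \<in> A \<and> p \<in> fst c then
     (let \<Gamma> = christoffel A g c; x = snd c p in
       \<chi> l. \<Sum>i\<in>UNIV. \<Sum>j\<in>UNIV. \<Sum>k\<in>UNIV.
         (pderiv_at (\<lambda>y. \<Gamma> y l j k) i x - pderiv_at (\<lambda>y. \<Gamma> y l i k) j x
           + (\<Sum>m\<in>UNIV. \<Gamma> x l i m * \<Gamma> x m j k - \<Gamma> x l j m * \<Gamma> x m i k))
         * (u c $ i) * (v c $ j) * (w c $ k))
     else 0)"


section \<open>Curves and vector fields along them\<close>

text \<open>
  A curve on \<open>[0,b]\<close> and the fields along it are functions on the reals whose values outside \<open>[0,b]\<close>
  are irrelevant; all derivatives are taken within \<open>[0,b]\<close>.
\<close>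

definition smooth_curve ::
  "'a topology \<Rightarrow> ('a, 'n::finite) chart set \<Rightarrow> (real \<Rightarrow> 'a) \<Rightarrow> real \<Rightarrow> bool" where
  "smooth_curve X A \<gamma> b \<longleftrightarrow> continuous_map (top_of_set {0..b}) X \<gamma> \<and>
     (\<forall>c\<in>A. smooth_on {t \<in> {0..b}. \<gamma> t \<in> fst c} (snd c \<circ> \<gamma>))"

definition velocity ::
  "('a, 'n::finite) chart set \<Rightarrow> (real \<Rightarrow> 'a) \<Rightarrow> real \<Rightarrow> real \<Rightarrow> ('a, 'n) tvec" where
  "velocity A \<gamma> b t = (\<lambda>c. if c \<in> A \<and> \<gamma> t \<in> fst c
     then vector_derivative (snd c \<circ> \<gamma>) (at t within {0..b}) else 0)"

definition field_along ::
  "('a, 'n::finite) chart set \<Rightarrow> (real \<Rightarrow> 'a) \<Rightarrow> real \<Rightarrow> (real \<Rightarrow> ('a, 'n) tvec) \<Rightarrow> bool" where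
  "field_along A \<gamma> b Z \<longleftrightarrow> (\<forall>t\<in>{0..b}. Z t \<in> tangent_space A (\<gamma> t))"

definition field_smooth_on ::
  "('a, 'n::finite) chart set \<Rightarrow> (real \<Rightarrow> 'a) \<Rightarrow> (real \<Rightarrow> ('a, 'n) tvec) \<Rightarrow> real set \<Rightarrow> bool" where
  "field_smooth_on A \<gamma> Z I \<longleftrightarrow> (\<forall>c\<in>A. smooth_on {t \<in> I. \<gamma> t \<in> fst c} (\<lambda>t. Z t c))"

definition piecewise_smooth_field ::
  "('a, 'n::finite) chart set \<Rightarrow> (real \<Rightarrow> 'a) \<Rightarrow> real \<Rightarrow> (real \<Rightarrow> ('a, 'n) tvec) \<Rightarrow> bool" where
  "piecewise_smooth_field A \<gamma> b Z \<longleftrightarrow> field_along A \<gamma> b Z \<and>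
     (\<forall>c\<in>A. continuous_on {t \<in> {0..b}. \<gamma> t \<in> fst c} (\<lambda>t. Z t c)) \<and>
     (\<exists>(N::nat) \<tau>. \<tau> 0 = 0 \<and> \<tau> N = b \<and>
        (\<forall>i<N. \<tau> i < \<tau> (Suc i) \<and> field_smooth_on A \<gamma> Z {\<tau> i..\<tau> (Suc i)}))"

text \<open>
  At the finitely many times where a piecewise smooth \<open>Z\<close> is not differentiable the value is
  unspecified; these times do not affect the integral in the index form.
\<close>

definition cov_deriv ::
  "('a, 'n::finite) chart set \<Rightarrow> ('a, 'n) metric_tensor \<Rightarrow> (real \<Rightarrow> 'a) \<Rightarrow> real \<Rightarrow>
    (real \<Rightarrow> ('a, 'n) tvec) \<Rightarrow> real \<Rightarrow> ('a, 'n) tvec" where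
  "cov_deriv A g \<gamma> b Z t = (\<lambda>c. if c \<in> A \<and> \<gamma> t \<in> fst c then
     vector_derivative (\<lambda>s. Z s c) (at t within {0..b})
       + (\<chi> k. \<Sum>i\<in>UNIV. \<Sum>j\<in>UNIV.
            christoffel A g c (snd c (\<gamma> t)) k i j * (velocity A \<gamma> b t c $ i) * (Z t c $ j))
     else 0)"

definition normal_geodesic ::
  "'a topology \<Rightarrow> ('a, 'n::finite) chart set \<Rightarrow> ('a, 'n) metric_tensor \<Rightarrow>
    (real \<Rightarrow> 'a) \<Rightarrow> real \<Rightarrow> bool" where
  "normal_geodesic X A g \<gamma> l \<longleftrightarrow> l > 0 \<and> smooth_curve X A \<gamma> l \<and>
     (\<forall>t\<in>{0..l}. cov_deriv A g \<gamma> l (velocity A \<gamma> l) t = (\<lambda>_. 0)) \<and>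
     (\<forall>t\<in>{0..l}. sqrt (g (\<gamma> t) (velocity A \<gamma> l t) (velocity A \<gamma> l t)) = 1)"

definition jacobi_field ::
  "('a, 'n::finite) chart set \<Rightarrow> ('a, 'n) metric_tensor \<Rightarrow> (real \<Rightarrow> 'a) \<Rightarrow> real \<Rightarrow>
    (real \<Rightarrow> ('a, 'n) tvec) \<Rightarrow> bool" where
  "jacobi_field A g \<gamma> b J \<longleftrightarrow> field_along A \<gamma> b J \<and> field_smooth_on A \<gamma> J {0..b} \<and>
     (\<forall>t\<in>{0..b}. \<forall>c.
        cov_deriv A g \<gamma> b (cov_deriv A g \<gamma> b J) t c
          + curvature A g (\<gamma> t) (J t) (velocity A \<gamma> b t) (velocity A \<gamma> b t) c = 0)"

definition symmetric_transformation ::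
  "('a, 'n::finite) chart set \<Rightarrow> ('a, 'n) metric_tensor \<Rightarrow> 'a \<Rightarrow>
    (('a, 'n) tvec \<Rightarrow> ('a, 'n) tvec) \<Rightarrow> bool" where
  "symmetric_transformation A g p B \<longleftrightarrow> linear_on_tangent_space A p B \<and>
     (\<forall>u\<in>tangent_space A p. \<forall>v\<in>tangent_space A p. g p (B u) v = g p u (B v))"

definition focal_point ::
  "('a, 'n::finite) chart set \<Rightarrow> ('a, 'n) metric_tensor \<Rightarrow> (real \<Rightarrow> 'a) \<Rightarrow>
    (('a, 'n) tvec \<Rightarrow> ('a, 'n) tvec) \<Rightarrow> real \<Rightarrow> bool" where
  "focal_point A g \<gamma> B t \<longleftrightarrow>
     (\<exists>J. jacobi_field A g \<gamma> t J \<and> J t = (\<lambda>_. 0) \<and> J 0 \<noteq> (\<lambda>_. 0) \<and>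
          cov_deriv A g \<gamma> t J 0 = B (J 0))"

definition index_form ::
  "('a, 'n::finite) chart set \<Rightarrow> ('a, 'n) metric_tensor \<Rightarrow> (real \<Rightarrow> 'a) \<Rightarrow> real \<Rightarrow>
    (('a, 'n) tvec \<Rightarrow> ('a, 'n) tvec) \<Rightarrow> (real \<Rightarrow> ('a, 'n) tvec) \<Rightarrow> real" where
  "index_form A g \<gamma> l B Z = g (\<gamma> 0) (B (Z 0)) (Z 0)
     + integral {0..l} (\<lambda>t.
         g (\<gamma> t) (cov_deriv A g \<gamma> l Z t) (cov_deriv A g \<gamma> l Z t)
       + g (\<gamma> t) (curvature A g (\<gamma> t) (velocity A \<gamma> l t) (Z t) (velocity A \<gamma> l t)) (Z t))"

end

theory Submission
  imports Defs
begin

text \<open>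
  In a parallel frame along the geodesic, fields become maps \<open>w\<close> into \<open>\<real>\<^sup>n\<close>, covariant differentiation
  becomes ordinary differentiation, the metric becomes a constant inner product \<open>q\<close>, and the Jacobi
  equation becomes \<open>f'' + K f = 0\<close> with \<open>K\<close> self-adjoint for \<open>q\<close>. Let \<open>Y\<close> be the matrix solution with
  \<open>Y 0 = 1\<close> and \<open>Y' 0 = B\<close>. Absence of focal points means that \<open>Y\<close> is invertible on \<open>[0,l]\<close>; then
  \<open>U = Y' Y\<^sup>-\<^sup>1\<close> is self-adjoint, by constancy of the Wronskian, and solves the Riccati equation
  \<open>U' = - K - U\<^sup>2\<close>. Completing the square gives
  \<open>I\<^sub>B(w,w) = q(U(l) w(l), w(l)) + \<integral> q(w' - U w, w' - U w)\<close>, and the integrand vanishes identically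
  exactly if \<open>w = Y c\<close> for a constant \<open>c\<close>, which is the Jacobi field in question.
\<close>

section \<open>Calculus of \<open>C\<^sup>k\<close> maps\<close>

text \<open>The curve need not lie in one chart. Transport solved chart by chart yields a single
  frame only if the transport equation means the same in overlapping charts, so the transformation
  laws of connection and curvature have to be derived from the Christoffel symbols. In the other
  direction, a solution in the frame must be shown to be a smooth field in every chart it meets,
  although only continuity of \<open>K\<close> is established in the frame.

  The form q(U w, w) enters because the Riccati equation makes its derivative differ from the index
  integrand by exactly a square. Its value at 0 is q(b w(0), w(0)), as U(0) = b, and cancels the
  boundary term of the index form; its values at the corners telescope, as w is continuous; its
  value at l is the same for V and W. What remains to be compared are the integrals of the squares,
  and the one for V is 0. Focal points meet invertibility through kernels: if Y(t) z = 0 with z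
  nonzero, then Y z is a Jacobi field with initial value z that vanishes at t.\<close>

text \<open>Derivatives within such a set are unique.\<close>

definition thick :: "'a::euclidean_space set \<Rightarrow> bool" where
  "thick S \<longleftrightarrow> (\<forall>x\<in>S. \<forall>i\<in>Basis. \<forall>e>0. \<exists>d. 0 < \<bar>d\<bar> \<and> \<bar>d\<bar> < e \<and> x + d *\<^sub>R i \<in> S)"

lemma thick_open:
  assumes "open S" shows "thick S"
  unfolding thick_def
proof (intro ballI allI impI)
  fix x and i :: 'a and e :: real assume x: "x \<in> S" "i \<in> Basis" "e > 0"
  obtain r where r: "r > 0" "ball x r \<subseteq> S" using assms x open_contains_ball by blast
  define d where "d = min (e/2) (r/2)"
  have "0 < d" "d < e" "d < r" using r x by (auto simp: d_def)
  moreover have "x + d *\<^sub>R i \<in> ball x r" using x \<open>0 < d\<close> \<open>d < r\<close> by (simp add: dist_norm)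
  ultimately show "\<exists>d. 0 < \<bar>d\<bar> \<and> \<bar>d\<bar> < e \<and> x + d *\<^sub>R i \<in> S" using r by (intro exI[of _ d]) auto
qed

lemma thick_openin_interval:
  fixes a b :: real
  assumes "a < b" "openin (top_of_set {a..b}) S" shows "thick S"
  unfolding thick_def
proof (intro ballI allI impI)
  fix x i e :: real assume x: "x \<in> S" "i \<in> Basis" "e > 0"
  have i: "i = 1" using x by simp
  obtain r where r: "r > 0" "ball x r \<inter> {a..b} \<subseteq> S"
    using assms(2) x by (auto simp: openin_contains_ball)
  have xab: "a \<le> x" "x \<le> b" using assms(2) x openin_imp_subset by fastforce+
  have "\<exists>d. 0 < \<bar>d\<bar> \<and> \<bar>d\<bar> < min e r \<and> x + d \<in> {a..b}"
  proof (cases "x < b")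
    case True
    then show ?thesis using xab r x by (intro exI[of _ "min (b - x) (min e r / 2)"]) auto
  next
    case False
    then show ?thesis using xab r x assms(1) by (intro exI[of _ "- min (x - a) (min e r / 2)"]) auto
  qed
  then obtain d where d: "0 < \<bar>d\<bar>" "\<bar>d\<bar> < e" "\<bar>d\<bar> < r" "x + d \<in> {a..b}" by auto
  have "x + d \<in> ball x r" using d by (simp add: dist_real_def)
  then show "\<exists>d. 0 < \<bar>d\<bar> \<and> \<bar>d\<bar> < e \<and> x + d *\<^sub>R i \<in> S" using d r i by (intro exI[of _ d]) auto
qed

text \<open>\<open>thick\<close> is the hypothesis of
  \<open>frechet_derivative_unique_within\<close>: arbitrarily short nonzero displacements inside S
  along every basis direction.\<close>

lemma has_derivative_unique_thick:
  assumes "thick S" "x \<in> S" "(f has_derivative f') (at x within S)" "(f has_derivative f'') (at x within S)"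
  shows "f' = f''"
  by (rule frechet_derivative_unique_within[OF assms(3,4)])
     (use assms(1,2) in \<open>auto simp: thick_def\<close>)

lemma frechet_derivative_thick:
  assumes "thick S" "x \<in> S" "(f has_derivative f') (at x within S)"
  shows "frechet_derivative f (at x within S) = f'"
  using assms by (meson differentiableI frechet_derivative_works has_derivative_unique_thick)

lemma Ck_on_has_derivative:
  "Ck_on (Suc k) S f \<Longrightarrow> x \<in> S \<Longrightarrow> (f has_derivative frechet_derivative f (at x within S)) (at x within S)"
  by (simp add: differentiable_on_def frechet_derivative_works)

text \<open>\<open>frechet_derivative\<close> is a choice from the predicate
  \<open>has_derivative\<close>, and this predicate is the same for two functions that agree on S.
  Hence the chosen derivatives coincide even where derivatives are not unique, and S may be
  arbitrary.\<close>

lemma Ck_on_cong: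
  assumes "Ck_on k S f" "\<And>x. x \<in> S \<Longrightarrow> f x = g x"
  shows "Ck_on k S g"
  using assms
proof (induction k arbitrary: f g)
  case 0
  then show ?case using continuous_on_cong by (metis Ck_on.simps(1))
next
  case (Suc k)
  have tr: "(g has_derivative D) (at x within S)" if "(f has_derivative D) (at x within S)" "x \<in> S"
      "\<And>x. x \<in> S \<Longrightarrow> f x = g x" for D x f g
    by (rule has_derivative_transform[OF that(2) _ that(1)]) (simp add: that(3))
  have eq: "frechet_derivative f (at x within S) = frechet_derivative g (at x within S)" if "x \<in> S" for x
    unfolding frechet_derivative_def using tr[of f _ x g] tr[of g _ x f] Suc.prems(2) that
    by (metis (no_types, lifting))
  show ?case
    using Suc.prems eq Suc.IH[of "\<lambda>x. frechet_derivative f (at x within S) _" "\<lambda>x. frechet_derivative g (at x within S) _"]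
    unfolding Ck_on.simps differentiable_on_def differentiable_def by (metis tr)
qed

text \<open>On a thick set any explicit derivative formula can replace
  \<open>frechet_derivative\<close>. The closure lemmas below become inductions on k over the usual
  differentiation rules.\<close>

lemma Ck_on_SucI:
  fixes f :: "'a::euclidean_space \<Rightarrow> 'b::real_normed_vector"
  assumes "thick S" "\<And>x. x \<in> S \<Longrightarrow> (f has_derivative f' x) (at x within S)"
    and "\<And>v. Ck_on k S (\<lambda>x. f' x v)"
  shows "Ck_on (Suc k) S f"
  using assms(2) frechet_derivative_thick[OF assms(1) _ assms(2)]
  by (auto simp: differentiable_on_def intro: differentiableI intro!: Ck_on_cong[OF assms(3)])

lemma Ck_on_Suc_imp: "Ck_on (Suc k) S f \<Longrightarrow> Ck_on k S f"
proof (induction k arbitrary: f)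
  case 0
  then show ?case using differentiable_imp_continuous_on by auto
next
  case (Suc k)
  then show ?case unfolding Ck_on.simps(2) by blast
qed

lemma Ck_on_imp_continuous_on: "Ck_on k S f \<Longrightarrow> continuous_on S f"
  by (induction k) (auto dest: Ck_on_Suc_imp simp del: Ck_on.simps(2))

lemma Ck_on_frechet:
  "Ck_on (Suc k) S f \<Longrightarrow> Ck_on k S (\<lambda>x. frechet_derivative f (at x within S) v)"
  by simp

lemma Ck_on_const [simp]: "thick S \<Longrightarrow> Ck_on k S (\<lambda>_. c)"
proof (induction k arbitrary: c)
  case (Suc k)
  show ?case by (rule Ck_on_SucI[where f'="\<lambda>_ _. 0"]) (use Suc in auto)
qed simp

lemma Ck_on_bounded_linear:
  assumes L: "bounded_linear L" and S: "thick S" and f: "Ck_on k S f"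
  shows "Ck_on k S (\<lambda>x. L (f x))"
  using f
proof (induction k arbitrary: f)
  case 0
  then show ?case using bounded_linear.continuous_on[OF L] by auto
next
  case (Suc k)
  show ?case
    by (rule Ck_on_SucI[OF S bounded_linear.has_derivative[OF L Ck_on_has_derivative[OF Suc.prems]]])
       (use Suc.IH Ck_on_frechet[OF Suc.prems] in auto)
qed

lemma Ck_on_add:
  assumes S: "thick S" and "Ck_on k S f" "Ck_on k S g"
  shows "Ck_on k S (\<lambda>x. f x + g x)"
  using assms(2,3)
proof (induction k arbitrary: f g)
  case 0
  then show ?case by (auto intro: continuous_intros)
next
  case (Suc k)
  show ?case
    by (rule Ck_on_SucI[OF S has_derivative_add[OF Ck_on_has_derivative[OF Suc.prems(1)]
            Ck_on_has_derivative[OF Suc.prems(2)]]])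
       (use Suc.IH Ck_on_frechet[OF Suc.prems(1)] Ck_on_frechet[OF Suc.prems(2)] in auto)
qed

lemma Ck_on_sum:
  assumes S: "thick S" and "\<And>i. i \<in> I \<Longrightarrow> Ck_on k S (f i)"
  shows "Ck_on k S (\<lambda>x. \<Sum>i\<in>I. f i x)"
  using assms(2)
proof (induction I rule: infinite_finite_induct)
  case (insert i I)
  then show ?case using Ck_on_add[OF S] by auto
qed (use S in auto)

text \<open>The product rule mixes f with the derivative of g and vice versa, so the induction must
  leave both functions arbitrary. Instances: products, scalar multiples, matrix-vector
  products.\<close>

lemma Ck_on_bilinear:
  assumes p: "bounded_bilinear p" and S: "thick S" and "Ck_on k S f" "Ck_on k S g"
  shows "Ck_on k S (\<lambda>x. p (f x) (g x))"
  using assms(3,4)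
proof (induction k arbitrary: f g)
  case 0
  then show ?case using bounded_bilinear.continuous_on[OF p] by auto
next
  case (Suc k)
  show ?case
    by (intro Ck_on_SucI[OF S bounded_bilinear.FDERIV[OF p Ck_on_has_derivative[OF Suc.prems(1)]
            Ck_on_has_derivative[OF Suc.prems(2)]]] Ck_on_add[OF S] Suc.IH
          Ck_on_frechet[OF Suc.prems(1)] Ck_on_frechet[OF Suc.prems(2)]
          Ck_on_Suc_imp[OF Suc.prems(1)] Ck_on_Suc_imp[OF Suc.prems(2)])
qed

lemmas Ck_on_mult = Ck_on_bilinear[OF bounded_bilinear_mult]
lemmas Ck_on_scaleR = Ck_on_bilinear[OF bounded_bilinear_scaleR]
lemmas Ck_on_minus = Ck_on_bounded_linear[OF bounded_linear_minus[OF bounded_linear_ident]]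

lemma Ck_on_diff:
  assumes S: "thick S" and "Ck_on k S f" "Ck_on k S g"
  shows "Ck_on k S (\<lambda>x. f x - g x)"
  using Ck_on_add[OF S assms(2) Ck_on_minus[OF S assms(3)]] by simp

text \<open>In the chain rule both the base point h x and the direction vary with x, whereas
  \<open>Ck_on\<close> speaks of derivatives in fixed directions. Expanding the direction in the
  basis leaves only fixed-direction derivatives of f, to which the induction hypothesis
  applies.\<close>

lemma Ck_on_compose:
  fixes f :: "'b::euclidean_space \<Rightarrow> 'c::real_normed_vector" and h :: "'a::euclidean_space \<Rightarrow> 'b"
  assumes S: "thick S" and hS: "h ` S \<subseteq> T" and "Ck_on k T f" "Ck_on k S h"
  shows "Ck_on k S (\<lambda>x. f (h x))"
  using assms(3,4)
proof (induction k arbitrary: f)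
  case 0
  then show ?case using hS by (auto intro: continuous_on_compose2)
next
  case (Suc k)
  let ?D = "\<lambda>y. frechet_derivative f (at y within T)"
  let ?H = "\<lambda>x. frechet_derivative h (at x within S)"
  have d: "((\<lambda>x. f (h x)) has_derivative (\<lambda>v. ?D (h x) (?H x v))) (at x within S)" if x: "x \<in> S" for x
  proof -
    have "(f has_derivative ?D (h x)) (at (h x) within h ` S)"
      using Ck_on_has_derivative[OF Suc.prems(1)] hS x by (blast intro: has_derivative_subset)
    from diff_chain_within[OF Ck_on_has_derivative[OF Suc.prems(2) x] this] show ?thesis
      by (simp add: o_def)
  qed
  have e: "(\<Sum>b\<in>Basis. (?H x v \<bullet> b) *\<^sub>R ?D (h x) b) = ?D (h x) (?H x v)" if x: "x \<in> S" for x v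
  proof -
    have l: "linear (?D (h x))"
      using Ck_on_has_derivative[OF Suc.prems(1)] hS x has_derivative_linear by blast
    have "?D (h x) (?H x v) = ?D (h x) (\<Sum>b\<in>Basis. (?H x v \<bullet> b) *\<^sub>R b)"
      by (simp add: euclidean_representation)
    then show ?thesis using l by (simp add: linear_sum linear_cmul)
  qed
  have h: "Ck_on k S h" using Ck_on_Suc_imp Suc by blast
  have "Ck_on k S (\<lambda>x. \<Sum>b\<in>Basis. (?H x v \<bullet> b) *\<^sub>R ?D (h x) b)" for v
    by (intro Ck_on_sum Ck_on_scaleR S Ck_on_bounded_linear[OF bounded_linear_inner_left] Suc.IH h
         Ck_on_frechet[OF Suc.prems(1)] Ck_on_frechet[OF Suc.prems(2)])
  from Ck_on_cong[OF this e] show ?case by (intro Ck_on_SucI[OF S d])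
qed

lemma Ck_on_id: assumes S: "thick S" shows "Ck_on k S (\<lambda>x. x)"
proof (cases k)
  case (Suc m)
  show ?thesis unfolding Suc
    by (rule Ck_on_SucI[where f'="\<lambda>_ v. v"]) (use S in auto)
qed simp

lemma Ck_on_subset:
  assumes "Ck_on k T f" "S \<subseteq> T" "thick S" shows "Ck_on k S f"
  using Ck_on_compose[OF assms(3) _ assms(1) Ck_on_id[OF assms(3)]] assms by simp

lemma Ck_on_inverse:
  fixes f :: "'a::euclidean_space \<Rightarrow> real"
  assumes S: "thick S" and f: "Ck_on k S f" and nz: "\<And>x. x \<in> S \<Longrightarrow> f x \<noteq> 0"
  shows "Ck_on k S (\<lambda>x. inverse (f x))"
  using f
proof (induction k)
  case 0
  then show ?case using nz by (auto intro: continuous_intros)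
next
  case (Suc k)
  have "Ck_on k S (\<lambda>x. - (inverse (f x) * frechet_derivative f (at x within S) v * inverse (f x)))" for v
    by (intro Ck_on_minus Ck_on_mult S Suc.IH Ck_on_Suc_imp[OF Suc.prems] Ck_on_frechet[OF Suc.prems])
  then show ?case
    by (intro Ck_on_SucI[OF S Deriv.has_derivative_inverse[OF nz Ck_on_has_derivative[OF Suc.prems]]]) auto
qed

lemma Ck_on_prod:
  fixes f :: "'i \<Rightarrow> 'a::euclidean_space \<Rightarrow> real"
  assumes S: "thick S" and "\<And>i. i \<in> I \<Longrightarrow> Ck_on k S (f i)"
  shows "Ck_on k S (\<lambda>x. \<Prod>i\<in>I. f i x)"
  using assms(2)
proof (induction I rule: infinite_finite_induct)
  case (insert i I)
  then show ?case using Ck_on_mult[OF S] by auto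
qed (use S in auto)

section \<open>Vector-valued and matrix-valued maps\<close>

lemma Ck_on_vec:
  fixes f :: "'a::euclidean_space \<Rightarrow> 'b::euclidean_space ^ 'n"
  assumes S: "thick S" and "\<And>i. Ck_on k S (\<lambda>x. f x $ i)"
  shows "Ck_on k S f"
proof -
  have b: "bounded_linear (\<lambda>x::'b. (axis i x :: 'b ^ 'n))" for i
    by (auto simp: linear_conv_bounded_linear[symmetric] axis_def vec_eq_iff intro!: linearI)
  have "Ck_on k S (\<lambda>x. \<Sum>i\<in>UNIV. axis i (f x $ i))"
    by (intro Ck_on_sum Ck_on_bounded_linear[OF b] assms)
  moreover have "(\<Sum>i\<in>UNIV. axis i (f x $ i)) = f x" for x
    by (simp add: vec_eq_iff axis_def if_distrib cong: if_cong)
  ultimately show ?thesis by simp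
qed

lemma Ck_on_nth:
  "thick S \<Longrightarrow> Ck_on k S f \<Longrightarrow> Ck_on k S (\<lambda>x. f x $ i)"
  by (rule Ck_on_bounded_linear[OF bounded_linear_vec_nth])

lemma Ck_on_det:
  fixes M :: "'a::euclidean_space \<Rightarrow> real ^ 'n ^ 'n"
  assumes S: "thick S" and M: "Ck_on k S M"
  shows "Ck_on k S (\<lambda>x. det (M x))"
  unfolding det_def by (intro Ck_on_sum Ck_on_mult Ck_on_prod Ck_on_nth Ck_on_const S M)

lemma matrix_inv_cancel:
  fixes M :: "'a::field ^ 'n ^ 'n" assumes "invertible M"
  shows "M ** matrix_inv M = mat 1" "matrix_inv M ** M = mat 1"
    "M *v (matrix_inv M *v x) = x" "matrix_inv M *v (M *v x) = x"
proof -
  show 1: "M ** matrix_inv M = mat 1" "matrix_inv M ** M = mat 1"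
    using someI_ex[OF assms[unfolded invertible_def]] unfolding matrix_inv_def by blast+
  show "M *v (matrix_inv M *v x) = x" "matrix_inv M *v (M *v x) = x"
    by (simp_all add: matrix_vector_mul_assoc 1)
qed

text \<open>By Cramer's rule the entries of the inverse are determinants, polynomial in the entries
  of M x, divided by the nonvanishing \<open>det (M x)\<close>.\<close>

lemma Ck_on_matrix_inv:
  fixes M :: "'a::euclidean_space \<Rightarrow> real ^ 'n ^ 'n"
  assumes S: "thick S" and M: "Ck_on k S M" and inv: "\<And>x. x \<in> S \<Longrightarrow> invertible (M x)"
  shows "Ck_on k S (\<lambda>x. matrix_inv (M x))"
proof -
  let ?C = "\<lambda>x j k. det (\<chi> i l. if l = k then axis j 1 $ i else M x $ i $ l) * inverse (det (M x))"
  have e: "(\<chi> k j. ?C x j k) = matrix_inv (M x)" if x: "x \<in> S" for x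
  proof -
    have "det (M x) \<noteq> 0" using inv[OF x] invertible_det_nz by blast
    \<comment> \<open>The j-th column of the inverse solves the linear system with right-hand side
      \<open>axis j 1\<close>.\<close>
    then have "matrix_inv (M x) *v axis j 1 = (\<chi> k. ?C x j k)" for j
      using cramer[of "M x" "matrix_inv (M x) *v axis j 1" "axis j 1"] matrix_inv_cancel[OF inv[OF x]]
      by (simp add: divide_inverse)
    then show ?thesis by (simp add: matrix_vector_mult_basis column_def vec_eq_iff)
  qed
  have nz: "det (M x) \<noteq> 0" if "x \<in> S" for x using inv[OF that] invertible_det_nz by blast
  have k: "Ck_on k S (\<lambda>x. if P then a else M x $ i $ l)" for P a i l
    using S M by (cases P) (auto intro: Ck_on_nth)
  have "Ck_on k S (\<lambda>x. (\<chi> k j. ?C x j k))"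
    by (intro Ck_on_vec S; simp)
       (intro Ck_on_mult Ck_on_det Ck_on_inverse S M nz Ck_on_vec; simp add: k S)
  from Ck_on_cong[OF this e] show ?thesis .
qed

lemma Ck_on_vector_derivativeI:
  assumes S: "thick S" and f: "\<And>t. t \<in> S \<Longrightarrow> (f has_vector_derivative f' t) (at t within S)"
    and "Ck_on k S f'"
  shows "Ck_on (Suc k) S f"
  by (rule Ck_on_SucI[OF S f[unfolded has_vector_derivative_def]])
     (use assms in \<open>auto intro: Ck_on_scaleR\<close>)

lemma Ck_on_vector_derivative:
  assumes S: "thick S" and f: "Ck_on (Suc k) S f"
  shows "t \<in> S \<Longrightarrow> (f has_vector_derivative vector_derivative f (at t within S)) (at t within S)"
    and "Ck_on k S (\<lambda>t. vector_derivative f (at t within S))"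
proof -
  have hv: "(f has_vector_derivative frechet_derivative f (at t within S) 1) (at t within S)" if "t \<in> S" for t
  proof -
    have "linear (frechet_derivative f (at t within S))"
      using Ck_on_has_derivative[OF f that] has_derivative_linear by blast
    then have "frechet_derivative f (at t within S) = (\<lambda>x. x *\<^sub>R frechet_derivative f (at t within S) 1)"
      by (metis linear_cmul mult.right_neutral real_scaleR_def)
    then show ?thesis using Ck_on_has_derivative[OF f that] unfolding has_vector_derivative_def by metis
  qed
  have "vector_derivative f (at t within S) = frechet_derivative f (at t within S) 1" if t: "t \<in> S" for t
  proof -
    have "(f has_vector_derivative vector_derivative f (at t within S)) (at t within S)"
      using hv[OF t] vector_derivative_works differentiableI_vector by blast
    from has_derivative_unique_thick[OF S t this[unfolded has_vector_derivative_def] hv[OF t, unfolded has_vector_derivative_def]]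
    show ?thesis by (metis scaleR_one)
  qed
  note e = this
  show "t \<in> S \<Longrightarrow> (f has_vector_derivative vector_derivative f (at t within S)) (at t within S)"
    using e hv by auto
  show "Ck_on k S (\<lambda>t. vector_derivative f (at t within S))"
    by (rule Ck_on_cong[OF Ck_on_frechet[OF f, of 1]]) (simp add: e)
qed

lemma vector_derivative_thick:
  assumes S: "thick S" and t: "t \<in> S" and f: "(f has_vector_derivative f') (at t within S)"
  shows "vector_derivative f (at t within S) = f'"
proof -
  have "(f has_vector_derivative vector_derivative f (at t within S)) (at t within S)"
    using f vector_derivative_works differentiableI_vector by blast
  from has_derivative_unique_thick[OF S t this[unfolded has_vector_derivative_def] f[unfolded has_vector_derivative_def]]
  show ?thesis by (metis scaleR_one)
qed

text \<open>The second difference over a parallelogram is an increment in s of the first difference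
  in the direction v. The mean value theorem in s brings in the derivative along u, and a second
  application in t differentiates that along v.\<close>

lemma second_difference_mean_value:
  fixes F :: "'a::euclidean_space \<Rightarrow> real"
  assumes F1: "\<And>y. y \<in> ball x r \<Longrightarrow> (F has_derivative F' y) (at y)"
    and F2: "\<And>y. y \<in> ball x r \<Longrightarrow> ((\<lambda>y. F' y u) has_derivative F2 y) (at y)"
    and h: "0 < h" "h * (norm u + norm v) < r"
  obtains s t where "0 < s" "s < h" "0 < t" "t < h"
    "F (x + h *\<^sub>R u + h *\<^sub>R v) - F (x + h *\<^sub>R u) - F (x + h *\<^sub>R v) + F x = h * h * F2 (x + s *\<^sub>R u + t *\<^sub>R v) v"
proof -
  have in_ball: "x + s *\<^sub>R u + t *\<^sub>R v \<in> ball x r" if "0 \<le> s" "s \<le> h" "0 \<le> t" "t \<le> h" for s t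
  proof -
    have "norm (s *\<^sub>R u + t *\<^sub>R v) \<le> s * norm u + t * norm v"
      using that norm_triangle_ineq[of "s *\<^sub>R u" "t *\<^sub>R v"] by simp
    also have "\<dots> \<le> h * norm u + h * norm v" using that by (intro add_mono mult_right_mono) auto
    finally have "norm (s *\<^sub>R u + t *\<^sub>R v) < r" using h by (simp add: algebra_simps)
    moreover have "dist x (x + s *\<^sub>R u + t *\<^sub>R v) = norm (s *\<^sub>R u + t *\<^sub>R v)"
      using norm_minus_cancel[of "s *\<^sub>R u + t *\<^sub>R v"] by (simp add: dist_norm algebra_simps)
    ultimately show ?thesis by simp
  qed
  \<comment> \<open>The redundant \<open>0 *\<^sub>R v\<close> gives both points the common shape x
    + s u + t v, so that one derivative computation serves for t = h and t = 0.\<close>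
  define \<phi> where "\<phi> s = F (x + s *\<^sub>R u + h *\<^sub>R v) - F (x + s *\<^sub>R u + 0 *\<^sub>R v)" for s
  have \<phi>: "(\<phi> has_derivative (\<lambda>k. k * (F' (x + s *\<^sub>R u + h *\<^sub>R v) u - F' (x + s *\<^sub>R u + 0 *\<^sub>R v) u))) (at s)"
    if s: "0 \<le> s" "s \<le> h" for s
  proof -
    have *: "((\<lambda>s. F (x + s *\<^sub>R u + t *\<^sub>R v)) has_derivative (\<lambda>k. F' (x + s *\<^sub>R u + t *\<^sub>R v) (k *\<^sub>R u))) (at s)"
      if "0 \<le> t" "t \<le> h" for t
      by (rule has_derivative_compose[where f="\<lambda>s. x + s *\<^sub>R u + t *\<^sub>R v", OF _ F1[OF in_ball]])
         (use s that in \<open>auto intro!: derivative_eq_intros\<close>)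
    have l: "linear (F' (x + s *\<^sub>R u + t *\<^sub>R v))" if "0 \<le> t" "t \<le> h" for t
      using F1[OF in_ball[OF s that]] has_derivative_linear by blast
    show ?thesis unfolding \<phi>_def
      by (rule has_derivative_eq_rhs[OF has_derivative_diff[OF *[of h] *[of 0]]])
         (use h l[of h] l[of 0] in \<open>auto simp: linear_cmul algebra_simps\<close>)
  qed
  have "continuous_on {0..h} \<phi>"
    using \<phi> by (intro continuous_at_imp_continuous_on ballI has_derivative_continuous) auto
  then obtain s where s: "0 < s" "s < h"
    "\<phi> h - \<phi> 0 = (h - 0) * (F' (x + s *\<^sub>R u + h *\<^sub>R v) u - F' (x + s *\<^sub>R u + 0 *\<^sub>R v) u)"
    by (rule mvt[OF h(1) _ \<phi>[OF less_imp_le less_imp_le]]) blast+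
  define \<psi> where "\<psi> t = F' (x + s *\<^sub>R u + t *\<^sub>R v) u" for t
  have \<psi>: "(\<psi> has_derivative (\<lambda>k. k * F2 (x + s *\<^sub>R u + t *\<^sub>R v) v)) (at t)" if t: "0 \<le> t" "t \<le> h" for t
  proof -
    have *: "((\<lambda>t. F' (x + s *\<^sub>R u + t *\<^sub>R v) u) has_derivative (\<lambda>k. F2 (x + s *\<^sub>R u + t *\<^sub>R v) (k *\<^sub>R v))) (at t)"
      by (rule has_derivative_compose[where f="\<lambda>t. x + s *\<^sub>R u + t *\<^sub>R v", OF _ F2[OF in_ball]])
         (use s t in \<open>auto intro!: derivative_eq_intros\<close>)
    have l: "linear (F2 (x + s *\<^sub>R u + t *\<^sub>R v))"
      using F2[OF in_ball[of s t]] s t has_derivative_linear by auto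
    show ?thesis unfolding \<psi>_def
      by (rule has_derivative_eq_rhs[OF *]) (use l in \<open>auto simp: linear_cmul\<close>)
  qed
  have "continuous_on {0..h} \<psi>"
    using \<psi> by (intro continuous_at_imp_continuous_on ballI has_derivative_continuous) auto
  then obtain t where t: "0 < t" "t < h" "\<psi> h - \<psi> 0 = (h - 0) * F2 (x + s *\<^sub>R u + t *\<^sub>R v) v"
    by (rule mvt[OF h(1) _ \<psi>[OF less_imp_le less_imp_le]]) blast+
  show ?thesis
  proof (rule that[OF s(1,2) t(1,2)])
    have "\<phi> h - \<phi> 0 = h * (\<psi> h - \<psi> 0)" using s(3) by (simp add: \<psi>_def)
    then show "F (x + h *\<^sub>R u + h *\<^sub>R v) - F (x + h *\<^sub>R u) - F (x + h *\<^sub>R v) + F x =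
      h * h * F2 (x + s *\<^sub>R u + t *\<^sub>R v) v" unfolding t(3) by (simp add: \<phi>_def mult.assoc)
  qed
qed

text \<open>Schwarz's argument: the same second difference, evaluated with the two directions in
  either order, equals h^2 times a mixed derivative of either kind at a point near x. Continuity
  moves both values to x up to e/2 each.\<close>

lemma second_derivative_symmetric_real:
  fixes F :: "'a::euclidean_space \<Rightarrow> real"
  assumes U: "open U" "x \<in> U"
    and F1: "\<And>y. y \<in> U \<Longrightarrow> (F has_derivative F' y) (at y)"
    and F2: "\<And>y v. y \<in> U \<Longrightarrow> ((\<lambda>y. F' y v) has_derivative F'' y v) (at y)"
    and cont: "\<And>u v. continuous_on U (\<lambda>y. F'' y u v)"
  shows "F'' x u v = F'' x v u"
proof -
  have "\<bar>F'' x u v - F'' x v u\<bar> \<le> e" if "e > 0" for e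
  proof -
    have c: "isCont (\<lambda>y. F'' y u v) x" for u v using cont U continuous_on_eq_continuous_at by blast
    have "\<exists>d>0. \<forall>y. dist y x < d \<longrightarrow> dist (F'' y u v) (F'' x u v) < e/2" for u v
      using c[of u v] that unfolding continuous_at_eps_delta by (meson half_gt_zero)
    then obtain d1 d2 where d: "d1 > 0" "\<And>y. dist y x < d1 \<Longrightarrow> dist (F'' y u v) (F'' x u v) < e/2"
      "d2 > 0" "\<And>y. dist y x < d2 \<Longrightarrow> dist (F'' y v u) (F'' x v u) < e/2" by metis
    obtain r0 where r0: "r0 > 0" "ball x r0 \<subseteq> U" using U open_contains_ball by blast
    define r where "r = min r0 (min d1 d2)"
    have r: "r > 0" "ball x r \<subseteq> U" using r0 d by (auto simp: r_def)
    \<comment> \<open>The summand 1 keeps the denominator positive when u and v both vanish; the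
      factor 2 makes the parallelogram stay strictly inside the ball.\<close>
    define h where "h = r / (2 * (norm u + norm v + 1))"
    have pos: "norm u + norm v + 1 > 0" by (smt (verit) norm_ge_zero)
    have h: "h > 0" using r pos by (simp add: h_def)
    have hr: "h * (norm u + norm v) < r"
    proof -
      have "h * (norm u + norm v) < h * (2 * (norm u + norm v + 1))"
        proof (rule mult_strict_left_mono[OF _ h])
        have "a + b < 2 * (a + b + 1)" if "0 \<le> a" "0 \<le> b" for a b :: real using that by (simp add: algebra_simps)
        then show "norm u + norm v < 2 * (norm u + norm v + 1)" using norm_ge_zero by blast
      qed
      also have "\<dots> = r" using pos by (simp add: h_def)
      finally show ?thesis .
    qed
    have near: "dist (x + s *\<^sub>R u + t *\<^sub>R v) x < r" if "0 < s" "s < h" "0 < t" "t < h" for s t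
    proof -
      have "norm (s *\<^sub>R u + t *\<^sub>R v) \<le> s * norm u + t * norm v"
        using that norm_triangle_ineq[of "s *\<^sub>R u" "t *\<^sub>R v"] by simp
      also have "\<dots> \<le> h * norm u + h * norm v" using that by (intro add_mono mult_right_mono) auto
      finally have "norm (s *\<^sub>R u + t *\<^sub>R v) < r" using hr by (simp add: algebra_simps)
      moreover have "dist (x + s *\<^sub>R u + t *\<^sub>R v) x = norm (s *\<^sub>R u + t *\<^sub>R v)"
        by (simp add: dist_norm add.assoc)
      ultimately show ?thesis by simp
    qed
    let ?D = "F (x + h *\<^sub>R u + h *\<^sub>R v) - F (x + h *\<^sub>R u) - F (x + h *\<^sub>R v) + F x"
    obtain s t where 1: "0 < s" "s < h" "0 < t" "t < h" "?D = h * h * F'' (x + s *\<^sub>R u + t *\<^sub>R v) u v"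
      using second_difference_mean_value[of x r F F' u "\<lambda>y. F'' y u" h v] F1 F2 r(2) h hr by blast
    \<comment> \<open>The same parallelogram traversed in the other order; its intermediate point is
      in general a different one.\<close>
    obtain s' t' where 2: "0 < s'" "s' < h" "0 < t'" "t' < h"
      "F (x + h *\<^sub>R v + h *\<^sub>R u) - F (x + h *\<^sub>R v) - F (x + h *\<^sub>R u) + F x = h * h * F'' (x + s' *\<^sub>R v + t' *\<^sub>R u) v u"
      using second_difference_mean_value[of x r F F' v "\<lambda>y. F'' y v" h u] F1 F2 r(2) h hr[unfolded add.commute[of "norm u"]]
      by blast
    have "F (x + h *\<^sub>R v + h *\<^sub>R u) = F (x + h *\<^sub>R u + h *\<^sub>R v)"
      by (rule arg_cong[of _ _ F]) (simp only: add_ac)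
    then have "?D = h * h * F'' (x + s' *\<^sub>R v + t' *\<^sub>R u) v u"
      using 2(5) by linarith
    then have "(h * h) * F'' (x + s *\<^sub>R u + t *\<^sub>R v) u v = (h * h) * F'' (x + s' *\<^sub>R v + t' *\<^sub>R u) v u"
      using 1(5) by (metis (no_types))
    moreover have "h * h \<noteq> 0" using h by simp
    ultimately have eq: "F'' (x + s *\<^sub>R u + t *\<^sub>R v) u v = F'' (x + s' *\<^sub>R v + t' *\<^sub>R u) v u"
      by (metis (no_types) mult_cancel_left)
    have "dist (F'' (x + s *\<^sub>R u + t *\<^sub>R v) u v) (F'' x u v) < e/2"
      by (rule d(2)) (use near[OF 1(1-4)] r_def in linarith)
    moreover have "dist (F'' (x + s' *\<^sub>R v + t' *\<^sub>R u) v u) (F'' x v u) < e/2"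
    proof (rule d(4))
      have "x + s' *\<^sub>R v + t' *\<^sub>R u = x + t' *\<^sub>R u + s' *\<^sub>R v" by (simp only: add_ac)
      then have "dist (x + s' *\<^sub>R v + t' *\<^sub>R u) x < r" using near[OF 2(3,4,1,2)] by (simp only:)
      then show "dist (x + s' *\<^sub>R v + t' *\<^sub>R u) x < d2" using r_def by linarith
    qed
    ultimately have "\<bar>F'' (x + s *\<^sub>R u + t *\<^sub>R v) u v - F'' x u v\<bar> < e/2"
      "\<bar>F'' (x + s *\<^sub>R u + t *\<^sub>R v) u v - F'' x v u\<bar> < e/2"
      unfolding eq dist_real_def by blast+
    then show ?thesis by linarith
  qed
  then have "\<bar>F'' x u v - F'' x v u\<bar> \<le> 0 + e" if "e > 0" for e using that by simp
  then have "\<bar>F'' x u v - F'' x v u\<bar> \<le> 0" by (rule field_le_epsilon)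
  then show ?thesis by simp
qed

lemma second_derivative_symmetric:
  fixes F :: "'a::euclidean_space \<Rightarrow> 'b::euclidean_space"
  assumes U: "open U" "x \<in> U"
    and F1: "\<And>y. y \<in> U \<Longrightarrow> (F has_derivative F' y) (at y)"
    and F2: "\<And>y v. y \<in> U \<Longrightarrow> ((\<lambda>y. F' y v) has_derivative F'' y v) (at y)"
    and cont: "\<And>u v. continuous_on U (\<lambda>y. F'' y u v)"
  shows "F'' x u v = F'' x v u"
proof (rule euclidean_eqI)
  fix b :: 'b
  show "F'' x u v \<bullet> b = F'' x v u \<bullet> b"
    by (rule second_derivative_symmetric_real[OF U has_derivative_inner_left has_derivative_inner_left,
          OF F1 F2 continuous_on_inner[OF cont continuous_on_const]])
qed

lemma second_frechet_derivative_symmetric: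
  fixes F :: "'a::euclidean_space \<Rightarrow> 'b::euclidean_space"
  assumes U: "open U" "x \<in> U" and F: "Ck_on 2 U F"
  shows "frechet_derivative (\<lambda>y. frechet_derivative F (at y) u) (at x) v =
    frechet_derivative (\<lambda>y. frechet_derivative F (at y) v) (at x) u"
proof -
  have F': "Ck_on (Suc (Suc 0)) U F" using F by (simp only: numeral_2_eq_2)
  have w: "at y within U = at y" if "y \<in> U" for y using at_within_open[OF that U(1)] .
  have 1: "(F has_derivative frechet_derivative F (at y)) (at y)" if "y \<in> U" for y
    using Ck_on_has_derivative[OF F' that] w[OF that] by simp
  have c: "Ck_on (Suc 0) U (\<lambda>y. frechet_derivative F (at y) v)" for v
    by (rule Ck_on_cong[OF Ck_on_frechet[OF F']]) (simp add: w)
  have 2: "((\<lambda>y. frechet_derivative F (at y) v) has_derivative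
      frechet_derivative (\<lambda>y. frechet_derivative F (at y) v) (at y)) (at y)" if "y \<in> U" for y v
    using Ck_on_has_derivative[OF c that] w[OF that] by simp
  have 3: "continuous_on U (\<lambda>y. frechet_derivative (\<lambda>y. frechet_derivative F (at y) u) (at y) v)" for u v
    using Ck_on_frechet[OF c, of u v] by (simp add: w cong: continuous_on_cong)
  show ?thesis by (rule second_derivative_symmetric[OF U 1 2 3])
qed

section \<open>Linear differential equations\<close>

lemma has_vector_derivative_join:
  fixes a b c t :: real
  assumes "a \<le> b" "b \<le> c"
    and 1: "t \<in> {a..b} \<Longrightarrow> (y1 has_vector_derivative d1) (at t within {a..b})"
    and 2: "t \<in> {b..c} \<Longrightarrow> (y2 has_vector_derivative d2) (at t within {b..c})"
    and eq: "y1 b = y2 b" "t = b \<Longrightarrow> d1 = d2" and t: "t \<in> {a..c}"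
  shows "((\<lambda>t. if t \<le> b then y1 t else y2 t) has_vector_derivative (if t \<le> b then d1 else d2)) (at t within {a..c})"
proof -
  have U: "{a..c} = {a..b} \<union> {b..c}" using assms by auto
  have I: "closure {a..b} \<inter> closure {b..c} = {b}" using assms by auto
  have "((\<lambda>t. if t \<in> {a..b} then y1 t else y2 t) has_vector_derivative (if t \<in> {a..b} then d1 else d2)) (at t within {a..c})"
    by (rule has_vector_derivative_If_within_closures[where f'="\<lambda>_. d1" and g'="\<lambda>_. d2", OF _ U])
       (use assms in \<open>auto simp: I insert_absorb Un_absorb2\<close>)
  then show ?thesis
    by (rule has_vector_derivative_transform[rotated 2, THEN has_vector_derivative_eq_rhs]) (use t in auto)
qed

text \<open>Picard's contraction argument, with contraction factor M (b - a). Continuity of the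
  right-hand side is required only along continuous curves y, so no topology on the space of
  operators f t is involved.\<close>

lemma linear_ode_local:
  fixes f :: "real \<Rightarrow> 'b::banach \<Rightarrow> 'b"
  assumes ab: "a \<le> b"
    and lin: "\<And>t. t \<in> {a..b} \<Longrightarrow> linear (f t)"
    and bound: "\<And>t y. t \<in> {a..b} \<Longrightarrow> norm (f t y) \<le> M * norm y"
    and cont: "\<And>y. continuous_on {a..b} y \<Longrightarrow> continuous_on {a..b} (\<lambda>t. f t (y t))"
    and M: "0 \<le> M" "M * (b - a) < 1"
  shows "\<exists>y. y a = y0 \<and> (\<forall>t\<in>{a..b}. (y has_vector_derivative f t (y t)) (at t within {a..b}))"
proof -
  define G where "G y t = y0 + integral {a..t} (\<lambda>s. f s (y s))" for y t
  have der: "(G y has_vector_derivative f t (y t)) (at t within {a..b})"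
    if "continuous_on {a..b} y" "t \<in> {a..b}" for y t
    unfolding G_def using integral_has_vector_derivative[OF cont[OF that(1)] that(2)]
    by (auto intro!: derivative_eq_intros)
  \<comment> \<open>\<open>clamp\<close> extends \<open>G y\<close> constantly beyond [a,b] to a
    bounded continuous function on the line, so the fixed point can be sought in the complete space
    \<open>real \<Rightarrow>\<^sub>C 'b\<close>.\<close>
  have "\<exists>g :: real \<Rightarrow>\<^sub>C 'b. \<forall>t. g t = G y (clamp a b t)" if "continuous_on {a..b} y" for y
  proof -
    have "continuous_on (cbox a b) (G y)"
      unfolding continuous_on_eq_continuous_within cbox_interval
      using der[OF that] has_vector_derivative_continuous by blast
    then obtain g :: "real \<Rightarrow>\<^sub>C 'b" where "\<And>t. g t = G y (clamp a b t)"
      using continuous_on_cbox_bcontfunE[of a b "G y"] by metis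
    then show ?thesis by blast
  qed
  then have "\<forall>y :: real \<Rightarrow>\<^sub>C 'b. \<exists>g :: real \<Rightarrow>\<^sub>C 'b. \<forall>t. g t = G y (clamp a b t)" by simp
  then obtain T :: "(real \<Rightarrow>\<^sub>C 'b) \<Rightarrow> (real \<Rightarrow>\<^sub>C 'b)" where T: "\<And>y t. T y t = G y (clamp a b t)" by metis
  have "dist (T y) (T z) \<le> (M * (b - a)) * dist y z" for y z
  proof (rule dist_bound)
    fix t
    define s where "s = clamp a b t"
    have s: "s \<in> {a..b}" using clamp_in_interval[of a b t] ab by (simp add: s_def)
    have sub: "{a..s} \<subseteq> {a..b}" using s by auto
    have int: "(\<lambda>s. f s (apply_bcontfun y s)) integrable_on {a..s}" for y
      by (intro integrable_continuous_real continuous_on_subset[OF cont sub]) simp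
    have "T y t - T z t = integral {a..s} (\<lambda>s. f s (y s) - f s (z s))"
      unfolding T G_def s_def[symmetric] by (simp add: integral_diff int)
    also have "norm \<dots> \<le> M * dist y z * (s - a)"
    proof (rule integral_bound)
      show "a \<le> s" using s by simp
      show "continuous_on {a..s} (\<lambda>s. f s (y s) - f s (z s))"
        by (intro continuous_intros continuous_on_subset[OF cont sub]) simp_all
      fix t assume "t \<in> {a..s}"
      then have t: "t \<in> {a..b}" using sub by auto
      have "norm (f t (y t) - f t (z t)) = norm (f t (y t - z t))" using lin[OF t] by (simp add: linear_diff)
      also have "\<dots> \<le> M * norm (y t - z t)" by (rule bound[OF t])
      also have "\<dots> \<le> M * dist y z" using dist_bounded[of y t z] M by (intro mult_left_mono) (auto simp: dist_norm)
      finally show "norm (f t (y t) - f t (z t)) \<le> M * dist y z" .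
    qed
    also have "\<dots> \<le> M * dist y z * (b - a)" using M s by (intro mult_left_mono) auto
    finally show "dist (T y t) (T z t) \<le> M * (b - a) * dist y z" by (simp add: dist_norm mult_ac)
  qed
  then have "\<exists>!y. T y = y" using M ab by (intro banach_fix_type) auto
  then obtain y where y: "T y = y" by blast
  have yG: "y t = G y t" if "t \<in> {a..b}" for t
    using T[of y t] that y by simp
  show ?thesis
  proof (intro exI[of _ "apply_bcontfun y"] conjI ballI)
    show "y a = y0" using yG[of a] ab by (simp add: G_def)
    fix t assume t: "t \<in> {a..b}"
    show "(y has_vector_derivative f t (y t)) (at t within {a..b})"
      by (rule has_vector_derivative_transform[OF t yG der[OF _ t]]) auto
  qed
qed

text \<open>The admissible step length depends on the bound M alone, so short solutions can be
  concatenated. \<open>Bolzano\<close> does the bookkeeping; \<open>Q\<close> quantifies over all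
  initial values so that a second solution can start where the first one ends.\<close>

lemma linear_ode_exists:
  fixes f :: "real \<Rightarrow> 'b::banach \<Rightarrow> 'b"
  assumes ab: "a \<le> b"
    and lin: "\<And>t. t \<in> {a..b} \<Longrightarrow> linear (f t)"
    and bound: "\<And>t y. t \<in> {a..b} \<Longrightarrow> norm (f t y) \<le> M * norm y"
    and cont: "\<And>y S. S \<subseteq> {a..b} \<Longrightarrow> continuous_on S y \<Longrightarrow> continuous_on S (\<lambda>t. f t (y t))"
  shows "\<exists>y. y a = y0 \<and> (\<forall>t\<in>{a..b}. (y has_vector_derivative f t (y t)) (at t within {a..b}))"
proof -
  define Q where "Q c d \<longleftrightarrow> (a \<le> c \<longrightarrow> c \<le> d \<longrightarrow> d \<le> b \<longrightarrow>
    (\<forall>y0. \<exists>y. y c = y0 \<and> (\<forall>t\<in>{c..d}. (y has_vector_derivative f t (y t)) (at t within {c..d}))))" for c d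
  have "Q a b" using ab
  proof (induct rule: Bolzano)
    case (trans p q r)
    show ?case unfolding Q_def
    proof (intro impI allI)
      fix y0 assume *: "a \<le> p" "p \<le> r" "r \<le> b"
      obtain y1 where y1: "y1 p = y0" "\<And>t. t\<in>{p..q} \<Longrightarrow> (y1 has_vector_derivative f t (y1 t)) (at t within {p..q})"
        using trans * unfolding Q_def by (meson order_trans)
      obtain y2 where y2: "y2 q = y1 q" "\<And>t. t\<in>{q..r} \<Longrightarrow> (y2 has_vector_derivative f t (y2 t)) (at t within {q..r})"
        using trans * unfolding Q_def by (meson order_trans)
      show "\<exists>y. y p = y0 \<and> (\<forall>t\<in>{p..r}. (y has_vector_derivative f t (y t)) (at t within {p..r}))"
      proof (intro exI[of _ "\<lambda>t. if t \<le> q then y1 t else y2 t"] conjI ballI)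
        show "(if p \<le> q then y1 p else y2 p) = y0" using y1 trans by simp
        fix t assume t: "t \<in> {p..r}"
        from has_vector_derivative_join[OF trans(3,4) y1(2) y2(2) _ _ t] y2(1)
        show "((\<lambda>t. if t \<le> q then y1 t else y2 t) has_vector_derivative f t (if t \<le> q then y1 t else y2 t)) (at t within {p..r})"
          by (simp add: if_distrib)
      qed
    qed
  next
    case (local x)
    \<comment> \<open>A strictly positive upper bound of M, so that 1 / L is a usable step length
      whatever the sign of M.\<close>
    define L where "L = max M 0 + 1"
    have L: "L > 0" "M \<le> L" by (auto simp: L_def)
    have "Q c d" if "d - c < 1 / L" for c d
      unfolding Q_def
    proof (intro impI allI)
      fix y0 assume *: "a \<le> c" "c \<le> d" "d \<le> b"
      show "\<exists>y. y c = y0 \<and> (\<forall>t\<in>{c..d}. (y has_vector_derivative f t (y t)) (at t within {c..d}))"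
      proof (rule linear_ode_local[OF *(2), where M=L])
        fix t y assume "t \<in> {c..d}"
        then have t: "t \<in> {a..b}" using * by auto
        show "linear (f t)" using lin t by auto
        show "norm (f t y) \<le> L * norm y"
          using bound[OF t, of y] mult_right_mono[OF L(2), of "norm y"] by simp
      next
        show "L * (d - c) < 1" using that L by (simp add: field_simps)
      qed (use L * cont in auto)
    qed
    then show ?case using L by (intro exI[of _ "1 / L"]) auto
  qed
  then show ?thesis using ab by (simp add: Q_def)
qed

section \<open>Differentiating products and inverses of matrices\<close>

lemma bounded_bilinear_matrix_vector: "bounded_bilinear ((*v) :: real ^ 'n ^ 'm \<Rightarrow> real ^ 'n \<Rightarrow> real ^ 'm)"
  unfolding bilinear_conv_bounded_bilinear[symmetric] bilinear_def
  by (auto intro!: linearI simp: matrix_vector_mult_add_rdistrib vec.add vec.scale scalar_mult_eq_scaleR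
      scaleR_matrix_vector_assoc matrix_vector_mult_scaleR matrix_vector_right_distrib)

lemma bounded_bilinear_matrix_matrix:
  "bounded_bilinear ((**) :: real ^ 'n ^ 'm \<Rightarrow> real ^ 'k ^ 'n \<Rightarrow> real ^ 'k ^ 'm)"
  unfolding bilinear_conv_bounded_bilinear[symmetric] bilinear_def
  by (intro conjI allI linearI)
     (simp_all add: matrix_matrix_mult_def vec_eq_iff sum.distrib[symmetric] sum_distrib_left algebra_simps)

lemmas matrix_vector_minus_left = bounded_bilinear.minus_left[OF bounded_bilinear_matrix_vector]
lemmas matrix_vector_diff_left = bounded_bilinear.diff_left[OF bounded_bilinear_matrix_vector]
lemmas matrix_matrix_minus_left = bounded_bilinear.minus_left[OF bounded_bilinear_matrix_matrix]

lemma has_vector_derivative_matrix_vector: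
  "(M has_vector_derivative M') (at t within S) \<Longrightarrow> (y has_vector_derivative y') (at t within S) \<Longrightarrow>
   ((\<lambda>t. M t *v y t :: real^'m) has_vector_derivative M t *v y' + M' *v y t) (at t within S)"
  by (rule bounded_bilinear.has_vector_derivative[OF bounded_bilinear_matrix_vector])

text \<open>Cramer's rule, through \<open>Ck_on_matrix_inv\<close>, gives the existence of a
  derivative D; its value follows by differentiating M M^-1 = 1 and solving for D.\<close>

lemma has_vector_derivative_matrix_inv:
  fixes M :: "real \<Rightarrow> real ^ 'n ^ 'n"
  assumes S: "thick S" and M: "\<And>t. t \<in> S \<Longrightarrow> (M has_vector_derivative M' t) (at t within S)"
    and cont: "continuous_on S M'" and inv: "\<And>t. t \<in> S \<Longrightarrow> invertible (M t)" and t: "t \<in> S"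
  shows "((\<lambda>t. matrix_inv (M t)) has_vector_derivative - (matrix_inv (M t) ** M' t ** matrix_inv (M t))) (at t within S)"
proof -
  have "Ck_on 0 S M'" using cont by simp
  then have "Ck_on (Suc 0) S M" by (intro Ck_on_vector_derivativeI[OF S M])
  then have "Ck_on (Suc 0) S (\<lambda>t. matrix_inv (M t))" by (rule Ck_on_matrix_inv[OF S _ inv])
  from Ck_on_vector_derivative(1)[OF S this t] obtain D where
    D: "((\<lambda>t. matrix_inv (M t)) has_vector_derivative D) (at t within S)" by blast
  have "((\<lambda>t. M t ** matrix_inv (M t)) has_vector_derivative M t ** D + M' t ** matrix_inv (M t)) (at t within S)"
    by (rule bounded_bilinear.has_vector_derivative[OF bounded_bilinear_matrix_matrix M[OF t] D])
  note product_rule = vector_derivative_thick[OF S t this]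
  have "((\<lambda>t. M t ** matrix_inv (M t)) has_vector_derivative 0) (at t within S)"
    by (rule has_vector_derivative_transform[OF t _ has_vector_derivative_const[of "mat 1"]])
       (simp add: matrix_inv_cancel inv)
  from vector_derivative_thick[OF S t this] have "M t ** D + M' t ** matrix_inv (M t) = 0"
    by (simp only: product_rule)
  then have "M t ** D = - (M' t ** matrix_inv (M t))" by (simp add: eq_neg_iff_add_eq_0)
  then have "matrix_inv (M t) ** (M t ** D) = - (matrix_inv (M t) ** M' t ** matrix_inv (M t))"
    by (simp add: bounded_bilinear.minus_right[OF bounded_bilinear_matrix_matrix] matrix_mul_assoc)
  then have "D = - (matrix_inv (M t) ** M' t ** matrix_inv (M t))"
    by (simp add: matrix_mul_assoc matrix_inv_cancel inv t)
  then show ?thesis using D by simp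
qed

lemma has_vector_derivative_zero_imp_const:
  fixes f :: "real \<Rightarrow> 'b::real_normed_vector"
  assumes "\<And>t. t \<in> {a..b} \<Longrightarrow> (f has_vector_derivative 0) (at t within {a..b})" "t \<in> {a..b}"
  shows "f t = f a"
  by (rule has_derivative_zero_unique[of "{a..b}"]) (use assms in \<open>auto simp: has_vector_derivative_def\<close>)

section \<open>Jacobi systems in Euclidean space\<close>

text \<open>The second-order equation is solved as a first-order linear system for the pair (Y,
  Y').\<close>

lemma jacobi_matrix_exists:
  fixes K :: "real \<Rightarrow> real ^ 'n ^ 'n"
  assumes l: "0 \<le> l" and K: "continuous_on {0..l} K"
  shows "\<exists>Y Y'. Y 0 = mat 1 \<and> Y' 0 = b \<and> (\<forall>t\<in>{0..l}. (Y has_vector_derivative Y' t) (at t within {0..l}))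
    \<and> (\<forall>t\<in>{0..l}. (Y' has_vector_derivative - (K t ** Y t)) (at t within {0..l}))"
proof -
  \<comment> \<open>Ingredients of the growth bound 1 + C * D: C bounds K on the compact interval, D
    is the constant of the bounded bilinear matrix product, and 1 accounts for the component
    Y'.\<close>
  obtain C where C: "\<And>t. t \<in> {0..l} \<Longrightarrow> norm (K t) \<le> C"
    using compact_imp_bounded[OF compact_continuous_image[OF K compact_Icc]] unfolding bounded_iff by blast
  obtain D where D: "D > 0" "\<And>(a::real^'n^'n) (b::real^'n^'n). norm (a ** b) \<le> norm a * norm b * D"
    using bounded_bilinear.pos_bounded[OF bounded_bilinear_matrix_matrix] by blast
  define f where "f t z = (snd z, - (K t ** fst z))" for t and z :: "(real^'n^'n) \<times> (real^'n^'n)"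
  have "\<exists>y. y 0 = (mat 1, b) \<and> (\<forall>t\<in>{0..l}. (y has_vector_derivative f t (y t)) (at t within {0..l}))"
  proof (rule linear_ode_exists[OF l, where M = "1 + C * D"])
    fix t and z :: "(real^'n^'n) \<times> (real^'n^'n)" assume t: "t \<in> {0..l}"
    show "linear (f t)"
      by (rule linearI)
         (auto simp: f_def bounded_bilinear.add_right[OF bounded_bilinear_matrix_matrix]
            bounded_bilinear.scaleR_right[OF bounded_bilinear_matrix_matrix])
    have "norm (K t ** fst z) \<le> norm (K t) * norm (fst z) * D" by (rule D)
    also have "\<dots> \<le> C * norm z * D"
      using C[OF t] norm_fst_le[of "fst z" "snd z"] D(1) order_trans[OF norm_ge_zero C[OF t]]
      by (intro mult_right_mono mult_mono) auto
    finally have "norm (f t z) \<le> norm (snd z) + C * norm z * D"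
      using norm_Pair_le[of "snd z" "- (K t ** fst z)"] by (simp add: f_def)
    also have "norm (snd z) \<le> norm z" using norm_snd_le[of "snd z" "fst z"] by simp
    finally show "norm (f t z) \<le> (1 + C * D) * norm z" by (simp add: algebra_simps)
  next
    fix y :: "real \<Rightarrow> (real^'n^'n) \<times> (real^'n^'n)" and S assume "S \<subseteq> {0..l}" "continuous_on S y"
    then show "continuous_on S (\<lambda>t. f t (y t))"
      unfolding f_def using continuous_on_subset[OF K]
      by (intro continuous_intros bounded_bilinear.continuous_on[OF bounded_bilinear_matrix_matrix]) auto
  qed
  then obtain y where y: "y 0 = (mat 1, b)"
    "\<And>t. t\<in>{0..l} \<Longrightarrow> (y has_vector_derivative f t (y t)) (at t within {0..l})" by blast
  have "((\<lambda>t. fst (y t)) has_vector_derivative snd (y t)) (at t within {0..l})"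
    "((\<lambda>t. snd (y t)) has_vector_derivative - (K t ** fst (y t))) (at t within {0..l})" if "t \<in> {0..l}" for t
    using bounded_linear.has_vector_derivative[OF bounded_linear_fst y(2)[OF that]]
      bounded_linear.has_vector_derivative[OF bounded_linear_snd y(2)[OF that]] by (simp_all add: f_def)
  moreover have "fst (y 0) = mat 1" "snd (y 0) = b" using y(1) by simp_all
  ultimately show ?thesis by (intro exI[of _ "\<lambda>t. fst (y t)"] exI[of _ "\<lambda>t. snd (y t)"]) simp
qed

lemma partition_mono:
  fixes \<tau> :: "nat \<Rightarrow> real"
  assumes "\<And>i. i < N \<Longrightarrow> \<tau> i < \<tau> (Suc i)" and "i \<le> j" "j \<le> N"
  shows "\<tau> i \<le> \<tau> j"
  using assms(2,3)
proof (induction j rule: dec_induct)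
  case (step n)
  then show ?case using assms(1)[of n] by simp
qed simp

text \<open>The inner product q is arbitrary, since the frame will not be orthonormal;
  self-adjointness of \<open>K t\<close> and b therefore refers to q and is not symmetry of the
  matrices.\<close>

locale jacobi_system =
  fixes q :: "real ^ 'n \<Rightarrow> real ^ 'n \<Rightarrow> real" and K :: "real \<Rightarrow> real ^ 'n ^ 'n" and b :: "real ^ 'n ^ 'n"
    and l :: real and Y Y' :: "real \<Rightarrow> real ^ 'n ^ 'n"
  assumes q_bil: "bounded_bilinear q" and q_sym: "q x y = q y x" and q_pos: "x \<noteq> 0 \<Longrightarrow> q x x > 0"
    and l_pos: "l > 0"
    and K_sym: "t \<in> {0..l} \<Longrightarrow> q (K t *v x) y = q x (K t *v y)"
    and b_sym: "q (b *v x) y = q x (b *v y)"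
    and Y0: "Y 0 = mat 1" "Y' 0 = b"
    and Y_der: "t \<in> {0..l} \<Longrightarrow> (Y has_vector_derivative Y' t) (at t within {0..l})"
    and Y'_der: "t \<in> {0..l} \<Longrightarrow> (Y' has_vector_derivative - (K t ** Y t)) (at t within {0..l})"
    and Y_inv: "t \<in> {0..l} \<Longrightarrow> invertible (Y t)"
begin

sublocale q: bounded_bilinear q by (rule q_bil)

definition "U t = Y' t ** matrix_inv (Y t)"

lemma thick_l: "thick {0..l}"
  using thick_openin_interval[of 0 l "{0..l}"] l_pos by simp

lemma U_Y: "t \<in> {0..l} \<Longrightarrow> U t *v (Y t *v x) = Y' t *v x"
  by (simp add: U_def matrix_vector_mul_assoc[symmetric] matrix_inv_cancel Y_inv)

lemma Y'_continuous: "continuous_on {0..l} Y'"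
  using Y'_der has_vector_derivative_continuous continuous_on_eq_continuous_within by blast

lemmas Y_inverse_der = has_vector_derivative_matrix_inv[OF thick_l Y_der Y'_continuous Y_inv]

text \<open>In the product rule for Y' Y^-1 the Jacobi equation turns Y'' Y^-1 into - K, and
  differentiating Y^-1 produces - U U.\<close>

lemma riccati:
  assumes t: "t \<in> {0..l}"
  shows "(U has_vector_derivative - K t - U t ** U t) (at t within {0..l})"
proof -
  have "(U has_vector_derivative Y' t ** - (matrix_inv (Y t) ** Y' t ** matrix_inv (Y t)) + - (K t ** Y t) ** matrix_inv (Y t)) (at t within {0..l})"
    unfolding U_def[abs_def]
    by (rule bounded_bilinear.has_vector_derivative[OF bounded_bilinear_matrix_matrix Y'_der[OF t] Y_inverse_der]) (use t in auto)
  moreover have "Y' t ** - (matrix_inv (Y t) ** Y' t ** matrix_inv (Y t)) = - (U t ** U t)"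
    by (simp add: U_def bounded_bilinear.minus_right[OF bounded_bilinear_matrix_matrix] matrix_mul_assoc)
  moreover have "- (K t ** Y t) ** matrix_inv (Y t) = - K t"
    by (simp add: matrix_matrix_minus_left matrix_mul_assoc[symmetric] matrix_inv_cancel Y_inv[OF t])
  ultimately show ?thesis by (simp add: algebra_simps)
qed

text \<open>The two terms q(f', h') cancel in the derivative, and the two terms with K cancel
  because \<open>K t\<close> is self-adjoint.\<close>

lemma wronskian:
  assumes "\<And>t. t \<in> {0..l} \<Longrightarrow> (f has_vector_derivative f' t) (at t within {0..l})"
    "\<And>t. t \<in> {0..l} \<Longrightarrow> (f' has_vector_derivative - (K t *v f t)) (at t within {0..l})"
    "\<And>t. t \<in> {0..l} \<Longrightarrow> (h has_vector_derivative h' t) (at t within {0..l})"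
    "\<And>t. t \<in> {0..l} \<Longrightarrow> (h' has_vector_derivative - (K t *v h t)) (at t within {0..l})"
    and t: "t \<in> {0..l}"
  shows "q (f' t) (h t) - q (f t) (h' t) = q (f' 0) (h 0) - q (f 0) (h' 0)"
proof (rule has_vector_derivative_zero_imp_const[OF _ t, where f="\<lambda>t. q (f' t) (h t) - q (f t) (h' t)"])
  fix t assume t: "t \<in> {0..l}"
  have "((\<lambda>t. q (f' t) (h t) - q (f t) (h' t)) has_vector_derivative
     (q (f' t) (h' t) + q (- (K t *v f t)) (h t)) - (q (f t) (- (K t *v h t)) + q (f' t) (h' t))) (at t within {0..l})"
    by (intro has_vector_derivative_diff q.has_vector_derivative assms t)
  then show "((\<lambda>t. q (f' t) (h t) - q (f t) (h' t)) has_vector_derivative 0) (at t within {0..l})"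
    using K_sym[OF t] by (simp add: q.minus_left q.minus_right)
qed

lemma Y_vec_der:
  assumes t: "t \<in> {0..l}"
  shows "((\<lambda>t. Y t *v x) has_vector_derivative Y' t *v x) (at t within {0..l})"
    and "((\<lambda>t. Y' t *v x) has_vector_derivative - (K t *v (Y t *v x))) (at t within {0..l})"
  using has_vector_derivative_matrix_vector[OF Y_der[OF t] has_vector_derivative_const]
    has_vector_derivative_matrix_vector[OF Y'_der[OF t] has_vector_derivative_const]
  by (simp_all add: matrix_vector_minus_left matrix_vector_mul_assoc)

text \<open>As Y t is onto, x and y are values at t of two solutions Y x', Y y'. Their Wronskian is
  0 at time 0, where it is q(b x', y') - q(x', b y'), and hence at t; this is the claim, as U maps Y
  x' to Y' x'.\<close>

lemma U_sym:
  assumes t: "t \<in> {0..l}"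
  shows "q (U t *v x) y = q x (U t *v y)"
proof -
  define x' y' where "x' = matrix_inv (Y t) *v x" "y' = matrix_inv (Y t) *v y"
  have xy: "x = Y t *v x'" "y = Y t *v y'" by (simp_all add: x'_y'_def matrix_inv_cancel Y_inv[OF t])
  have "q (Y' t *v x') (Y t *v y') - q (Y t *v x') (Y' t *v y') = 0"
    using wronskian[OF Y_vec_der Y_vec_der t, of x' y'] b_sym by (simp add: Y0)
  then show ?thesis unfolding xy using U_Y[OF t] by simp
qed

text \<open>The derivative of Y^-1 w is Y^-1 (w' - U w). So w' = U w singles out the curves Y z with
  constant z; general subintervals are allowed because w is treated piece by piece.\<close>

lemma riccati_flow:
  assumes sub: "0 \<le> a" "c \<le> l"
    and w: "\<And>t. t \<in> {a..c} \<Longrightarrow> (w has_vector_derivative U t *v w t) (at t within {a..c})"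
    and t: "t \<in> {a..c}"
  shows "matrix_inv (Y t) *v w t = matrix_inv (Y a) *v w a"
proof (rule has_vector_derivative_zero_imp_const[OF _ t, where f="\<lambda>t. matrix_inv (Y t) *v w t"])
  fix t assume t: "t \<in> {a..c}"
  then have t': "t \<in> {0..l}" using sub by auto
  have "((\<lambda>t. matrix_inv (Y t)) has_vector_derivative - (matrix_inv (Y t) ** Y' t ** matrix_inv (Y t))) (at t within {a..c})"
    by (rule has_vector_derivative_within_subset[OF Y_inverse_der]) (use t' sub in auto)
  from has_vector_derivative_matrix_vector[OF this w[OF t]]
  show "((\<lambda>t. matrix_inv (Y t) *v w t) has_vector_derivative 0) (at t within {a..c})"
    by (simp add: U_def matrix_vector_minus_left matrix_vector_mul_assoc matrix_mul_assoc)
qed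

text \<open>Uniqueness for the second-order problem is reduced to first order: f has zero Wronskian
  with every solution Y y, these fill the whole space at time t, and nondegeneracy of q gives f' = U
  f. Then \<open>riccati_flow\<close> applies.\<close>

lemma solution_eq:
  assumes f: "\<And>t. t \<in> {0..l} \<Longrightarrow> (f has_vector_derivative f' t) (at t within {0..l})"
    "\<And>t. t \<in> {0..l} \<Longrightarrow> (f' has_vector_derivative - (K t *v f t)) (at t within {0..l})"
    and f0: "f' 0 = b *v f 0" and t: "t \<in> {0..l}"
  shows "f t = Y t *v f 0"
proof -
  have fU: "f' t = U t *v f t" if t: "t \<in> {0..l}" for t
  proof (rule ccontr)
    assume "f' t \<noteq> U t *v f t"
    then have "q (f' t - U t *v f t) (f' t - U t *v f t) > 0" by (intro q_pos) simp
    moreover have "q (f' t - U t *v f t) z = 0" for z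
    proof -
      define y where "y = matrix_inv (Y t) *v z"
      have z: "z = Y t *v y" by (simp add: y_def matrix_inv_cancel Y_inv[OF t])
      have "q (f' t) (Y t *v y) = q (f t) (Y' t *v y)"
        using wronskian[OF f Y_vec_der t, of y] b_sym f0 by (simp add: Y0)
      also have "\<dots> = q (U t *v f t) z" unfolding U_sym[OF t] z U_Y[OF t] ..
      finally show ?thesis by (simp add: q.diff_left z)
    qed
    ultimately show False by simp
  qed
  have "matrix_inv (Y t) *v f t = matrix_inv (Y 0) *v f 0"
    by (rule riccati_flow[OF _ _ _ t]) (use f(1) fU in auto)
  then have "Y t *v (matrix_inv (Y t) *v f t) = Y t *v (matrix_inv (Y 0) *v f 0)" by simp
  moreover have "matrix_inv (Y 0) *v f 0 = f 0"
    using matrix_inv_cancel(4)[OF Y_inv[of 0], of "f 0"] l_pos by (simp add: Y0)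
  ultimately show ?thesis by (simp add: matrix_inv_cancel Y_inv[OF t])
qed

text \<open>By the Riccati equation and self-adjointness of U, the derivative of q(U w, w) plus the
  square e of w' - U w is the index integrand, and S is the integral of e. Continuity of e turns S =
  0 into w' = U w. The condition is recorded as constancy of Y^-1 w because this can be joined
  across corners, where w' need not exist.\<close>

lemma index_piece:
  assumes ac: "0 \<le> a" "a < c" "c \<le> l"
    and w: "\<And>t. t \<in> {a..c} \<Longrightarrow> (w has_vector_derivative w' t) (at t within {a..c})"
    and w': "continuous_on {a..c} w'"
  shows "\<exists>S\<ge>0. ((\<lambda>t. q (w' t) (w' t) - q (K t *v w t) (w t)) has_integral
      q (U c *v w c) (w c) - q (U a *v w a) (w a) + S) {a..c} \<and>
    (S = 0 \<longleftrightarrow> (\<forall>t\<in>{a..c}. matrix_inv (Y t) *v w t = matrix_inv (Y a) *v w a))"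
proof -
  have sub: "{a..c} \<subseteq> {0..l}" using ac by auto
  have thick: "thick {a..c}" using thick_openin_interval[of a c "{a..c}"] ac by simp
  have U_der: "(U has_vector_derivative - K t - U t ** U t) (at t within {a..c})" if "t \<in> {a..c}" for t
    by (rule has_vector_derivative_within_subset[OF riccati]) (use that sub in auto)
  have U_cont: "continuous_on {a..c} U" and w_cont: "continuous_on {a..c} w"
    using U_der w has_vector_derivative_continuous continuous_on_eq_continuous_within by blast+
  define d where "d t = w' t - U t *v w t" for t
  define e where "e t = q (d t) (d t)" for t
  have d_cont: "continuous_on {a..c} d" unfolding d_def
    by (intro continuous_intros bounded_bilinear.continuous_on[OF bounded_bilinear_matrix_vector] U_cont w_cont w')
  have e_cont: "continuous_on {a..c} e" unfolding e_def by (intro q.continuous_on d_cont)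
  have e_nn: "e t \<ge> 0" for t using q_pos[of "d t"] by (cases "d t = 0") (auto simp: e_def q.zero_left)
  define F where "F t = q (U t *v w t) (w t)" for t
  define F' where "F' t = q (U t *v w t) (w' t) + q (U t *v w' t + (- K t - U t ** U t) *v w t) (w t)" for t
  have F: "(F has_vector_derivative F' t) (at t within {a..c})" if t: "t \<in> {a..c}" for t
    unfolding F_def F'_def
    by (intro q.has_vector_derivative has_vector_derivative_matrix_vector U_der w t)
  have "(F' has_integral F c - F a) {a..c}"
    by (rule fundamental_theorem_of_calculus[OF _ F]) (use ac in auto)
  moreover have "(e has_integral integral {a..c} e) {a..c}"
    using integrable_continuous_real[OF e_cont] by (rule integrable_integral)
  ultimately have "((\<lambda>t. F' t + e t) has_integral F c - F a + integral {a..c} e) {a..c}"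
    by (rule has_integral_add)
  moreover have "F' t + e t = q (w' t) (w' t) - q (K t *v w t) (w t)" if "t \<in> {a..c}" for t
  proof -
    have t: "t \<in> {0..l}" using that sub by auto
    have "F' t = 2 * q (U t *v w t) (w' t) - q (K t *v w t) (w t) - q (U t *v w t) (U t *v w t)"
      unfolding F'_def using U_sym[OF t, of "w' t" "w t"] U_sym[OF t, of "U t *v w t" "w t"] q_sym[of "w' t" "U t *v w t"]
      by (simp add: matrix_vector_diff_left matrix_vector_minus_left q.add_left q.diff_left q.minus_left matrix_vector_mul_assoc)
    moreover have "e t = q (w' t) (w' t) - 2 * q (U t *v w t) (w' t) + q (U t *v w t) (U t *v w t)"
      using q_sym[of "w' t" "U t *v w t"] by (simp add: e_def d_def q.diff_left q.diff_right)
    ultimately show ?thesis by simp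
  qed
  ultimately have int: "((\<lambda>t. q (w' t) (w' t) - q (K t *v w t) (w t)) has_integral F c - F a + integral {a..c} e) {a..c}"
    by (rule has_integral_eq[rotated])
  have "integral {a..c} e = 0 \<longleftrightarrow> (\<forall>t\<in>{a..c}. e t = 0)"
    by (rule integral_eq_0_iff[OF e_cont ac(2) e_nn])
  also have "\<dots> \<longleftrightarrow> (\<forall>t\<in>{a..c}. w' t = U t *v w t)"
  proof -
    have "e t = 0 \<longleftrightarrow> w' t = U t *v w t" for t
      unfolding e_def using q_pos[of "d t"] by (cases "d t = 0") (auto simp: d_def q.zero_left)
    then show ?thesis by blast
  qed
  also have "\<dots> \<longleftrightarrow> (\<forall>t\<in>{a..c}. matrix_inv (Y t) *v w t = matrix_inv (Y a) *v w a)"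
  proof (intro iffI ballI)
    fix t assume "\<forall>t\<in>{a..c}. w' t = U t *v w t" "t \<in> {a..c}"
    then show "matrix_inv (Y t) *v w t = matrix_inv (Y a) *v w a"
      using w ac by (intro riccati_flow[of a c]) auto
  next
    \<comment> \<open>Here w = Y z on the whole piece, and two derivatives of the same curve must
      agree on a thick interval.\<close>
    fix t assume flow: "\<forall>t\<in>{a..c}. matrix_inv (Y t) *v w t = matrix_inv (Y a) *v w a" and t: "t \<in> {a..c}"
    define z where "z = matrix_inv (Y a) *v w a"
    have wz: "w t = Y t *v z" if "t \<in> {a..c}" for t
    proof -
      have "Y t *v (matrix_inv (Y t) *v w t) = w t" by (rule matrix_inv_cancel(3)[OF Y_inv]) (use that sub in blast)
      moreover have "matrix_inv (Y t) *v w t = z" using flow that unfolding z_def by blast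
      ultimately show ?thesis by (simp only:)
    qed
    have "((\<lambda>t. Y t *v z) has_vector_derivative Y' t *v z) (at t within {a..c})"
      by (rule has_vector_derivative_within_subset[OF Y_vec_der(1)]) (use t sub in auto)
    then have "(w has_vector_derivative Y' t *v z) (at t within {a..c})"
      using wz by (rule has_vector_derivative_transform[OF t, rotated])
    then have "w' t = Y' t *v z" using w[OF t] vector_derivative_thick[OF thick t] by metis
    then show "w' t = U t *v w t" using wz[OF t] U_Y[of t z] t sub by auto
  qed
  finally show ?thesis
    using int integral_nonneg[OF integrable_continuous_real[OF e_cont] e_nn] unfolding F_def by blast
qed

text \<open>The boundary terms of the pieces telescope by continuity of w, and the nonnegative
  excesses add up. The integrand h is prescribed only on the open pieces, because the covariant
  derivative of a piecewise smooth field is unspecified at the corners.\<close>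

lemma index_formula:
  fixes \<tau> :: "nat \<Rightarrow> real"
  assumes \<tau>: "\<tau> 0 = 0" "\<tau> N = l" "\<And>i. i < N \<Longrightarrow> \<tau> i < \<tau> (Suc i)"
    and w: "\<And>i. i < N \<Longrightarrow> \<exists>w'. continuous_on {\<tau> i..\<tau> (Suc i)} w' \<and>
      (\<forall>t\<in>{\<tau> i..\<tau> (Suc i)}. (w has_vector_derivative w' t) (at t within {\<tau> i..\<tau> (Suc i)})) \<and>
      (\<forall>t\<in>{\<tau> i<..<\<tau> (Suc i)}. h t = q (w' t) (w' t) - q (K t *v w t) (w t))"
  shows "\<exists>S\<ge>0. (h has_integral q (U l *v w l) (w l) - q (b *v w 0) (w 0) + S) {0..l} \<and>
    (S = 0 \<longleftrightarrow> (\<forall>t\<in>{0..l}. w t = Y t *v w 0))"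
proof -
  let ?F = "\<lambda>t. q (U t *v w t) (w t)" and ?z = "\<lambda>t. matrix_inv (Y t) *v w t"
  note mono = partition_mono[where \<tau>=\<tau> and N=N, OF \<tau>(3)]
  have "\<exists>S\<ge>0. (h has_integral ?F (\<tau> i) - ?F 0 + S) {0..\<tau> i} \<and> (S = 0 \<longleftrightarrow> (\<forall>t\<in>{0..\<tau> i}. ?z t = ?z 0))"
    if "i \<le> N" for i
    using that
  proof (induction i)
    case 0
    show ?case by (intro exI[of _ 0]) (auto simp: \<tau>(1))
  next
    case (Suc i)
    then have i: "i < N" by simp
    obtain S where S: "S \<ge> 0" "(h has_integral ?F (\<tau> i) - ?F 0 + S) {0..\<tau> i}"
      "S = 0 \<longleftrightarrow> (\<forall>t\<in>{0..\<tau> i}. ?z t = ?z 0)" using Suc by auto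
    obtain w' where w': "continuous_on {\<tau> i..\<tau> (Suc i)} w'"
      "\<And>t. t\<in>{\<tau> i..\<tau> (Suc i)} \<Longrightarrow> (w has_vector_derivative w' t) (at t within {\<tau> i..\<tau> (Suc i)})"
      "\<And>t. t\<in>{\<tau> i<..<\<tau> (Suc i)} \<Longrightarrow> h t = q (w' t) (w' t) - q (K t *v w t) (w t)"
      using w[OF i] by blast
    have b: "0 \<le> \<tau> i" "\<tau> (Suc i) \<le> l" using mono[of 0 i] mono[of "Suc i" N] i \<tau> by auto
    obtain T where T: "T \<ge> 0" "((\<lambda>t. q (w' t) (w' t) - q (K t *v w t) (w t)) has_integral
        ?F (\<tau> (Suc i)) - ?F (\<tau> i) + T) {\<tau> i..\<tau> (Suc i)}"
      "T = 0 \<longleftrightarrow> (\<forall>t\<in>{\<tau> i..\<tau> (Suc i)}. ?z t = ?z (\<tau> i))"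
      using index_piece[OF b(1) \<tau>(3)[OF i] b(2) w'(2,1)] by auto
    \<comment> \<open>Changing the integrand at the two ends of a piece does not change the
      integral.\<close>
    have "(h has_integral ?F (\<tau> (Suc i)) - ?F (\<tau> i) + T) {\<tau> i..\<tau> (Suc i)}"
      by (rule has_integral_spike_finite[OF _ _ T(2), of "{\<tau> i, \<tau> (Suc i)}"]) (auto intro!: w'(3))
    from has_integral_combine[OF b(1) less_imp_le[OF \<tau>(3)[OF i]] S(2) this]
    have "(h has_integral ?F (\<tau> (Suc i)) - ?F 0 + (S + T)) {0..\<tau> (Suc i)}" by (simp add: algebra_simps)
    moreover have "S + T = 0 \<longleftrightarrow> (\<forall>t\<in>{0..\<tau> (Suc i)}. ?z t = ?z 0)"
    proof -
      have sp: "{0..\<tau> (Suc i)} = {0..\<tau> i} \<union> {\<tau> i..\<tau> (Suc i)}" "\<tau> i \<in> {0..\<tau> i}" using b \<tau>(3)[OF i] by auto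
      \<comment> \<open>Nonnegativity of both excesses excludes cancellation.\<close>
      have "S + T = 0 \<longleftrightarrow> S = 0 \<and> T = 0" using S(1) T(1) by auto
      also have "\<dots> \<longleftrightarrow> (\<forall>t\<in>{0..\<tau> (Suc i)}. ?z t = ?z 0)" unfolding S(3) T(3) sp(1) using sp(2)
        by (metis UnCI UnE)
      finally show ?thesis .
    qed
    ultimately show ?case using S(1) T(1) by (intro exI[of _ "S + T"]) auto
  qed
  from this[of N] obtain S where S: "S \<ge> 0" "(h has_integral ?F l - ?F 0 + S) {0..l}"
    "S = 0 \<longleftrightarrow> (\<forall>t\<in>{0..l}. ?z t = ?z 0)" by (auto simp: \<tau>)
  have z0: "?z 0 = w 0" using matrix_inv_cancel(4)[OF Y_inv[of 0], of "w 0"] l_pos by (simp add: Y0)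
  \<comment> \<open>From Y(0) = 1 and Y'(0) = b: the lower boundary term becomes the one that the
    index form contains.\<close>
  have "U 0 *v w 0 = b *v w 0" using U_Y[of 0 "w 0"] l_pos by (simp add: Y0)
  moreover have "?z t = w 0 \<longleftrightarrow> w t = Y t *v w 0" if "t \<in> {0..l}" for t
    using matrix_inv_cancel(3,4)[OF Y_inv[OF that]] by metis
  ultimately show ?thesis using S z0 by auto
qed

end

section \<open>Connection and curvature in charts\<close>

lemma has_derivative_vecI:
  fixes f :: "'e::real_normed_vector \<Rightarrow> 'b::euclidean_space ^ 'n"
  assumes "\<And>i. ((\<lambda>s. f s $ i) has_derivative (\<lambda>w. f' w $ i)) F"
  shows "(f has_derivative f') F"
proof -
  have b: "bounded_linear (\<lambda>x::'b. (axis i x :: 'b ^ 'n))" for i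
    by (auto simp: linear_conv_bounded_linear[symmetric] axis_def vec_eq_iff intro!: linearI)
  have e: "(\<Sum>i\<in>UNIV. axis i (v $ i)) = (v :: 'b ^ 'n)" for v
    by (simp add: vec_eq_iff axis_def if_distrib cong: if_cong)
  have "((\<lambda>s. \<Sum>i\<in>UNIV. axis i (f s $ i)) has_derivative (\<lambda>w. \<Sum>i\<in>UNIV. axis i (f' w $ i))) F"
    by (intro has_derivative_sum bounded_linear.has_derivative[OF b] assms)
  then show ?thesis by (simp only: e)
qed

text \<open>Coefficients are a function of two indices, so that both the metric and the Christoffel
  symbols with fixed upper index are instances.\<close>

definition coeff_form :: "('n::finite \<Rightarrow> 'n \<Rightarrow> real) \<Rightarrow> real ^ 'n \<Rightarrow> real ^ 'n \<Rightarrow> real" where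
  "coeff_form G u v = (\<Sum>i\<in>UNIV. \<Sum>j\<in>UNIV. G i j * u $ i * v $ j)"

lemma bounded_bilinear_coeff_form: "bounded_bilinear (coeff_form G)"
  unfolding bilinear_conv_bounded_bilinear[symmetric] bilinear_def coeff_form_def
  by (intro conjI allI linearI) (simp_all add: sum.distrib sum_distrib_left algebra_simps)

lemma has_derivative_coeff_form:
  assumes "\<And>i j. ((\<lambda>s. G s i j) has_derivative (\<lambda>w. G' w i j)) (at s within S)"
    and a: "(a has_derivative a') (at s within S)" and b: "(b has_derivative b') (at s within S)"
  shows "((\<lambda>s. coeff_form (G s) (a s) (b s)) has_derivative
    (\<lambda>w. coeff_form (G' w) (a s) (b s) + coeff_form (G s) (a' w) (b s) + coeff_form (G s) (a s) (b' w))) (at s within S)"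
proof -
  have "((\<lambda>s. coeff_form (G s) (a s) (b s)) has_derivative
     (\<lambda>w. \<Sum>i\<in>UNIV. \<Sum>j\<in>UNIV. G s i j * a s $ i * b' w $ j + (G s i j * a' w $ i + G' w i j * a s $ i) * b s $ j)) (at s within S)"
    unfolding coeff_form_def
    by (intro has_derivative_sum has_derivative_mult assms bounded_linear.has_derivative[OF bounded_linear_vec_nth])
  then show ?thesis
    by (rule has_derivative_eq_rhs) (simp add: coeff_form_def sum.distrib algebra_simps)
qed

lemma Ck_on_coeff_form:
  assumes S: "thick S" and "\<And>i j. Ck_on k S (\<lambda>s. G s i j)" "Ck_on k S a" "Ck_on k S b"
  shows "Ck_on k S (\<lambda>s. coeff_form (G s) (a s) (b s))"
  unfolding coeff_form_def by (intro Ck_on_sum Ck_on_mult Ck_on_nth S assms)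

lemma has_derivative_pderiv:
  assumes f: "f differentiable (at (y s))" and y: "(y has_derivative y') (at s within S)"
  shows "((\<lambda>s. f (y s)) has_derivative (\<lambda>w. \<Sum>k\<in>UNIV. pderiv_at f k (y s) * y' w $ k)) (at s within S)"
proof -
  let ?D = "frechet_derivative f (at (y s))"
  have D: "(f has_derivative ?D) (at (y s))" using f frechet_derivative_works by blast
  then have lin: "linear ?D" using has_derivative_linear by blast
  have "?D v = (\<Sum>k\<in>UNIV. pderiv_at f k (y s) * v $ k)" for v
  proof -
    have "?D v = ?D (\<Sum>k\<in>UNIV. v $ k *\<^sub>R axis k 1)"
      using basis_expansion[of v] by (simp add: scalar_mult_eq_scaleR)
    then show ?thesis by (simp add: linear_sum[OF lin] linear_cmul[OF lin] pderiv_at_def mult.commute)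
  qed
  moreover have "((\<lambda>s. f (y s)) has_derivative (\<lambda>w. ?D (y' w))) (at s within S)"
    by (rule has_derivative_compose[OF y has_derivative_at_withinI]) (rule D)
  ultimately show ?thesis by simp
qed

definition metric_form ::
  "('a, 'n::finite) chart set \<Rightarrow> ('a, 'n) metric_tensor \<Rightarrow> ('a, 'n) chart \<Rightarrow> real ^ 'n \<Rightarrow> real ^ 'n \<Rightarrow> real ^ 'n \<Rightarrow> real" where
  "metric_form A g c x = coeff_form (\<lambda>i j. metric_coeff A g c x $ i $ j)"

definition connection ::
  "('a, 'n::finite) chart set \<Rightarrow> ('a, 'n) metric_tensor \<Rightarrow> ('a, 'n) chart \<Rightarrow> real ^ 'n \<Rightarrow> real ^ 'n \<Rightarrow> real ^ 'n \<Rightarrow> real ^ 'n" where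
  "connection A g c x u v = (\<chi> k. coeff_form (christoffel A g c x k) u v)"

definition connection_deriv ::
  "('a, 'n::finite) chart set \<Rightarrow> ('a, 'n) metric_tensor \<Rightarrow> ('a, 'n) chart \<Rightarrow> real ^ 'n \<Rightarrow> real ^ 'n \<Rightarrow> real ^ 'n \<Rightarrow> real ^ 'n \<Rightarrow> real ^ 'n" where
  "connection_deriv A g c x w u v =
     (\<chi> l. coeff_form (\<lambda>j k. \<Sum>i\<in>UNIV. pderiv_at (\<lambda>y. christoffel A g c y l j k) i x * w $ i) u v)"

text \<open>The index-free coordinate curvature: derivatives of the connection in its base point,
  antisymmetrized, plus the commutator of the connection. The transformation law and the symmetries
  are proved in this form; \<open>curvature_chart\<close> identifies it with the index
  formula.\<close>

definition chart_curvature ::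
  "('a, 'n::finite) chart set \<Rightarrow> ('a, 'n) metric_tensor \<Rightarrow> ('a, 'n) chart \<Rightarrow> real ^ 'n \<Rightarrow> real ^ 'n \<Rightarrow> real ^ 'n \<Rightarrow> real ^ 'n \<Rightarrow> real ^ 'n" where
  "chart_curvature A g c x u v w =
     connection_deriv A g c x u v w - connection_deriv A g c x v u w
     + connection A g c x u (connection A g c x v w) - connection A g c x v (connection A g c x u w)"

lemma bounded_bilinear_vec:
  fixes f :: "'a::euclidean_space \<Rightarrow> 'b::euclidean_space \<Rightarrow> real ^ 'n"
  assumes "\<And>k. bounded_bilinear (\<lambda>u v. f u v $ k)"
  shows "bounded_bilinear f"
  unfolding bilinear_conv_bounded_bilinear[symmetric] bilinear_def
  by (intro conjI allI linearI)
     (simp_all add: vec_eq_iff bounded_bilinear.add_left[OF assms] bounded_bilinear.add_right[OF assms]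
       bounded_bilinear.scaleR_left[OF assms] bounded_bilinear.scaleR_right[OF assms]
       bounded_bilinear.scaleR_left[OF assms, simplified] bounded_bilinear.scaleR_right[OF assms, simplified])

lemma bounded_bilinear_metric_form: "bounded_bilinear (metric_form A g c x)"
  unfolding metric_form_def by (rule bounded_bilinear_coeff_form)

lemma bounded_bilinear_connection: "bounded_bilinear (connection A g c x)"
  by (rule bounded_bilinear_vec) (simp add: connection_def bounded_bilinear_coeff_form)

lemma bounded_bilinear_connection_deriv: "bounded_bilinear (connection_deriv A g c x w)"
  by (rule bounded_bilinear_vec) (simp add: connection_deriv_def bounded_bilinear_coeff_form)

lemma linear_connection_deriv: "linear (\<lambda>w. connection_deriv A g c x w u v)"
  by (rule linearI)
     (simp_all add: connection_deriv_def vec_eq_iff coeff_form_def sum.distrib sum_distrib_left sum_distrib_right algebra_simps)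

text \<open>Needed for metric compatibility: the index contracted between Christoffel symbol and
  metric is outermost in one expansion and innermost in the other.\<close>

lemma sum_rotate4:
  fixes f :: "'i::finite \<Rightarrow> 'j::finite \<Rightarrow> 'k::finite \<Rightarrow> 'l::finite \<Rightarrow> real"
  shows "(\<Sum>i\<in>UNIV. \<Sum>j\<in>UNIV. \<Sum>k\<in>UNIV. \<Sum>l\<in>UNIV. f i j k l) = (\<Sum>l\<in>UNIV. \<Sum>j\<in>UNIV. \<Sum>k\<in>UNIV. \<Sum>i\<in>UNIV. f i j k l)"
proof -
  have "(\<Sum>i\<in>UNIV. \<Sum>j\<in>UNIV. \<Sum>k\<in>UNIV. \<Sum>l\<in>UNIV. f i j k l) = (\<Sum>i\<in>UNIV. \<Sum>l\<in>UNIV. \<Sum>j\<in>UNIV. \<Sum>k\<in>UNIV. f i j k l)"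
    by (rule sum.cong[OF refl], rule trans[OF _ sum.swap], rule sum.cong[OF refl], rule sum.swap)
  also have "\<dots> = (\<Sum>l\<in>UNIV. \<Sum>i\<in>UNIV. \<Sum>j\<in>UNIV. \<Sum>k\<in>UNIV. f i j k l)" by (rule sum.swap)
  also have "\<dots> = (\<Sum>l\<in>UNIV. \<Sum>j\<in>UNIV. \<Sum>k\<in>UNIV. \<Sum>i\<in>UNIV. f i j k l)"
    by (rule sum.cong[OF refl]) (subst sum.swap, rule sum.cong[OF refl], rule sum.swap)
  finally show ?thesis .
qed

lemma sum_reverse3:
  fixes f :: "'j::finite \<Rightarrow> 'k::finite \<Rightarrow> 'l::finite \<Rightarrow> real"
  shows "(\<Sum>j\<in>UNIV. \<Sum>k\<in>UNIV. \<Sum>l\<in>UNIV. f j k l) = (\<Sum>l\<in>UNIV. \<Sum>k\<in>UNIV. \<Sum>j\<in>UNIV. f j k l)"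
proof -
  have "(\<Sum>j\<in>UNIV. \<Sum>k\<in>UNIV. \<Sum>l\<in>UNIV. f j k l) = (\<Sum>l\<in>UNIV. \<Sum>j\<in>UNIV. \<Sum>k\<in>UNIV. f j k l)"
    by (rule trans[OF _ sum.swap], rule sum.cong[OF refl], rule sum.swap)
  also have "\<dots> = (\<Sum>l\<in>UNIV. \<Sum>k\<in>UNIV. \<Sum>j\<in>UNIV. f j k l)"
    by (rule sum.cong[OF refl], rule sum.swap)
  finally show ?thesis .
qed

lemma Ck_on_pderiv_at:
  assumes U: "open U" and f: "Ck_on (Suc k) U f"
  shows "Ck_on k U (\<lambda>x. pderiv_at f i x)"
  by (rule Ck_on_cong[OF Ck_on_frechet[OF f, of "axis i 1"]]) (simp add: pderiv_at_def at_within_open[OF _ U])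

lemma Ck_on_differentiable_at:
  assumes "open U" "Ck_on (Suc k) U f" "x \<in> U"
  shows "f differentiable (at x)"
  using assms by (simp add: differentiable_on_eq_differentiable_at)

section \<open>Smoothness, symmetry and metric compatibility in one chart\<close>

context riemannian_manifold begin

abbreviation "mform \<equiv> metric_form A g"
abbreviation "conn \<equiv> connection A g"
abbreviation "dconn \<equiv> connection_deriv A g"
abbreviation "curv \<equiv> chart_curvature A g"

lemma thick_chart: "c \<in> A \<Longrightarrow> thick (snd c ` fst c)"
  by (rule thick_open[OF chart_img_open])

lemma Ck_on_metric_coeff:
  assumes c: "c \<in> A" shows "Ck_on k (snd c ` fst c) (metric_coeff A g c)"
    and "Ck_on k (snd c ` fst c) (\<lambda>x. metric_coeff A g c x $ i $ j)"
proof -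
  show "Ck_on k (snd c ` fst c) (metric_coeff A g c)" using metric_smooth[OF c] by (simp add: smooth_on_def)
  then show "Ck_on k (snd c ` fst c) (\<lambda>x. metric_coeff A g c x $ i $ j)"
    by (intro Ck_on_nth thick_chart c)
qed

lemma Ck_on_christoffel:
  assumes c: "c \<in> A" shows "Ck_on k (snd c ` fst c) (\<lambda>x. christoffel A g c x m i j)"
proof -
  have "Ck_on k (snd c ` fst c) (\<lambda>x. matrix_inv (metric_coeff A g c x))"
    by (rule Ck_on_matrix_inv[OF thick_chart[OF c] Ck_on_metric_coeff(1)[OF c]]) (use metric_coeff_inv[OF c] in auto)
  then show ?thesis unfolding christoffel_def divide_inverse
    by (intro Ck_on_mult Ck_on_sum Ck_on_const Ck_on_add Ck_on_diff Ck_on_nth thick_chart[OF c]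
        Ck_on_pderiv_at chart_img_open[OF c] Ck_on_metric_coeff(2)[OF c])
qed

lemma Ck_on_connection:
  assumes c: "c \<in> A" and S: "thick S" and y: "y ` S \<subseteq> snd c ` fst c" and k: "Ck_on k S y" "Ck_on k S a" "Ck_on k S b"
  shows "Ck_on k S (\<lambda>s. conn c (y s) (a s) (b s))"
  unfolding connection_def
  by (intro Ck_on_vec[OF S]; simp)
     (intro Ck_on_coeff_form[OF S] Ck_on_compose[OF S y Ck_on_christoffel[OF c]] k)

lemma Ck_on_connection_deriv:
  assumes c: "c \<in> A" and S: "thick S" and y: "y ` S \<subseteq> snd c ` fst c"
    and k: "Ck_on k S y" "Ck_on k S d" "Ck_on k S a" "Ck_on k S b"
  shows "Ck_on k S (\<lambda>s. dconn c (y s) (d s) (a s) (b s))"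
  unfolding connection_deriv_def
  by (intro Ck_on_vec[OF S]; simp)
     (intro Ck_on_coeff_form[OF S] Ck_on_sum[OF S] Ck_on_mult[OF S] Ck_on_nth[OF S]
        Ck_on_compose[OF S y Ck_on_pderiv_at[OF chart_img_open[OF c] Ck_on_christoffel[OF c]]] k)

lemma Ck_on_curvature:
  assumes c: "c \<in> A" and S: "thick S" and y: "y ` S \<subseteq> snd c ` fst c"
    and k: "Ck_on k S y" "Ck_on k S d" "Ck_on k S a" "Ck_on k S b"
  shows "Ck_on k S (\<lambda>s. curv c (y s) (d s) (a s) (b s))"
  unfolding chart_curvature_def
  by (intro Ck_on_add[OF S] Ck_on_diff[OF S] Ck_on_connection[OF c S y] Ck_on_connection_deriv[OF c S y] k)

lemma Ck_on_metric_form: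
  assumes c: "c \<in> A" and S: "thick S" and y: "y ` S \<subseteq> snd c ` fst c" and k: "Ck_on k S y" "Ck_on k S a" "Ck_on k S b"
  shows "Ck_on k S (\<lambda>s. mform c (y s) (a s) (b s))"
  unfolding metric_form_def
  by (intro Ck_on_coeff_form[OF S] Ck_on_compose[OF S y Ck_on_metric_coeff(2)[OF c]] k)

lemma connection_has_derivative:
  assumes c: "c \<in> A" and x: "y s \<in> snd c ` fst c"
    and y: "(y has_derivative y') (at s within S)"
    and a: "(a has_derivative a') (at s within S)" and b: "(b has_derivative b') (at s within S)"
  shows "((\<lambda>s. conn c (y s) (a s) (b s)) has_derivative
     (\<lambda>w. dconn c (y s) (y' w) (a s) (b s) + conn c (y s) (a' w) (b s) + conn c (y s) (a s) (b' w))) (at s within S)"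
proof (rule has_derivative_vecI)
  fix l
  have "((\<lambda>s. coeff_form (christoffel A g c (y s) l) (a s) (b s)) has_derivative
    (\<lambda>w. coeff_form (\<lambda>j k. \<Sum>i\<in>UNIV. pderiv_at (\<lambda>y. christoffel A g c y l j k) i (y s) * y' w $ i) (a s) (b s)
      + coeff_form (christoffel A g c (y s) l) (a' w) (b s) + coeff_form (christoffel A g c (y s) l) (a s) (b' w))) (at s within S)"
    by (intro has_derivative_coeff_form has_derivative_pderiv[where f="\<lambda>y. christoffel A g c y l _ _"]
        Ck_on_differentiable_at[OF chart_img_open[OF c] Ck_on_christoffel[OF c] x] y a b)
  then show "((\<lambda>s. conn c (y s) (a s) (b s) $ l) has_derivative
     (\<lambda>w. (dconn c (y s) (y' w) (a s) (b s) + conn c (y s) (a' w) (b s) + conn c (y s) (a s) (b' w)) $ l)) (at s within S)"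
    by (simp add: connection_def connection_deriv_def)
qed

lemma connection_sym:
  assumes c: "c \<in> A" and x: "x \<in> snd c ` fst c" shows "conn c x u v = conn c x v u"
  unfolding connection_def coeff_form_def vec_eq_iff
  by (subst sum.swap) (simp add: christoffel_torsion_free[OF c x] mult_ac)

text \<open>\<open>connection_sym\<close> holds on the whole open chart image and can be
  differentiated there.\<close>

lemma connection_deriv_sym:
  assumes c: "c \<in> A" and x: "x \<in> snd c ` fst c" shows "dconn c x w u v = dconn c x w v u"
proof -
  have d: "((\<lambda>y. conn c y u v) has_derivative (\<lambda>w. dconn c x w u v)) (at x)" for u v
    using connection_has_derivative[OF c x has_derivative_ident has_derivative_const has_derivative_const]
    by (simp add: bounded_bilinear.zero_left[OF bounded_bilinear_connection] bounded_bilinear.zero_right[OF bounded_bilinear_connection])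
  have "((\<lambda>y. conn c y u v) has_derivative (\<lambda>w. dconn c x w v u)) (at x)"
    by (rule has_derivative_transform_within_open[OF d[of v u] chart_img_open[OF c] x])
       (rule connection_sym[OF c])
  from has_derivative_unique[OF d this] show ?thesis by metis
qed

lemma metric_form_sym:
  assumes c: "c \<in> A" and x: "x \<in> snd c ` fst c" shows "mform c x u v = mform c x v u"
proof -
  obtain p where p: "p \<in> fst c" "x = snd c p" using x by blast
  show ?thesis unfolding metric_form_def coeff_form_def p(2)
    by (subst sum.swap) (intro sum.cong refl, subst metric_coeff_sym[OF c p(1)], simp only: mult_ac)
qed

text \<open>\<open>coord_vec\<close> rebuilds a tangent vector from its coordinates in any single
  chart around p, so \<open>gform\<close> evaluates the metric on arbitrary tangent vectors.\<close>

lemma metric_form_eq: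
  assumes c: "c \<in> A" and p: "p \<in> fst c" and u: "u \<in> tangent_space A p" and v: "v \<in> tangent_space A p"
  shows "g p u v = mform c (snd c p) (u c) (v c)"
proof -
  have e: "coord_vec A c p (u c) = u" if u: "u \<in> tangent_space A p" for u
  proof
    fix d
    show "coord_vec A c p (u c) d = u d"
    proof (cases "d \<in> A \<and> p \<in> fst d")
      case True
      then have "u d = frechet_derivative (transition c d) (at (snd c p)) (u c)"
        using u c p unfolding tangent_space_def by blast
      then show ?thesis using True by (simp only: coord_vec_def simp_thms if_True)
    next
      case False
      then have "u d = 0" using u unfolding tangent_space_def by blast
      then show ?thesis unfolding coord_vec_def using False by (simp only: if_False)
    qed
  qed
  show ?thesis using gform[OF c p, of "u c" "v c"] by (simp add: e u v metric_form_def coeff_form_def)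
qed

lemma metric_form_pos:
  assumes c: "c \<in> A" and x: "x \<in> snd c ` fst c" and u: "u \<noteq> 0" shows "mform c x u u > 0"
proof -
  obtain p where p: "p \<in> fst c" "x = snd c p" using x by blast
  have t: "coord_vec A c p u \<in> tangent_space A p" by (rule coord_vec_tangent[OF c p(1)])
  have s: "coord_vec A c p u c = u" by (rule coord_vec_self[OF c p(1)])
  then have "coord_vec A c p u \<noteq> (\<lambda>_. 0)" using u by auto
  then have "g p (coord_vec A c p u) (coord_vec A c p u) > 0"
    using metric_pos t charts_cover c p by blast
  then show ?thesis using metric_form_eq[OF c p(1) t t] by (simp add: s p(2))
qed

text \<open>\<open>christoffel_metric\<close> distributes the derivative of the coefficients over
  the two arguments. The map y is general on purpose: it will be a curve, the identity of a chart,
  and a transition map.\<close>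

lemma metric_form_has_derivative:
  assumes c: "c \<in> A" and x: "y s \<in> snd c ` fst c"
    and y: "(y has_derivative y') (at s within S)"
    and a: "(a has_derivative a') (at s within S)" and b: "(b has_derivative b') (at s within S)"
  shows "((\<lambda>s. mform c (y s) (a s) (b s)) has_derivative
     (\<lambda>w. mform c (y s) (a' w + conn c (y s) (y' w) (a s)) (b s) + mform c (y s) (a s) (b' w + conn c (y s) (y' w) (b s))))
     (at s within S)"
proof -
  let ?G = "\<lambda>i j. metric_coeff A g c (y s) $ i $ j" and ?C = "christoffel A g c (y s)"
  have "((\<lambda>s. coeff_form (\<lambda>i j. metric_coeff A g c (y s) $ i $ j) (a s) (b s)) has_derivative
    (\<lambda>w. coeff_form (\<lambda>i j. \<Sum>k\<in>UNIV. pderiv_at (\<lambda>y. metric_coeff A g c y $ i $ j) k (y s) * y' w $ k) (a s) (b s)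
      + coeff_form ?G (a' w) (b s) + coeff_form ?G (a s) (b' w))) (at s within S)"
    by (intro has_derivative_coeff_form has_derivative_pderiv[where f="\<lambda>y. metric_coeff A g c y $ _ $ _"]
        Ck_on_differentiable_at[OF chart_img_open[OF c] Ck_on_metric_coeff(2)[OF c] x] y a b)
  moreover have "coeff_form (\<lambda>i j. \<Sum>k\<in>UNIV. pderiv_at (\<lambda>y. metric_coeff A g c y $ i $ j) k (y s) * w $ k) u v
    = mform c (y s) (conn c (y s) w u) v + mform c (y s) u (conn c (y s) w v)" for w u v
  proof -
    have 1: "mform c (y s) (conn c (y s) w u) v =
        (\<Sum>l\<in>UNIV. \<Sum>j\<in>UNIV. \<Sum>k\<in>UNIV. \<Sum>i\<in>UNIV. ?C l k i * ?G l j * w $ k * u $ i * v $ j)"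
      by (simp add: metric_form_def connection_def coeff_form_def sum_distrib_left sum_distrib_right mult_ac)
    have 2: "mform c (y s) u (conn c (y s) w v) =
        (\<Sum>i\<in>UNIV. \<Sum>l\<in>UNIV. \<Sum>k\<in>UNIV. \<Sum>j\<in>UNIV. ?C l k j * ?G i l * w $ k * u $ i * v $ j)"
      by (simp add: metric_form_def connection_def coeff_form_def sum_distrib_left sum_distrib_right mult_ac)
    have 3: "(\<Sum>i\<in>UNIV. \<Sum>j\<in>UNIV. \<Sum>k\<in>UNIV. \<Sum>l\<in>UNIV. ?C l k j * ?G i l * w $ k * u $ i * v $ j) =
      (\<Sum>i\<in>UNIV. \<Sum>l\<in>UNIV. \<Sum>k\<in>UNIV. \<Sum>j\<in>UNIV. ?C l k j * ?G i l * w $ k * u $ i * v $ j)"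
      by (intro sum.cong refl sum_reverse3)
    have "coeff_form (\<lambda>i j. \<Sum>k\<in>UNIV. pderiv_at (\<lambda>y. metric_coeff A g c y $ i $ j) k (y s) * w $ k) u v =
      (\<Sum>i\<in>UNIV. \<Sum>j\<in>UNIV. \<Sum>k\<in>UNIV. \<Sum>l\<in>UNIV. ?C l k i * ?G l j * w $ k * u $ i * v $ j) +
      (\<Sum>i\<in>UNIV. \<Sum>j\<in>UNIV. \<Sum>k\<in>UNIV. \<Sum>l\<in>UNIV. ?C l k j * ?G i l * w $ k * u $ i * v $ j)"
      by (simp add: coeff_form_def christoffel_metric[OF c x] sum_distrib_left sum_distrib_right sum.distrib[symmetric] algebra_simps)
    then show ?thesis unfolding 1 2 3 by (subst (asm) sum_rotate4)
  qed
  ultimately show ?thesis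
    unfolding metric_form_def[symmetric]
    by (elim has_derivative_eq_rhs)
       (simp add: fun_eq_iff bounded_bilinear.add_left[OF bounded_bilinear_metric_form] bounded_bilinear.add_right[OF bounded_bilinear_metric_form])
qed

end

lemma sum_rotate3:
  fixes f :: "'m::finite \<Rightarrow> 'j::finite \<Rightarrow> 'k::finite \<Rightarrow> real"
  shows "(\<Sum>m\<in>UNIV. \<Sum>j\<in>UNIV. \<Sum>k\<in>UNIV. f m j k) = (\<Sum>j\<in>UNIV. \<Sum>k\<in>UNIV. \<Sum>m\<in>UNIV. f m j k)"
  by (rule trans[OF sum.swap], rule sum.cong[OF refl], rule sum.swap)

section \<open>Change of charts: tensoriality of the connection and of the curvature\<close>

context riemannian_manifold begin

abbreviation "dtrans c d x \<equiv> frechet_derivative (transition c d) (at x)"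

text \<open>Second derivative of the transition map, expanded so that linearity in \<open>v\<close> is evident.\<close>

definition "ddtrans c d x u v =
  (\<Sum>j\<in>UNIV. v $ j *\<^sub>R frechet_derivative (\<lambda>z. dtrans c d z (axis j 1)) (at x) u)"

lemma open_overlap: "c \<in> A \<Longrightarrow> d \<in> A \<Longrightarrow> open (snd c ` (fst c \<inter> fst d))"
  using overlap_open chart_dom_open by blast

lemma overlap_chart: "x \<in> snd c ` (fst c \<inter> fst d) \<Longrightarrow> x \<in> snd c ` fst c"
  by blast

lemma transition_chart:
  assumes "c \<in> A" "p \<in> fst c" shows "transition c d (snd c p) = snd d p"
  using assms by (simp add: transition_def chart_inv_left)

lemma transition_overlap:
  assumes "c \<in> A" "x \<in> snd c ` (fst c \<inter> fst d)" shows "transition c d x \<in> snd d ` fst d"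
  proof -
  obtain p where "p \<in> fst c" "p \<in> fst d" "x = snd c p" using assms(2) by blast
  then show ?thesis using transition_chart[OF assms(1), of p d] by (simp only: imageI)
qed

lemma Ck_on_transition:
  assumes "c \<in> A" "d \<in> A" shows "Ck_on k (snd c ` (fst c \<inter> fst d)) (transition c d)"
  using transition_smooth[OF assms] by (simp add: smooth_on_def)

lemma Ck_on_dtrans:
  assumes cd: "c \<in> A" "d \<in> A" shows "Ck_on k (snd c ` (fst c \<inter> fst d)) (\<lambda>x. dtrans c d x v)"
  by (rule Ck_on_cong[OF Ck_on_frechet[OF Ck_on_transition[OF cd]]])
     (simp add: at_within_open[OF _ open_overlap[OF cd]])

lemma transition_has_derivative:
  assumes cd: "c \<in> A" "d \<in> A" and x: "x \<in> snd c ` (fst c \<inter> fst d)"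
  shows "(transition c d has_derivative dtrans c d x) (at x)"
  using transition_diff[OF cd] x by blast

lemma linear_dtrans:
  assumes cd: "c \<in> A" "d \<in> A" and x: "x \<in> snd c ` (fst c \<inter> fst d)"
  shows "linear (dtrans c d x)"
  using transition_has_derivative[OF assms] has_derivative_linear by blast

text \<open>Base point and argument vary together; expanding the argument in the standard basis
  reduces this to the product rule with fixed directions.\<close>

lemma dtrans_has_derivative:
  assumes cd: "c \<in> A" "d \<in> A" and s: "s \<in> S" and yS: "y ` S \<subseteq> snd c ` (fst c \<inter> fst d)"
    and y: "(y has_derivative y') (at s within S)" and a: "(a has_derivative a') (at s within S)"
  shows "((\<lambda>s. dtrans c d (y s) (a s)) has_derivative
    (\<lambda>w. ddtrans c d (y s) (y' w) (a s) + dtrans c d (y s) (a' w))) (at s within S)"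
proof -
  let ?U = "snd c ` (fst c \<inter> fst d)"
  have x: "y s \<in> ?U" using s yS by auto
  have e: "(\<Sum>j\<in>UNIV. v $ j *\<^sub>R dtrans c d x (axis j 1)) = dtrans c d x v" if "x \<in> ?U" for x v
  proof -
    have "dtrans c d x v = dtrans c d x (\<Sum>j\<in>UNIV. v $ j *\<^sub>R axis j 1)"
      using basis_expansion[of v] by (simp add: scalar_mult_eq_scaleR)
    then show ?thesis using linear_dtrans[OF cd that] by (simp add: linear_sum linear_cmul)
  qed
  have D: "((\<lambda>z. dtrans c d z v) has_derivative frechet_derivative (\<lambda>z. dtrans c d z v) (at (y s))) (at (y s))" for v
    using Ck_on_has_derivative[OF Ck_on_dtrans[OF cd] x] by (simp add: at_within_open[OF x open_overlap[OF cd]])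
  have "((\<lambda>s. \<Sum>j\<in>UNIV. a s $ j *\<^sub>R dtrans c d (y s) (axis j 1)) has_derivative
    (\<lambda>w. \<Sum>j\<in>UNIV. a s $ j *\<^sub>R frechet_derivative (\<lambda>z. dtrans c d z (axis j 1)) (at (y s)) (y' w)
      + a' w $ j *\<^sub>R dtrans c d (y s) (axis j 1))) (at s within S)"
    by (intro has_derivative_sum has_derivative_scaleR bounded_linear.has_derivative[OF bounded_linear_vec_nth] a
         has_derivative_compose[OF y has_derivative_at_withinI[OF D]])
  then have "((\<lambda>s. \<Sum>j\<in>UNIV. a s $ j *\<^sub>R dtrans c d (y s) (axis j 1)) has_derivative
    (\<lambda>w. ddtrans c d (y s) (y' w) (a s) + dtrans c d (y s) (a' w))) (at s within S)"
    by (rule has_derivative_eq_rhs) (simp add: fun_eq_iff sum.distrib ddtrans_def e[OF x])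
  then show ?thesis
    by (rule has_derivative_transform[OF s, rotated]) (use e yS in auto)
qed

lemma dtrans_frechet:
  assumes cd: "c \<in> A" "d \<in> A" and x: "x \<in> snd c ` (fst c \<inter> fst d)"
  shows "frechet_derivative (\<lambda>z. dtrans c d z v) (at x) u = ddtrans c d x u v"
proof -
  have "((\<lambda>z. dtrans c d z v) has_derivative (\<lambda>w. ddtrans c d x w v + dtrans c d x 0)) (at x within snd c ` (fst c \<inter> fst d))"
    by (rule dtrans_has_derivative[OF cd x _ has_derivative_ident has_derivative_const]) simp
  then have "((\<lambda>z. dtrans c d z v) has_derivative (\<lambda>w. ddtrans c d x w v)) (at x)"
    using linear_0[OF linear_dtrans[OF assms]] by (simp add: at_within_open[OF x open_overlap[OF cd]])
  from frechet_derivative_at[OF this] show ?thesis by metis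
qed

lemma ddtrans_sym:
  assumes cd: "c \<in> A" "d \<in> A" and x: "x \<in> snd c ` (fst c \<inter> fst d)"
  shows "ddtrans c d x u v = ddtrans c d x v u"
  using second_frechet_derivative_symmetric[OF open_overlap[OF cd] x Ck_on_transition[OF cd], of v u]
  by (simp add: dtrans_frechet[OF assms])

lemma dtrans_inverse:
  assumes cd: "c \<in> A" "d \<in> A" and p: "p \<in> fst c" "p \<in> fst d"
  shows "dtrans d c (snd d p) (dtrans c d (snd c p) v) = v"
  using chain[OF cd cd(1) p p(1), of v] coord_vec_self[OF cd(1) p(1), of v] cd p
  by (simp add: coord_vec_def)

text \<open>Both sides evaluate g at one point on the same pair of tangent vectors, read in the two
  charts.\<close>

lemma metric_form_transform:
  assumes cd: "c \<in> A" "d \<in> A" and x: "x \<in> snd c ` (fst c \<inter> fst d)"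
  shows "mform d (transition c d x) (dtrans c d x u) (dtrans c d x v) = mform c x u v"
proof -
  obtain p where p: "p \<in> fst c" "p \<in> fst d" "x = snd c p" using x by blast
  have t: "coord_vec A c p u \<in> tangent_space A p" for u by (rule coord_vec_tangent[OF cd(1) p(1)])
  have "coord_vec A c p u d = dtrans c d x u" for u
    using cd p by (simp only: coord_vec_def simp_thms if_True)
  then show ?thesis
    using metric_form_eq[OF cd(1) p(1) t t, of u v] metric_form_eq[OF cd(2) p(2) t t, of u v]
    by (simp add: coord_vec_self[OF cd(1) p(1)] p(3) transition_chart[OF cd(1) p(1)])
qed

lemma metric_form_nondegenerate:
  assumes c: "c \<in> A" and x: "x \<in> snd c ` fst c" and "mform c x u u = 0" shows "u = 0"
  using metric_form_pos[OF c x, of u] assms(3) by fastforce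

lemma connection_transform:
  assumes cd: "c \<in> A" "d \<in> A" and x: "x \<in> snd c ` (fst c \<inter> fst d)"
  shows "conn d (transition c d x) (dtrans c d x u) (dtrans c d x v) + ddtrans c d x u v = dtrans c d x (conn c x u v)"
proof -
  let ?U = "snd c ` (fst c \<inter> fst d)"
  let ?f = "transition c d" and ?D = "dtrans c d x"
  have fx: "?f x \<in> snd d ` fst d" by (rule transition_overlap[OF cd(1) x])
  have w: "at x within ?U = at x" by (rule at_within_open[OF x open_overlap[OF cd]])
  have D0: "?D 0 = 0" by (rule linear_0[OF linear_dtrans[OF cd x]])
  note h = bounded_bilinear_metric_form[of A g d "?f x"]
  txt \<open>The defect of the law is symmetric (torsion-freeness) and skew for the metric (metric
    compatibility), hence zero: this is the uniqueness of the Levi-Civita connection.\<close>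
  define S where "S u v = conn d (?f x) (?D u) (?D v) + ddtrans c d x u v - ?D (conn c x u v)" for u v
  have S_sym: "S u v = S v u" for u v
    unfolding S_def using ddtrans_sym[OF cd x, of u v] connection_sym[OF cd(2) fx, of "?D u" "?D v"]
      connection_sym[OF cd(1) overlap_chart[OF x], of u v] by simp
  have skew: "mform d (?f x) (S u v) (?D z) + mform d (?f x) (?D v) (S u z) = 0" for u v z
  proof -
    have 1: "((\<lambda>x. mform c x v z) has_derivative (\<lambda>w. mform c x (conn c x w v) z + mform c x v (conn c x w z))) (at x)"
      using metric_form_has_derivative[OF cd(1) overlap_chart[OF x] has_derivative_ident has_derivative_const has_derivative_const]
      by simp
    have D: "((\<lambda>x. dtrans c d x v) has_derivative (\<lambda>w. ddtrans c d x w v)) (at x)" for v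
      using dtrans_has_derivative[OF cd x _ has_derivative_ident has_derivative_const] D0 w by simp
    have 2: "((\<lambda>x. mform d (?f x) (dtrans c d x v) (dtrans c d x z)) has_derivative
      (\<lambda>w. mform d (?f x) (ddtrans c d x w v + conn d (?f x) (?D w) (?D v)) (?D z) +
         mform d (?f x) (?D v) (ddtrans c d x w z + conn d (?f x) (?D w) (?D z)))) (at x)"
      by (rule metric_form_has_derivative[OF cd(2) fx transition_has_derivative[OF cd x] D D])
    have "((\<lambda>x. mform c x v z) has_derivative
      (\<lambda>w. mform d (?f x) (ddtrans c d x w v + conn d (?f x) (?D w) (?D v)) (?D z) +
         mform d (?f x) (?D v) (ddtrans c d x w z + conn d (?f x) (?D w) (?D z)))) (at x)"
      by (rule has_derivative_transform_within_open[OF 2 open_overlap[OF cd] x])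
         (rule metric_form_transform[OF cd])
    from fun_cong[OF has_derivative_unique[OF 1 this], of u]
    have "mform d (?f x) (?D (conn c x u v)) (?D z) + mform d (?f x) (?D v) (?D (conn c x u z)) =
      mform d (?f x) (ddtrans c d x u v + conn d (?f x) (?D u) (?D v)) (?D z) +
         mform d (?f x) (?D v) (ddtrans c d x u z + conn d (?f x) (?D u) (?D z))"
      by (simp only: metric_form_transform[OF cd x])
    then show ?thesis
      by (simp add: S_def bounded_bilinear.add_left[OF h] bounded_bilinear.add_right[OF h]
        bounded_bilinear.diff_left[OF h] bounded_bilinear.diff_right[OF h])
  qed
  have zero: "mform d (?f x) (S u v) (?D z) = 0" for u v z
  proof -
    define t where "t u v z = mform d (?f x) (S u v) (?D z)" for u v z
    have a: "t u v z = - t u z v" for u v z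
      using skew[of u v z] metric_form_sym[OF cd(2) fx, of "?D v" "S u z"] by (simp add: t_def)
    have s: "t u v z = t v u z" for u v z unfolding t_def by (subst S_sym) (rule refl)
    \<comment> \<open>A form symmetric in its first two slots and skew in its last two vanishes:
      alternating the two exchanges runs through all six permutations and returns with three sign
      changes.\<close>
    have "t u v z = - t u v z"
      using a[of u v z] s[of u z v] a[of z u v] s[of z v u] a[of v z u] s[of v u z] by linarith
    then show ?thesis by (simp add: t_def)
  qed
  obtain p where p: "p \<in> fst c" "p \<in> fst d" "x = snd c p" using x by blast
  \<comment> \<open>The differential is onto, so \<open>zero\<close> may be tested against S u v
    itself.\<close>
  have "?D (dtrans d c (snd d p) (S u v)) = S u v"
    using dtrans_inverse[OF cd(2,1) p(2,1)] p(3) by simp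
  then have "mform d (?f x) (S u v) (S u v) = 0" using zero by metis
  then have "S u v = 0" by (rule metric_form_nondegenerate[OF cd(2) fx])
  then show ?thesis by (simp add: S_def)
qed

text \<open>Solving \<open>connection_transform\<close> for the second derivative of the transition
  map and inserting it into the product rule. In this form covariant differentiation commutes with
  changing charts, and no second derivative is left over.\<close>

lemma dtrans_covariant_derivative:
  assumes cd: "c \<in> A" "d \<in> A" and s: "s \<in> S" and yS: "y ` S \<subseteq> snd c ` (fst c \<inter> fst d)"
    and y: "(y has_derivative y') (at s within S)" and a: "(a has_derivative a') (at s within S)"
  shows "((\<lambda>s. dtrans c d (y s) (a s)) has_derivative
    (\<lambda>w. dtrans c d (y s) (a' w + conn c (y s) (y' w) (a s))
        - conn d (transition c d (y s)) (dtrans c d (y s) (y' w)) (dtrans c d (y s) (a s)))) (at s within S)"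
proof (rule has_derivative_eq_rhs[OF dtrans_has_derivative[OF assms]], rule ext)
  fix w
  have x: "y s \<in> snd c ` (fst c \<inter> fst d)" using s yS by auto
  show "ddtrans c d (y s) (y' w) (a s) + dtrans c d (y s) (a' w) =
    dtrans c d (y s) (a' w + conn c (y s) (y' w) (a s))
        - conn d (transition c d (y s)) (dtrans c d (y s) (y' w)) (dtrans c d (y s) (a s))"
    using connection_transform[OF cd x, of "y' w" "a s"]
    by (simp add: linear_add[OF linear_dtrans[OF cd x]] algebra_simps)
qed

lemma connection_deriv_at:
  assumes c: "c \<in> A" and x: "x \<in> snd c ` fst c"
  shows "((\<lambda>x. conn c x u v) has_derivative (\<lambda>w. dconn c x w u v)) (at x)"
  using connection_has_derivative[OF c x has_derivative_ident has_derivative_const has_derivative_const]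
  by (simp add: bounded_bilinear.zero_left[OF bounded_bilinear_connection] bounded_bilinear.zero_right[OF bounded_bilinear_connection])

lemma curvature_transform:
  assumes cd: "c \<in> A" "d \<in> A" and x: "x \<in> snd c ` (fst c \<inter> fst d)"
  shows "curv d (transition c d x) (dtrans c d x u) (dtrans c d x v) (dtrans c d x w) = dtrans c d x (curv c x u v w)"
proof -
  let ?U = "snd c ` (fst c \<inter> fst d)"
  let ?f = "transition c d" and ?D = "dtrans c d x"
  have fx: "?f x \<in> snd d ` fst d" by (rule transition_overlap[OF cd(1) x])
  have xc: "x \<in> snd c ` fst c" by (rule overlap_chart[OF x])
  have wi: "at x within ?U = at x" by (rule at_within_open[OF x open_overlap[OF cd]])
  note lin = linear_dtrans[OF cd x]
  note G = bounded_bilinear_connection[of A g d "?f x"]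
  txt \<open>The law follows by differentiating the transformation law of the connection and
    antisymmetrizing: the third derivatives of the transition map cancel.\<close>
  define D3 where "D3 u v = frechet_derivative (\<lambda>y. ddtrans c d y v w) (at x) u" for u v
  have D3_sym: "D3 u v = D3 v u" for u v
  proof -
    have "frechet_derivative (\<lambda>y. frechet_derivative (\<lambda>z. dtrans c d z w) (at y) v) (at x) u = D3 u v" for u v
    proof -
      have "((\<lambda>y. ddtrans c d y v w) has_derivative D) (at x) \<longleftrightarrow>
        ((\<lambda>y. frechet_derivative (\<lambda>z. dtrans c d z w) (at y) v) has_derivative D) (at x)" for D
        using has_derivative_transform_within_open[OF _ open_overlap[OF cd] x] dtrans_frechet[OF cd]
        by (metis (no_types, lifting))
      then show ?thesis unfolding D3_def frechet_derivative_def by presburger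
    qed
    then show ?thesis
      using second_frechet_derivative_symmetric[OF open_overlap[OF cd] x Ck_on_dtrans[OF cd], of w v u] by simp
  qed
  have dd: "ddtrans c d y u v = dtrans c d y (conn c y u v) - conn d (?f y) (dtrans c d y u) (dtrans c d y v)"
    if "y \<in> ?U" for y u v using connection_transform[OF cd that, of u v] by (simp add: algebra_simps)
  have D3: "D3 u v = ?D (dconn c x u v w + conn c x u (conn c x v w)) - conn d (?f x) (?D u) (?D (conn c x v w))
     - (dconn d (?f x) (?D u) (?D v) (?D w) + conn d (?f x) (ddtrans c d x u v) (?D w) + conn d (?f x) (?D v) (ddtrans c d x u w))" for u v
  proof -
    have 1: "((\<lambda>y. dtrans c d y (conn c y v w)) has_derivative
      (\<lambda>u. ?D (dconn c x u v w + conn c x u (conn c x v w)) - conn d (?f x) (?D u) (?D (conn c x v w)))) (at x)"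
      using dtrans_covariant_derivative[OF cd x _ has_derivative_ident has_derivative_at_withinI[OF connection_deriv_at[OF cd(1) xc]]]
      by (simp add: wi)
    have D: "((\<lambda>x. dtrans c d x v) has_derivative (\<lambda>w. ddtrans c d x w v)) (at x)" for v
      using dtrans_has_derivative[OF cd x _ has_derivative_ident has_derivative_const] linear_0[OF lin] wi by simp
    have 2: "((\<lambda>y. conn d (?f y) (dtrans c d y v) (dtrans c d y w)) has_derivative
      (\<lambda>u. dconn d (?f x) (?D u) (?D v) (?D w) + conn d (?f x) (ddtrans c d x u v) (?D w) + conn d (?f x) (?D v) (ddtrans c d x u w))) (at x)"
      by (rule connection_has_derivative[OF cd(2) fx transition_has_derivative[OF cd x] D D])
    have "((\<lambda>y. ddtrans c d y v w) has_derivative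
      (\<lambda>u. ?D (dconn c x u v w + conn c x u (conn c x v w)) - conn d (?f x) (?D u) (?D (conn c x v w))
     - (dconn d (?f x) (?D u) (?D v) (?D w) + conn d (?f x) (ddtrans c d x u v) (?D w) + conn d (?f x) (?D v) (ddtrans c d x u w)))) (at x)"
      by (rule has_derivative_transform_within_open[OF has_derivative_diff[OF 1 2] open_overlap[OF cd] x])
         (rule dd[symmetric])
    from frechet_derivative_at[OF this, symmetric] show ?thesis unfolding D3_def by (rule fun_cong)
  qed
  \<comment> \<open>The term with \<open>ddtrans c d x u v\<close> cancels by symmetry. Expanding
    the remaining second derivatives by \<open>dd\<close> gives mixed terms symmetric in u and v,
    which also cancel, and the quadratic connection terms of the curvature in the chart d.\<close>
  have "D3 u v - D3 v u = ?D (curv c x u v w) - curv d (?f x) (?D u) (?D v) (?D w)"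
    unfolding D3 chart_curvature_def using ddtrans_sym[OF cd x, of u v]
    by (simp add: dd[OF x, of _ w] linear_add[OF lin] linear_diff[OF lin] bounded_bilinear.diff_right[OF G] algebra_simps)
  then show ?thesis using D3_sym[of u v] by simp
qed

text \<open>The second derivative of y \<mapsto> g(w, z), with w and z constant in the chart, is
  symmetric. By metric compatibility its antisymmetrization is g(R(u,v)w, z) + g(w, R(u,v)z), the
  cross terms cancelling.\<close>

lemma curvature_skew:
  assumes c: "c \<in> A" and x: "x \<in> snd c ` fst c"
  shows "mform c x (curv c x u v w) z = - mform c x w (curv c x u v z)"
proof -
  let ?U = "snd c ` fst c"
  note h = bounded_bilinear_metric_form[of A g c x]
  have U: "open ?U" by (rule chart_img_open[OF c])
  have F1: "((\<lambda>x. mform c x w z) has_derivative (\<lambda>v. mform c y (conn c y v w) z + mform c y w (conn c y v z))) (at y)"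
    if "y \<in> ?U" for y
    using metric_form_has_derivative[where y="\<lambda>x. x" and s=y, OF c that has_derivative_ident has_derivative_const has_derivative_const] by simp
  have F2: "((\<lambda>x. mform c x (conn c x v w) z + mform c x w (conn c x v z)) has_derivative
     (\<lambda>u. (mform c y (dconn c y u v w + conn c y u (conn c y v w)) z + mform c y (conn c y v w) (0 + conn c y u z))
       + (mform c y (0 + conn c y u w) (conn c y v z) + mform c y w (dconn c y u v z + conn c y u (conn c y v z))))) (at y)"
    if "y \<in> ?U" for y v
    by (intro has_derivative_add metric_form_has_derivative[where y="\<lambda>x. x" and s=y, OF c that] has_derivative_ident has_derivative_const
        connection_deriv_at[OF c that])
  have thick: "thick ?U" by (rule thick_chart[OF c])
  have cont: "continuous_on ?U (\<lambda>y. (mform c y (dconn c y u v w + conn c y u (conn c y v w)) z + mform c y (conn c y v w) (0 + conn c y u z))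
       + (mform c y (0 + conn c y u w) (conn c y v z) + mform c y w (dconn c y u v z + conn c y u (conn c y v z))))" for u v
    by (rule Ck_on_imp_continuous_on[of 0])
       (intro Ck_on_add[OF thick] Ck_on_metric_form[OF c thick] Ck_on_connection[OF c thick]
          Ck_on_connection_deriv[OF c thick] Ck_on_const[OF thick] Ck_on_id[OF thick]; simp)
  have "(mform c x (dconn c x u v w + conn c x u (conn c x v w)) z + mform c x (conn c x v w) (0 + conn c x u z))
       + (mform c x (0 + conn c x u w) (conn c x v z) + mform c x w (dconn c x u v z + conn c x u (conn c x v z)))
    = (mform c x (dconn c x v u w + conn c x v (conn c x u w)) z + mform c x (conn c x u w) (0 + conn c x v z))
       + (mform c x (0 + conn c x v w) (conn c x u z) + mform c x w (dconn c x v u z + conn c x v (conn c x u z)))"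
    by (rule second_derivative_symmetric_real[OF U x F1 F2 cont])
  then show ?thesis
    by (simp add: chart_curvature_def bounded_bilinear.add_left[OF h] bounded_bilinear.add_right[OF h]
        bounded_bilinear.diff_left[OF h] bounded_bilinear.diff_right[OF h])
qed

text \<open>After cyclic summation the terms cancel in pairs by symmetry of the connection and of
  its derivative.\<close>

lemma curvature_bianchi:
  assumes c: "c \<in> A" and x: "x \<in> snd c ` fst c"
  shows "curv c x u v w + curv c x v w u + curv c x w u v = 0"
  unfolding chart_curvature_def
  using connection_sym[OF c x, of u v] connection_sym[OF c x, of v w] connection_sym[OF c x, of w u]
    connection_deriv_sym[OF c x, of w u v] connection_deriv_sym[OF c x, of u v w] connection_deriv_sym[OF c x, of v w u]
  by simp

lemma curvature_antisym: "curv c x u v w = - curv c x v u w"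
  by (simp add: chart_curvature_def)

text \<open>The classical combination of four cyclic identities, whose terms are matched by
  antisymmetry in the first and in the last pair of arguments.\<close>

lemma curvature_pair_sym:
  assumes c: "c \<in> A" and x: "x \<in> snd c ` fst c"
  shows "mform c x (curv c x u v w) z = mform c x (curv c x w z u) v"
proof -
  note h = bounded_bilinear_metric_form[of A g c x]
  define r where "r u v w z = mform c x (curv c x u v w) z" for u v w z
  have 1: "r u v w z = - r v u w z" for u v w z
    unfolding r_def by (subst curvature_antisym) (simp add: bounded_bilinear.minus_left[OF h])
  have 2: "r u v w z = - r u v z w" for u v w z
    unfolding r_def by (subst curvature_skew[OF c x]) (simp add: metric_form_sym[OF c x])
  have 3: "r u v w z + r v w u z + r w u v z = 0" for u v w z
    unfolding r_def bounded_bilinear.add_left[OF h, symmetric] curvature_bianchi[OF c x]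
    by (rule bounded_bilinear.zero_left[OF h])
  have "r u v w z = r w z u v"
    using 3[of u v w z] 3[of v w z u] 3[of w z u v] 3[of z u v w] 1[of u w z v] 1[of v z u w]
      2[of u v w z] 2[of v w u z] 2[of w u v z] 2[of w z u v] 2[of z v w u] 2[of z u v w]
    by linarith
  then show ?thesis by (simp add: r_def)
qed

text \<open>Pair symmetry followed by skewness in the last pair. This is the source of
  self-adjointness of \<open>K\<close> in the frame.\<close>

lemma jacobi_operator_sym:
  assumes c: "c \<in> A" and x: "x \<in> snd c ` fst c"
  shows "mform c x (curv c x u v v) z = mform c x u (curv c x z v v)"
proof -
  have "mform c x (curv c x u v v) z = mform c x (curv c x v z u) v" by (rule curvature_pair_sym[OF c x])
  also have "\<dots> = - mform c x u (curv c x v z v)" by (rule curvature_skew[OF c x])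
  also have "\<dots> = mform c x u (curv c x z v v)"
    by (subst curvature_antisym) (simp add: bounded_bilinear.minus_right[OF bounded_bilinear_metric_form])
  finally show ?thesis .
qed

lemma curvature_chart:
  assumes c: "c \<in> A" and p: "p \<in> fst c"
  shows "curvature A g p u v w c = curv c (snd c p) (u c) (v c) (w c)"
proof -
  let ?G = "christoffel A g c" and ?x = "snd c p"
  have "curvature A g p u v w c $ l = curv c ?x (u c) (v c) (w c) $ l" for l
  proof -
    have 1: "dconn c ?x (u c) (v c) (w c) $ l =
       (\<Sum>i\<in>UNIV. \<Sum>j\<in>UNIV. \<Sum>k\<in>UNIV. pderiv_at (\<lambda>y. ?G y l j k) i ?x * (u c $ i) * (v c $ j) * (w c $ k))"
      unfolding connection_deriv_def coeff_form_def
      by (subst sum.swap, simp add: sum_distrib_right, rule sum.cong[OF refl], subst sum.swap, simp)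
    have 2: "dconn c ?x (v c) (u c) (w c) $ l =
       (\<Sum>i\<in>UNIV. \<Sum>j\<in>UNIV. \<Sum>k\<in>UNIV. pderiv_at (\<lambda>y. ?G y l i k) j ?x * (u c $ i) * (v c $ j) * (w c $ k))"
      unfolding connection_deriv_def coeff_form_def
      by (simp add: sum_distrib_right, rule sum.cong[OF refl], subst sum.swap, simp add: mult_ac)
    have 3: "conn c ?x (u c) (conn c ?x (v c) (w c)) $ l =
       (\<Sum>i\<in>UNIV. \<Sum>j\<in>UNIV. \<Sum>k\<in>UNIV. \<Sum>m\<in>UNIV. ?G ?x l i m * ?G ?x m j k * (u c $ i) * (v c $ j) * (w c $ k))"
      unfolding connection_def coeff_form_def
      by (simp add: sum_distrib_left mult_ac, rule sum.cong[OF refl], rule sum_rotate3)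
    have 4: "conn c ?x (v c) (conn c ?x (u c) (w c)) $ l =
       (\<Sum>i\<in>UNIV. \<Sum>j\<in>UNIV. \<Sum>k\<in>UNIV. \<Sum>m\<in>UNIV. ?G ?x l j m * ?G ?x m i k * (u c $ i) * (v c $ j) * (w c $ k))"
      unfolding connection_def coeff_form_def
      by (subst sum.swap, simp add: sum_distrib_left mult_ac, rule sum.cong[OF refl], rule sum_rotate3)
    show ?thesis
      using c p by (simp only: curvature_def chart_curvature_def vector_add_component vector_minus_component 1 2 3 4 simp_thms if_True Let_def)
        (simp add: sum.distrib sum_subtractf sum_distrib_right left_diff_distrib distrib_right)
  qed
  then show ?thesis by (simp add: vec_eq_iff)
qed

lemma curvature_tangent:
  assumes u: "u \<in> tangent_space A p" and v: "v \<in> tangent_space A p" and w: "w \<in> tangent_space A p"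
  shows "curvature A g p u v w \<in> tangent_space A p"
proof -
  have "curvature A g p u v w d = dtrans c d (snd c p) (curvature A g p u v w c)"
    if cd: "c \<in> A" "d \<in> A" "p \<in> fst c" "p \<in> fst d" for c d
  proof -
    have x: "snd c p \<in> snd c ` (fst c \<inter> fst d)" using cd by blast
    have "a d = dtrans c d (snd c p) (a c)" if "a \<in> tangent_space A p" for a
      using that cd unfolding tangent_space_def by blast
    then show ?thesis
      using curvature_transform[OF cd(1,2) x, of "u c" "v c" "w c"] u v w
      by (simp add: curvature_chart cd transition_chart)
  qed
  moreover have "curvature A g p u v w c = 0" if "\<not> (c \<in> A \<and> p \<in> fst c)" for c
    unfolding curvature_def using that by (rule if_not_P)
  ultimately show ?thesis unfolding tangent_space_def by blast
qed

end

section \<open>Parallel frames\<close>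

lemma at_within_openin:
  assumes "openin (top_of_set T) S" "t \<in> S" shows "at t within S = at t within T"
proof -
  obtain V where V: "open V" "S = T \<inter> V" using assms(1) unfolding openin_open by blast
  show ?thesis by (rule at_within_nhd[of t V]) (use V assms(2) in auto)
qed

text \<open>For relatively open S the filters \<open>at t within S\<close> and
  \<open>at t within T\<close> agree at points of S, so derivatives computed in S are those in T. It
  assembles regularity along the curve from regularity in charts.\<close>

lemma Ck_on_local:
  assumes "\<And>t. t \<in> T \<Longrightarrow> \<exists>S. openin (top_of_set T) S \<and> t \<in> S \<and> Ck_on k S f"
  shows "Ck_on k T f"
  using assms
proof (induction k arbitrary: f)
  case 0
  show ?case unfolding Ck_on.simps continuous_on_eq_continuous_within
  proof
    fix t assume "t \<in> T"
    then obtain S where S: "openin (top_of_set T) S" "t \<in> S" "continuous_on S f" using 0[of t] by auto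
    then show "continuous (at t within T) f"
      using at_within_openin[OF S(1,2)] by (metis continuous_on_eq_continuous_within)
  qed
next
  case (Suc k)
  show ?case unfolding Ck_on.simps
  proof (intro conjI allI)
    show "f differentiable_on T" unfolding differentiable_on_def
    proof
      fix t assume "t \<in> T"
      then obtain S where S: "openin (top_of_set T) S" "t \<in> S" "f differentiable_on S" using Suc.prems[of t] by auto
      then show "f differentiable (at t within T)"
        using at_within_openin[OF S(1,2)] by (metis differentiable_on_def)
    qed
    fix v
    show "Ck_on k T (\<lambda>x. frechet_derivative f (at x within T) v)"
    proof (rule Suc.IH)
      fix t assume "t \<in> T"
      then obtain S where S: "openin (top_of_set T) S" "t \<in> S" "Ck_on (Suc k) S f" using Suc.prems[of t] by auto
      have "Ck_on k S (\<lambda>x. frechet_derivative f (at x within T) v)"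
        by (rule Ck_on_cong[OF Ck_on_frechet[OF S(3)]]) (simp add: at_within_openin[OF S(1)])
      then show "\<exists>S. openin (top_of_set T) S \<and> t \<in> S \<and> Ck_on k S (\<lambda>x. frechet_derivative f (at x within T) v)"
        using S by blast
    qed
  qed
qed

lemma matrix_vec: "linear f \<Longrightarrow> matrix f *v x = f (x :: real ^ 'n)"
  by (simp add: fun_cong[OF matrix_vector_mul(2)])

lemma invertible_matrixI:
  fixes F :: "real ^ 'n ^ 'n"
  assumes "\<And>z. F *v z = 0 \<Longrightarrow> z = 0" shows "invertible F"
  using assms matrix_left_invertible_ker[of F] invertible_left_inverse by blast

lemma invertible_matrix_zero:
  fixes F :: "real ^ 'n ^ 'n"
  assumes "invertible F" "F *v z = 0" shows "z = 0"
  using matrix_inv_cancel(4)[OF assms(1), of z] assms(2) by simp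

section \<open>Frames as families of matrices\<close>

context riemannian_manifold begin

text \<open>Encoded like tangent vectors: one matrix per chart, whose columns are the coordinates of
  the frame vectors in that chart. The frame need not be orthonormal.\<close>

definition "frame p (F :: ('a, 'n) chart \<Rightarrow> real ^ 'n ^ 'n) \<longleftrightarrow> (\<forall>c\<in>A. p \<in> fst c \<longrightarrow> invertible (F c)) \<and> (\<forall>z. (\<lambda>c. F c *v z) \<in> tangent_space A p)"

text \<open>The value 0 at all other charts matches the normalization in
  \<open>tangent_space\<close>.\<close>

definition "extend_frame c p (M :: real ^ 'n ^ 'n) = (\<lambda>d. if d \<in> A \<and> p \<in> fst d then matrix (dtrans c d (snd c p)) ** M else 0)"

lemma extend_frame_vec:
  assumes c: "c \<in> A" and p: "p \<in> fst c"
  shows "(\<lambda>d. extend_frame c p M d *v z) = coord_vec A c p (M *v z)"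
proof
  fix d
  show "extend_frame c p M d *v z = coord_vec A c p (M *v z) d"
  proof (cases "d \<in> A \<and> p \<in> fst d")
    case True
    have x: "snd c p \<in> snd c ` (fst c \<inter> fst d)" using True p by blast
    have "linear (dtrans c d (snd c p))" by (rule linear_dtrans[OF c _ x]) (use True in blast)
    then show ?thesis unfolding extend_frame_def coord_vec_def
      using True by (simp only: simp_thms if_True matrix_vector_mul_assoc[symmetric] matrix_vec)
  next
    case False
    then show ?thesis unfolding extend_frame_def coord_vec_def by (simp only: if_False matrix_vector_mult_0)
  qed
qed

lemma frame_extend:
  assumes c: "c \<in> A" and p: "p \<in> fst c" and M: "invertible M"
  shows "frame p (extend_frame c p M)"
  unfolding frame_def
proof (intro conjI ballI impI allI)
  fix z show "(\<lambda>d. extend_frame c p M d *v z) \<in> tangent_space A p"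
    unfolding extend_frame_vec[OF c p] by (rule coord_vec_tangent[OF c p])
next
  fix d assume d: "d \<in> A" "p \<in> fst d"
  show "invertible (extend_frame c p M d)"
  proof (rule invertible_matrixI)
    fix z assume "extend_frame c p M d *v z = 0"
    then have "coord_vec A c p (M *v z) d = 0" using fun_cong[OF extend_frame_vec[OF c p]] by metis
    then have 0: "dtrans c d (snd c p) (M *v z) = 0" using d by (simp only: coord_vec_def simp_thms if_True)
    have x: "snd d p \<in> snd d ` (fst d \<inter> fst c)" using d p by blast
    have "M *v z = dtrans d c (snd d p) (dtrans c d (snd c p) (M *v z))"
      by (rule dtrans_inverse[OF c d(1) p d(2), symmetric])
    also have "\<dots> = 0" unfolding 0 by (rule linear_0[OF linear_dtrans[OF d(1) c x]])
    finally show "z = 0" by (rule invertible_matrix_zero[OF M])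
  qed
qed

lemma tangent_transform:
  assumes "v \<in> tangent_space A p" "c \<in> A" "d \<in> A" "p \<in> fst c" "p \<in> fst d"
  shows "v d = dtrans c d (snd c p) (v c)"
  using assms unfolding tangent_space_def by blast

lemma tangent_other: "v \<in> tangent_space A p \<Longrightarrow> \<not> (c \<in> A \<and> p \<in> fst c) \<Longrightarrow> v c = 0"
  unfolding tangent_space_def by blast

lemma tangent_eqI:
  assumes "u \<in> tangent_space A p" "v \<in> tangent_space A p" "c \<in> A" "p \<in> fst c" "u c = v c"
  shows "u = v"
proof
  fix d show "u d = v d"
    using tangent_transform[OF assms(1) assms(3) _ assms(4), of d] tangent_transform[OF assms(2) assms(3) _ assms(4), of d]
      tangent_other[OF assms(1), of d] tangent_other[OF assms(2), of d] assms(5) by metis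
qed

text \<open>In contrast to \<open>Ck_on_connection\<close>, S is arbitrary here, as the continuity
  hypothesis of \<open>linear_ode_exists\<close> demands.\<close>

lemma continuous_on_connection:
  assumes c: "c \<in> A" and y: "y ` S \<subseteq> snd c ` fst c" and k: "continuous_on S y" "continuous_on S a" "continuous_on S b"
  shows "continuous_on S (\<lambda>s. conn c (y s) (a s) (b s))"
proof -
  have "continuous_on S (\<lambda>s. christoffel A g c (y s) k i j)" for k i j
    by (rule continuous_on_compose2[OF Ck_on_imp_continuous_on[OF Ck_on_christoffel[OF c, of 0]] k(1) y])
  then show ?thesis unfolding connection_def coeff_form_def by (intro continuous_intros k)
qed

end

section \<open>Curves crossing several charts and parallel transport\<close>

locale riemannian_curve = riemannian_manifold X A g
  for X :: "'a topology" and A :: "('a, 'n::finite) chart set" and g +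
  fixes \<gamma> :: "real \<Rightarrow> 'a" and l :: real
  assumes l_pos: "l > 0" and smooth: "smooth_curve X A \<gamma> l"
begin

abbreviation "pos c t \<equiv> snd c (\<gamma> t)"
definition "vel c t = velocity A \<gamma> l t c"
text \<open>For 0 \<le> a < b \<le> l this set of times is relatively open in [a,b], hence thick:
  derivatives within it are unique and equal those within [a,b].\<close>

definition "cdom a b c = {t \<in> {a..b}. \<gamma> t \<in> fst c}"

lemma \<gamma>_cover: assumes "t \<in> {0..l}" obtains c where "c \<in> A" "\<gamma> t \<in> fst c"
proof -
  have "\<gamma> t \<in> topspace X" using smooth assms unfolding smooth_curve_def continuous_map_def by auto
  then show ?thesis using that charts_cover by blast
qed

lemma openin_dom:
  assumes c: "c \<in> A" and ab: "0 \<le> a" "b \<le> l" shows "openin (top_of_set {a..b}) (cdom a b c)"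
proof -
  have "openin (top_of_set {0..l}) (cdom 0 l c)"
    using openin_continuous_map_preimage[OF _ chart_dom_open[OF c]] smooth
    unfolding smooth_curve_def cdom_def by (metis topspace_euclidean_subtopology)
  then obtain V where V: "open V" "cdom 0 l c = {0..l} \<inter> V" unfolding openin_open by blast
  have "cdom a b c = {a..b} \<inter> V"
  proof (rule set_eqI)
    fix t show "t \<in> cdom a b c \<longleftrightarrow> t \<in> {a..b} \<inter> V"
      using ab V(2)[unfolded set_eq_iff, rule_format, of t] by (auto simp: cdom_def)
  qed
  then show ?thesis using V(1) by (simp add: openin_open_Int)
qed

lemma thick_dom: "c \<in> A \<Longrightarrow> 0 \<le> a \<Longrightarrow> a < b \<Longrightarrow> b \<le> l \<Longrightarrow> thick (cdom a b c)"
  using openin_dom thick_openin_interval by blast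

lemma at_within_dom: "c \<in> A \<Longrightarrow> 0 \<le> a \<Longrightarrow> b \<le> l \<Longrightarrow> t \<in> cdom a b c \<Longrightarrow> at t within cdom a b c = at t within {a..b}"
  using openin_dom at_within_openin by blast

lemma Ck_on_pos:
  assumes c: "c \<in> A" shows "Ck_on k (cdom 0 l c) (pos c)"
  using smooth c unfolding smooth_curve_def smooth_on_def cdom_def o_def by blast

lemma vel_eq: "c \<in> A \<Longrightarrow> t \<in> cdom 0 l c \<Longrightarrow> vel c t = vector_derivative (pos c) (at t within {0..l})"
  unfolding vel_def velocity_def cdom_def by (simp add: o_def)

lemma pos_has_vector_derivative:
  assumes c: "c \<in> A" and t: "t \<in> cdom 0 l c"
  shows "(pos c has_vector_derivative vel c t) (at t within {0..l})"
  using Ck_on_vector_derivative(1)[OF thick_dom Ck_on_pos[OF c] t] l_pos c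
  by (simp add: vel_eq[OF c t] at_within_dom[OF c _ _ t])

lemma Ck_on_vel:
  assumes c: "c \<in> A" shows "Ck_on k (cdom 0 l c) (vel c)"
proof -
  have "thick (cdom 0 l c)" using thick_dom[OF c] l_pos by simp
  from Ck_on_vector_derivative(2)[OF this Ck_on_pos[OF c]]
  have "Ck_on k (cdom 0 l c) (\<lambda>t. vector_derivative (pos c) (at t within cdom 0 l c))" .
  then show ?thesis by (rule Ck_on_cong) (simp add: vel_eq[OF c] at_within_dom[OF c])
qed

lemma pos_image: "pos c ` cdom a b c \<subseteq> snd c ` fst c"
  unfolding cdom_def by auto

lemma dom_subset: "0 \<le> a \<Longrightarrow> b \<le> l \<Longrightarrow> cdom a b c \<subseteq> cdom 0 l c"
  unfolding cdom_def by auto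

lemma vel_transform:
  assumes cd: "c \<in> A" "d \<in> A" and t: "t \<in> {0..l}" "\<gamma> t \<in> fst c" "\<gamma> t \<in> fst d"
  shows "vel d t = dtrans c d (pos c t) (vel c t)"
proof -
  have tc: "t \<in> cdom 0 l c" and td: "t \<in> cdom 0 l d" using t by (auto simp: cdom_def)
  have thick: "thick (cdom 0 l c \<inter> cdom 0 l d)"
    by (rule thick_openin_interval[OF l_pos openin_Int[OF openin_dom[OF cd(1)] openin_dom[OF cd(2)]]]) auto
  have 1: "(pos c has_vector_derivative vel c t) (at t within cdom 0 l c \<inter> cdom 0 l d)"
    by (rule has_vector_derivative_within_subset[OF pos_has_vector_derivative[OF cd(1) tc]]) (auto simp: cdom_def)
  have 2: "(pos d has_vector_derivative vel d t) (at t within cdom 0 l c \<inter> cdom 0 l d)"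
    by (rule has_vector_derivative_within_subset[OF pos_has_vector_derivative[OF cd(2) td]]) (auto simp: cdom_def)
  have x: "pos c t \<in> snd c ` (fst c \<inter> fst d)" using t by blast
  have "((\<lambda>s. transition c d (pos c s)) has_derivative (\<lambda>h. dtrans c d (pos c t) (h *\<^sub>R vel c t))) (at t within cdom 0 l c \<inter> cdom 0 l d)"
    by (rule has_derivative_compose[OF 1[unfolded has_vector_derivative_def] has_derivative_at_withinI[OF transition_has_derivative[OF cd x]]])
  then have "((\<lambda>s. transition c d (pos c s)) has_vector_derivative dtrans c d (pos c t) (vel c t)) (at t within cdom 0 l c \<inter> cdom 0 l d)"
    unfolding has_vector_derivative_def using linear_cmul[OF linear_dtrans[OF cd x]] by simp
  then have 3: "(pos d has_vector_derivative dtrans c d (pos c t) (vel c t)) (at t within cdom 0 l c \<inter> cdom 0 l d)"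
    by (rule has_vector_derivative_transform[rotated 2]) (use tc td cd in \<open>auto simp: cdom_def transition_chart\<close>)
  show ?thesis
    using vector_derivative_thick[OF thick _ 2] vector_derivative_thick[OF thick _ 3] tc td by simp
qed

lemma velocity_tangent: assumes t: "t \<in> {0..l}" shows "velocity A \<gamma> l t \<in> tangent_space A (\<gamma> t)"
proof -
  have "velocity A \<gamma> l t d = dtrans c d (pos c t) (velocity A \<gamma> l t c)"
    if "c \<in> A" "d \<in> A" "\<gamma> t \<in> fst c" "\<gamma> t \<in> fst d" for c d
    using vel_transform[OF that(1,2) t that(3,4)] unfolding vel_def .
  moreover have "velocity A \<gamma> l t c = 0" if "\<not> (c \<in> A \<and> \<gamma> t \<in> fst c)" for c
    unfolding velocity_def using that by (rule if_not_P)
  ultimately show ?thesis unfolding tangent_space_def by blast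
qed

text \<open>Focal points refer to the curve on [0,b] with derivatives taken within [0,b]. Uniqueness
  on a nondegenerate interval identifies these with the derivatives within [0,l], also at the end
  point b.\<close>

lemma velocity_restrict:
  assumes b: "0 < b" "b \<le> l" and t: "t \<in> {0..b}" shows "velocity A \<gamma> b t = velocity A \<gamma> l t"
proof
  fix c
  show "velocity A \<gamma> b t c = velocity A \<gamma> l t c"
  proof (cases "c \<in> A \<and> \<gamma> t \<in> fst c")
    case True
    then have "t \<in> cdom 0 l c" using t b by (auto simp: cdom_def)
    then have "(pos c has_vector_derivative vel c t) (at t within {0..b})"
      by (intro has_vector_derivative_within_subset[OF pos_has_vector_derivative]) (use True b in auto)
    then have "vector_derivative (pos c) (at t within {0..b}) = vel c t"
      by (intro vector_derivative_thick[OF _ t] thick_openin_interval[of 0 b]) (use b in auto)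
    then show ?thesis using True unfolding velocity_def vel_def by (simp add: o_def)
  next
    case False
    then show ?thesis unfolding velocity_def by (simp only: if_False)
  qed
qed

text \<open>The transport equation is demanded in every chart that the curve meets, not in a chosen
  one, so joining two pieces raises no question of compatibility between charts.\<close>

definition "parallel_on a b (P :: real \<Rightarrow> ('a, 'n) chart \<Rightarrow> real ^ 'n ^ 'n) \<longleftrightarrow> (\<forall>t\<in>{a..b}. frame (\<gamma> t) (P t)) \<and>
  (\<forall>c\<in>A. \<forall>t\<in>cdom a b c. \<forall>z. ((\<lambda>s. P s c *v z) has_vector_derivative - conn c (pos c t) (vel c t) (P t c *v z)) (at t within {a..b}))"

lemma parallel_vector_exists:
  assumes c: "c \<in> A" and ab: "0 \<le> a" "a \<le> b" "b \<le> l" and sub: "{a..b} \<subseteq> cdom 0 l c"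
  shows "\<exists>y. y a = y0 \<and> (\<forall>t\<in>{a..b}. (y has_vector_derivative - conn c (pos c t) (vel c t) (y t)) (at t within {a..b}))"
proof -
  have cont: "continuous_on S (\<lambda>t. conn c (pos c t) (vel c t) (y t))" if "S \<subseteq> {a..b}" "continuous_on S y" for S y
    using that sub Ck_on_imp_continuous_on[OF Ck_on_pos[OF c, of 0]] Ck_on_imp_continuous_on[OF Ck_on_vel[OF c, of 0]]
    by (intro continuous_on_connection[OF c]) (auto intro: continuous_on_subset simp: cdom_def)
  \<comment> \<open>Compactness bounds the connection on each basis vector separately; the sum of
    these constants serves as the growth bound of the linear equation.\<close>
  have "\<exists>C. \<forall>t\<in>{a..b}. norm (conn c (pos c t) (vel c t) (axis j 1)) \<le> C" for j
    using compact_imp_bounded[OF compact_continuous_image[OF cont[OF order_refl continuous_on_const] compact_Icc]]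
    unfolding bounded_iff by blast
  then obtain C where C: "\<And>j t. t \<in> {a..b} \<Longrightarrow> norm (conn c (pos c t) (vel c t) (axis j 1)) \<le> C j" by metis
  show ?thesis
  proof (rule linear_ode_exists[OF ab(2), where M="\<Sum>j\<in>UNIV. C j"])
    fix t y assume t: "t \<in> {a..b}"
    note G = bounded_bilinear_connection[of A g c "pos c t"]
    show lin: "linear (\<lambda>y. - conn c (pos c t) (vel c t) y)"
      by (rule linearI) (simp_all add: bounded_bilinear.add_right[OF G] bounded_bilinear.scaleR_right[OF G])
    have "- conn c (pos c t) (vel c t) y = - conn c (pos c t) (vel c t) (\<Sum>j\<in>UNIV. y $ j *\<^sub>R axis j 1)"
      using basis_expansion[of y] by (simp add: scalar_mult_eq_scaleR)
    also have "\<dots> = (\<Sum>j\<in>UNIV. y $ j *\<^sub>R (- conn c (pos c t) (vel c t) (axis j 1)))"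
      by (simp only: linear_sum[OF lin] linear_cmul[OF lin])
    also have "norm \<dots> \<le> (\<Sum>j\<in>UNIV. norm y * C j)"
    proof (rule sum_norm_le)
      fix j
      have "norm (y $ j *\<^sub>R (- conn c (pos c t) (vel c t) (axis j 1))) = \<bar>y $ j\<bar> * norm (conn c (pos c t) (vel c t) (axis j 1))" by simp
      also have "\<dots> \<le> norm y * C j" by (intro mult_mono component_le_norm_cart C t) auto
      finally show "norm (y $ j *\<^sub>R (- conn c (pos c t) (vel c t) (axis j 1))) \<le> norm y * C j" .
    qed
    finally show "norm (- conn c (pos c t) (vel c t) y) \<le> (\<Sum>j\<in>UNIV. C j) * norm y"
      by (simp only: sum_distrib_right mult.commute[of "norm y"])
  next
    fix y :: "real \<Rightarrow> real ^ 'n" and S assume "S \<subseteq> {a..b}" "continuous_on S y"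
    then show "continuous_on S (\<lambda>t. - conn c (pos c t) (vel c t) (y t))" by (intro continuous_on_minus cont)
  qed
qed

text \<open>Metric compatibility leaves only terms containing y' + conn(vel, y) or its analogue for
  z, and these vanish.\<close>

lemma mform_parallel_const:
  assumes c: "c \<in> A" and ab: "0 \<le> a" "b \<le> l" and sub: "{a..b} \<subseteq> cdom 0 l c"
    and y: "\<And>t. t\<in>{a..b} \<Longrightarrow> (y has_vector_derivative - conn c (pos c t) (vel c t) (y t)) (at t within {a..b})"
    and z: "\<And>t. t\<in>{a..b} \<Longrightarrow> (z has_vector_derivative - conn c (pos c t) (vel c t) (z t)) (at t within {a..b})"
    and t: "t \<in> {a..b}"
  shows "mform c (pos c t) (y t) (z t) = mform c (pos c a) (y a) (z a)"
proof (rule has_vector_derivative_zero_imp_const[OF _ t, where f="\<lambda>t. mform c (pos c t) (y t) (z t)"])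
  fix t assume t: "t \<in> {a..b}"
  note G = bounded_bilinear_connection[of A g c "pos c t"]
  note h = bounded_bilinear_metric_form[of A g c "pos c t"]
  have x: "(pos c has_vector_derivative vel c t) (at t within {a..b})"
    by (rule has_vector_derivative_within_subset[OF pos_has_vector_derivative[OF c]]) (use sub t ab in auto)
  have xt: "pos c t \<in> snd c ` fst c" using sub t by (auto simp: cdom_def)
  show "((\<lambda>t. mform c (pos c t) (y t) (z t)) has_vector_derivative 0) (at t within {a..b})"
    unfolding has_vector_derivative_def
    by (rule has_derivative_eq_rhs[OF metric_form_has_derivative[OF c xt x[unfolded has_vector_derivative_def]
           y[OF t, unfolded has_vector_derivative_def] z[OF t, unfolded has_vector_derivative_def]]])
       (simp add: bounded_bilinear.scaleR_left[OF G] bounded_bilinear.zero_left[OF h] bounded_bilinear.zero_right[OF h])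
qed

text \<open>The columns are transported in the single chart c, collected in \<open>M t\<close>, and
  carried to the other charts by \<open>extend_frame\<close>. There the equation holds because
  covariant differentiation commutes with the change of chart.\<close>

lemma parallel_local:
  assumes c: "c \<in> A" and ab: "0 \<le> a" "a \<le> b" "b \<le> l" and sub: "{a..b} \<subseteq> cdom 0 l c"
    and F: "frame (\<gamma> a) F"
  shows "\<exists>P. P a = F \<and> parallel_on a b P"
proof -
  have "\<exists>y. y a = F c *v axis j 1 \<and> (\<forall>t\<in>{a..b}. (y has_vector_derivative - conn c (pos c t) (vel c t) (y t)) (at t within {a..b}))" for j
    by (rule parallel_vector_exists[OF c ab sub])
  then obtain y where y: "\<And>j. y j a = F c *v axis j 1"
    "\<And>j t. t\<in>{a..b} \<Longrightarrow> (y j has_vector_derivative - conn c (pos c t) (vel c t) (y j t)) (at t within {a..b})" by metis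
  define M :: "real \<Rightarrow> real ^ 'n ^ 'n" where "M t = (\<chi> i j. y j t $ i)" for t
  have Mz: "M t *v z = (\<Sum>j\<in>UNIV. z $ j *\<^sub>R y j t)" for t z
    by (simp add: M_def matrix_vector_mult_def vec_eq_iff mult.commute)
  have Ma: "M a = F c"
    by (simp add: M_def y(1) vec_eq_iff matrix_vector_mult_basis column_def)
  have M: "((\<lambda>t. M t *v z) has_vector_derivative - conn c (pos c t) (vel c t) (M t *v z)) (at t within {a..b})"
    if t: "t \<in> {a..b}" for t z
  proof -
    note G = bounded_bilinear_connection[of A g c "pos c t"]
    have "((\<lambda>t. \<Sum>j\<in>UNIV. z $ j *\<^sub>R y j t) has_vector_derivative (\<Sum>j\<in>UNIV. z $ j *\<^sub>R (- conn c (pos c t) (vel c t) (y j t)))) (at t within {a..b})"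
      by (intro has_vector_derivative_sum bounded_linear.has_vector_derivative[OF bounded_linear_scaleR_right] y t)
    moreover have "(\<Sum>j\<in>UNIV. z $ j *\<^sub>R (- conn c (pos c t) (vel c t) (y j t))) = - conn c (pos c t) (vel c t) (M t *v z)"
      by (simp add: Mz bounded_bilinear.sum_right[OF G] bounded_bilinear.scaleR_right[OF G] sum_negf)
    ultimately show ?thesis unfolding Mz by simp
  qed
  have chart: "\<gamma> t \<in> fst c" "pos c t \<in> snd c ` fst c" if "t \<in> {a..b}" for t using sub that by (auto simp: cdom_def)
  have a: "a \<in> {a..b}" using ab by simp
  \<comment> \<open>\<open>M t *v z\<close> has constant length, so a kernel vector at time t would
    already be one at time a, where F is a frame.\<close>
  have inv: "invertible (M t)" if t: "t \<in> {a..b}" for t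
  proof (rule invertible_matrixI, rule ccontr)
    fix z assume z: "M t *v z = 0" "z \<noteq> 0"
    have "F c *v z \<noteq> 0" using F c chart(1)[OF a] invertible_matrix_zero z(2) unfolding frame_def by blast
    then have "mform c (pos c a) (M a *v z) (M a *v z) > 0"
      unfolding Ma by (rule metric_form_pos[OF c chart(2)[OF a]])
    also have "mform c (pos c a) (M a *v z) (M a *v z) = mform c (pos c t) (M t *v z) (M t *v z)"
      by (rule mform_parallel_const[OF c ab(1,3) sub M M t, symmetric])
    also have "\<dots> = 0" unfolding z(1) by (rule bounded_bilinear.zero_left[OF bounded_bilinear_metric_form])
    finally show False by simp
  qed
  define P where "P t = extend_frame c (\<gamma> t) (M t)" for t
  have Pz: "(\<lambda>d. P t d *v z) = coord_vec A c (\<gamma> t) (M t *v z)" if "t \<in> {a..b}" for t z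
    unfolding P_def by (rule extend_frame_vec[OF c chart(1)[OF that]])
  show ?thesis
  proof (intro exI[of _ P] conjI)
    show "P a = F"
    proof
      fix d
      have "(\<lambda>d. F d *v z) = (\<lambda>d. P a d *v z)" for z
      proof (rule tangent_eqI[OF _ _ c chart(1)[OF a]])
        show "(\<lambda>d. F d *v z) \<in> tangent_space A (\<gamma> a)" using F unfolding frame_def by blast
        show "(\<lambda>d. P a d *v z) \<in> tangent_space A (\<gamma> a)" unfolding Pz[OF a] by (rule coord_vec_tangent[OF c chart(1)[OF a]])
        show "F c *v z = P a c *v z" unfolding fun_cong[OF Pz[OF a]] coord_vec_self[OF c chart(1)[OF a]] Ma ..
      qed
      then show "P a d = F d" unfolding matrix_eq by metis
    qed
    show "parallel_on a b P" unfolding parallel_on_def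
    proof (intro conjI ballI allI)
      fix t assume t: "t \<in> {a..b}"
      show "frame (\<gamma> t) (P t)" unfolding P_def by (rule frame_extend[OF c chart(1)[OF t] inv[OF t]])
    next
      fix d t z assume d: "d \<in> A" and t: "t \<in> cdom a b d"
      have tab: "t \<in> {a..b}" using t by (simp add: cdom_def)
      let ?S = "cdom a b d"
      have w: "at t within ?S = at t within {a..b}" by (rule at_within_dom[OF d ab(1,3) t])
      have x: "(pos c has_derivative (\<lambda>h. h *\<^sub>R vel c t)) (at t within ?S)"
        unfolding has_vector_derivative_def[symmetric] w
        by (rule has_vector_derivative_within_subset[OF pos_has_vector_derivative[OF c]]) (use sub tab ab in auto)
      have im: "pos c ` ?S \<subseteq> snd c ` (fst c \<inter> fst d)" using chart(1) by (auto simp: cdom_def)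
      have xt: "pos c t \<in> snd c ` (fst c \<inter> fst d)" using im t by blast
      have Pd: "P s d *v z = dtrans c d (pos c s) (M s *v z)" if "s \<in> ?S" for s
        using fun_cong[OF Pz[of s z], of d] that d by (simp add: cdom_def coord_vec_def)
      note G = bounded_bilinear_connection
      \<comment> \<open>In the first argument of the outer \<open>dtrans\<close> expression the
        derivative of M z and the connection term cancel; only the connection of the chart d
        survives.\<close>
      have "((\<lambda>s. dtrans c d (pos c s) (M s *v z)) has_derivative
         (\<lambda>h. dtrans c d (pos c t) (h *\<^sub>R (- conn c (pos c t) (vel c t) (M t *v z)) + conn c (pos c t) (h *\<^sub>R vel c t) (M t *v z))
        - conn d (transition c d (pos c t)) (dtrans c d (pos c t) (h *\<^sub>R vel c t)) (dtrans c d (pos c t) (M t *v z)))) (at t within ?S)"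
        by (rule dtrans_covariant_derivative[OF c d t im x]) (unfold has_vector_derivative_def[symmetric] w, rule M[OF tab])
      moreover have "vel d t = dtrans c d (pos c t) (vel c t)"
        by (rule vel_transform[OF c d]) (use t ab chart in \<open>auto simp: cdom_def\<close>)
      moreover have "transition c d (pos c t) = pos d t" by (rule transition_chart[OF c chart(1)[OF tab]])
      ultimately have "((\<lambda>s. dtrans c d (pos c s) (M s *v z)) has_vector_derivative - conn d (pos d t) (vel d t) (P t d *v z)) (at t within ?S)"
        unfolding has_vector_derivative_def Pd[OF t]
        by (elim has_derivative_eq_rhs)
           (simp add: fun_eq_iff bounded_bilinear.scaleR_left[OF G] linear_0[OF linear_dtrans[OF c d xt]] linear_cmul[OF linear_dtrans[OF c d xt]])
      then have "((\<lambda>s. P s d *v z) has_vector_derivative - conn d (pos d t) (vel d t) (P t d *v z)) (at t within ?S)"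
        by (rule has_vector_derivative_transform[OF t, rotated]) (simp add: Pd)
      then show "((\<lambda>s. P s d *v z) has_vector_derivative - conn d (pos d t) (vel d t) (P t d *v z)) (at t within {a..b})"
        unfolding w .
    qed
  qed
qed

lemma parallel_frame_exists:
  assumes F: "frame (\<gamma> 0) F" shows "\<exists>P. P 0 = F \<and> parallel_on 0 l P"
proof -
  define Q where "Q a b \<longleftrightarrow> (0 \<le> a \<longrightarrow> a \<le> b \<longrightarrow> b \<le> l \<longrightarrow> (\<forall>F. frame (\<gamma> a) F \<longrightarrow> (\<exists>P. P a = F \<and> parallel_on a b P)))" for a b
  have "Q 0 l" using less_imp_le[OF l_pos]
  proof (induct rule: Bolzano)
    case (trans p q r)
    show ?case unfolding Q_def
    proof (intro impI allI)
      fix F assume *: "0 \<le> p" "p \<le> r" "r \<le> l" "frame (\<gamma> p) F"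
      have Qp: "\<exists>P. P p = F \<and> parallel_on p q P" if "frame (\<gamma> p) F" for F
        using trans(1) * trans(3,4) that unfolding Q_def by (metis order_trans)
      have Qq: "\<exists>P. P q = F \<and> parallel_on q r P" if "frame (\<gamma> q) F" for F
        using trans(2) * trans(3,4) that unfolding Q_def by (metis order_trans)
      obtain P1 where P1: "P1 p = F" "parallel_on p q P1"
        using Qp[OF *(4)] by blast
      then have fq: "frame (\<gamma> q) (P1 q)" using trans unfolding parallel_on_def by simp
      obtain P2 where P2: "P2 q = P1 q" "parallel_on q r P2"
        using Qq[OF fq] by blast
      show "\<exists>P. P p = F \<and> parallel_on p r P"
      proof (intro exI[of _ "\<lambda>t. if t \<le> q then P1 t else P2 t"] conjI)
        show "(if p \<le> q then P1 p else P2 p) = F" using P1 trans by simp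
        show "parallel_on p r (\<lambda>t. if t \<le> q then P1 t else P2 t)" unfolding parallel_on_def
        proof (intro conjI ballI allI)
          fix t assume "t \<in> {p..r}"
          then show "frame (\<gamma> t) (if t \<le> q then P1 t else P2 t)"
            using P1(2) P2(2) unfolding parallel_on_def by auto
        next
          fix c t and z :: "real ^ 'n" assume c: "c \<in> A" and t: "t \<in> cdom p r c"
          have t': "t \<in> {p..r}" using t by (simp add: cdom_def)
          let ?d = "\<lambda>P t. - conn c (pos c t) (vel c t) (P t c *v z)"
          have 1: "((\<lambda>s. P1 s c *v z) has_vector_derivative ?d P1 t) (at t within {p..q})" if "t \<in> {p..q}"
            using P1(2) c t that unfolding parallel_on_def cdom_def by blast
          have 2: "((\<lambda>s. P2 s c *v z) has_vector_derivative ?d P2 t) (at t within {q..r})" if "t \<in> {q..r}"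
            using P2(2) c t that unfolding parallel_on_def cdom_def by blast
          have "((\<lambda>t. if t \<le> q then P1 t c *v z else P2 t c *v z) has_vector_derivative
              (if t \<le> q then ?d P1 t else ?d P2 t)) (at t within {p..r})"
            by (rule has_vector_derivative_join[OF trans(3,4) 1 2 _ _ t']) (simp_all add: P2(1))
          moreover have "(\<lambda>t. if t \<le> q then P1 t c *v z else P2 t c *v z) = (\<lambda>t. (if t \<le> q then P1 t else P2 t) c *v z)" by auto
          moreover have "(if t \<le> q then ?d P1 t else ?d P2 t) = - conn c (pos c t) (vel c t) ((if t \<le> q then P1 t else P2 t) c *v z)" by simp
          ultimately show "((\<lambda>s. (if s \<le> q then P1 s else P2 s) c *v z) has_vector_derivative
             - conn c (pos c t) (vel c t) ((if t \<le> q then P1 t else P2 t) c *v z)) (at t within {p..r})"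
            by (simp only:)
        qed
      qed
    qed
  next
    case (local x)
    then have "x \<in> {0..l}" by simp
    then obtain c where c: "c \<in> A" "\<gamma> x \<in> fst c" using \<gamma>_cover by blast
    have "x \<in> cdom 0 l c" using local c by (simp add: cdom_def)
    then obtain e where e: "e > 0" "ball x e \<inter> {0..l} \<subseteq> cdom 0 l c"
      using openin_dom[OF c(1), of 0 l] unfolding openin_contains_ball by blast
    have "Q a b" if ab: "a \<le> x" "x \<le> b" "b - a < e" for a b
      unfolding Q_def
    proof (intro impI allI)
      fix F assume *: "0 \<le> a" "a \<le> b" "b \<le> l" "frame (\<gamma> a) F"
      have "{a..b} \<subseteq> ball x e \<inter> {0..l}" using ab * by (auto simp: dist_real_def)
      then have "{a..b} \<subseteq> cdom 0 l c" using e(2) by blast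
      then show "\<exists>P. P a = F \<and> parallel_on a b P" by (rule parallel_local[OF c(1) *(1-3) _ *(4)])
    qed
    then show ?case using e(1) by blast
  qed
  then show ?thesis using F l_pos by (simp add: Q_def)
qed

end

section \<open>Fields in a parallel frame\<close>

lemma linear_on_tangent_comb:
  assumes "linear_on_tangent_space A p B" "u \<in> tangent_space A p" "v \<in> tangent_space A p"
  shows "B (\<lambda>c. a *\<^sub>R u c + b *\<^sub>R v c) = (\<lambda>c. a *\<^sub>R B u c + b *\<^sub>R B v c)"
  using assms unfolding linear_on_tangent_space_def by blast

locale parallel_frame = riemannian_curve X A g \<gamma> l
  for X :: "'a topology" and A :: "('a, 'n::finite) chart set" and g \<gamma> l +
  fixes P :: "real \<Rightarrow> ('a, 'n) chart \<Rightarrow> real ^ 'n ^ 'n"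
  assumes parallel: "parallel_on 0 l P"
begin

definition "lift t z = (\<lambda>c. P t c *v z)"
definition "coord t v = (THE z. lift t z = v)"

lemma frame: "t \<in> {0..l} \<Longrightarrow> frame (\<gamma> t) (P t)"
  using parallel unfolding parallel_on_def by blast

lemma lift_tangent: "t \<in> {0..l} \<Longrightarrow> lift t z \<in> tangent_space A (\<gamma> t)"
  using frame unfolding frame_def lift_def by blast

lemma P_inv: "c \<in> A \<Longrightarrow> t \<in> {0..l} \<Longrightarrow> \<gamma> t \<in> fst c \<Longrightarrow> invertible (P t c)"
  using frame unfolding frame_def by blast

lemma lift_eqI:
  assumes v: "v \<in> tangent_space A (\<gamma> t)" and c: "c \<in> A" "t \<in> {0..l}" "\<gamma> t \<in> fst c"
  shows "lift t z = v \<longleftrightarrow> z = matrix_inv (P t c) *v v c"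
proof
  assume "lift t z = v"
  then have "v c = P t c *v z" by (auto simp: lift_def)
  then show "z = matrix_inv (P t c) *v v c" using matrix_inv_cancel(4)[OF P_inv[OF c]] by simp
next
  assume "z = matrix_inv (P t c) *v v c"
  then have "lift t z c = v c" using matrix_inv_cancel(3)[OF P_inv[OF c]] by (simp add: lift_def)
  then show "lift t z = v" by (rule tangent_eqI[OF lift_tangent[OF c(2)] v c(1,3)])
qed

lemma coord_eq:
  assumes "v \<in> tangent_space A (\<gamma> t)" "c \<in> A" "t \<in> {0..l}" "\<gamma> t \<in> fst c"
  shows "coord t v = matrix_inv (P t c) *v v c"
  unfolding coord_def lift_eqI[OF assms] by simp

lemma lift_coord:
  assumes v: "v \<in> tangent_space A (\<gamma> t)" and t: "t \<in> {0..l}" shows "lift t (coord t v) = v"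
proof -
  obtain c where c: "c \<in> A" "\<gamma> t \<in> fst c" using \<gamma>_cover[OF t] by blast
  show ?thesis unfolding lift_eqI[OF v c(1) t c(2)] by (rule coord_eq[OF v c(1) t c(2)])
qed

lemma coord_lift:
  assumes t: "t \<in> {0..l}" shows "coord t (lift t z) = z"
proof -
  obtain c where c: "c \<in> A" "\<gamma> t \<in> fst c" using \<gamma>_cover[OF t] by blast
  show ?thesis unfolding coord_eq[OF lift_tangent[OF t] c(1) t c(2)] unfolding lift_def
    by (rule matrix_inv_cancel(4)[OF P_inv[OF c(1) t c(2)]])
qed

lemma lift_zero: "lift t 0 = (\<lambda>_. 0)"
  by (simp add: lift_def)

lemma lift_comb: "lift t (a *\<^sub>R y + b *\<^sub>R z) = (\<lambda>c. a *\<^sub>R lift t y c + b *\<^sub>R lift t z c)"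
  by (simp add: lift_def matrix_vector_right_distrib matrix_vector_mult_scaleR)

lemma linear_coord:
  assumes t: "t \<in> {0..l}" and f: "\<And>z. f z \<in> tangent_space A (\<gamma> t)"
    and lin: "\<And>a b y z. f (a *\<^sub>R y + b *\<^sub>R z) = (\<lambda>c. a *\<^sub>R f y c + b *\<^sub>R f z c)"
  shows "linear (\<lambda>z. coord t (f z))"
proof -
  obtain c where c: "c \<in> A" "\<gamma> t \<in> fst c" using \<gamma>_cover[OF t] by blast
  have e: "coord t (f z) = matrix_inv (P t c) *v f z c" for z by (rule coord_eq[OF f c(1) t c(2)])
  show ?thesis unfolding e
  proof (rule linearI)
    show "matrix_inv (P t c) *v f (y + z) c = matrix_inv (P t c) *v f y c + matrix_inv (P t c) *v f z c" for y z
      using fun_cong[OF lin[of 1 y 1 z], of c] by (simp add: matrix_vector_right_distrib)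
    show "matrix_inv (P t c) *v f (a *\<^sub>R y) c = a *\<^sub>R (matrix_inv (P t c) *v f y c)" for a y
      using fun_cong[OF lin[of a y 0 y], of c] by (simp add: matrix_vector_mult_scaleR)
  qed
qed

definition "frame_deriv c t = (\<chi> i j. (- conn c (pos c t) (vel c t) (P t c *v axis j 1)) $ i)"

lemma P_vec_deriv:
  assumes c: "c \<in> A" and t: "t \<in> cdom 0 l c"
  shows "((\<lambda>s. P s c *v z) has_vector_derivative - conn c (pos c t) (vel c t) (P t c *v z)) (at t within {0..l})"
  using parallel c t unfolding parallel_on_def by blast

lemma frame_deriv_vec: "frame_deriv c t *v z = - conn c (pos c t) (vel c t) (P t c *v z)"
proof -
  note G = bounded_bilinear_connection[of A g c "pos c t"]
  have lin: "linear (\<lambda>z. - conn c (pos c t) (vel c t) (P t c *v z))"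
    by (rule linearI) (simp_all add: matrix_vector_right_distrib matrix_vector_mult_scaleR
      bounded_bilinear.add_right[OF G] bounded_bilinear.scaleR_right[OF G])
  have "frame_deriv c t = matrix (\<lambda>z. - conn c (pos c t) (vel c t) (P t c *v z))"
    by (simp add: frame_deriv_def matrix_def)
  then show ?thesis using matrix_vec[OF lin] by simp
qed

lemma P_deriv:
  assumes c: "c \<in> A" and t: "t \<in> cdom 0 l c"
  shows "((\<lambda>s. P s c) has_vector_derivative frame_deriv c t) (at t within {0..l})"
  unfolding has_vector_derivative_def
proof (intro has_derivative_vecI)
  fix i j
  have e: "P s c $ i $ j = (P s c *v axis j 1) $ i" for s
    by (simp add: matrix_vector_mult_basis column_def)
  have "((\<lambda>s. (P s c *v axis j 1) $ i) has_derivative (\<lambda>h. (h *\<^sub>R (- conn c (pos c t) (vel c t) (P t c *v axis j 1))) $ i)) (at t within {0..l})"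
    by (rule bounded_linear.has_derivative[OF bounded_linear_vec_nth P_vec_deriv[OF assms, unfolded has_vector_derivative_def]])
  then show "((\<lambda>s. P s c $ i $ j) has_derivative (\<lambda>h. (h *\<^sub>R frame_deriv c t) $ i $ j)) (at t within {0..l})"
    unfolding e by (simp add: frame_deriv_def)
qed

text \<open>Bootstrapping: the transport equation expresses the derivative of P through P and smooth
  coefficients, so each use gains one order.\<close>

lemma Ck_on_P:
  assumes c: "c \<in> A" shows "Ck_on k (cdom 0 l c) (\<lambda>t. P t c)"
proof -
  have thick: "thick (cdom 0 l c)" using thick_dom[OF c] l_pos by simp
  have der: "((\<lambda>s. P s c *v z) has_vector_derivative - conn c (pos c t) (vel c t) (P t c *v z)) (at t within cdom 0 l c)"
    if "t \<in> cdom 0 l c" for t z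
    using P_vec_deriv[OF c that] at_within_dom[OF c _ _ that] by simp
  have "Ck_on k (cdom 0 l c) (\<lambda>t. P t c *v z)" for z
  proof (induction k)
    case 0
    show ?case using der has_vector_derivative_continuous unfolding Ck_on.simps continuous_on_eq_continuous_within by blast
  next
    case (Suc k)
    show ?case
      by (intro Ck_on_vector_derivativeI[OF thick der] Ck_on_minus thick Ck_on_connection[OF c] pos_image
            Ck_on_pos[OF c] Ck_on_vel[OF c] Suc.IH)
  qed
  then have "Ck_on k (cdom 0 l c) (\<lambda>t. (P t c *v axis j 1) $ i)" for i j by (intro Ck_on_nth thick)
  then show ?thesis
    by (intro Ck_on_vec thick) (simp add: matrix_vector_mult_basis column_def)
qed

lemma Ck_on_P_inv:
  assumes c: "c \<in> A" shows "Ck_on k (cdom 0 l c) (\<lambda>t. matrix_inv (P t c))"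
  using thick_dom[OF c] l_pos P_inv[OF c] by (intro Ck_on_matrix_inv Ck_on_P c) (auto simp: cdom_def)

lemma cov_deriv_eq:
  "c \<in> A \<Longrightarrow> \<gamma> t \<in> fst c \<Longrightarrow> cov_deriv A g \<gamma> b Z t c =
    vector_derivative (\<lambda>s. Z s c) (at t within {0..b}) + conn c (pos c t) (velocity A \<gamma> b t c) (Z t c)"
  by (simp add: cov_deriv_def connection_def coeff_form_def)

text \<open>Since P is parallel, its derivative cancels the Christoffel term of the covariant
  derivative. Differentiability of z is needed only at the time t, which suits fields with
  corners.\<close>

lemma cov_deriv_lift:
  assumes b: "0 < b" "b \<le> l" and t: "t \<in> {0..b}" and Z: "\<And>s. s \<in> {0..b} \<Longrightarrow> Z s = lift s (z s)"
    and z: "(z has_vector_derivative z') (at t within {0..b})"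
  shows "cov_deriv A g \<gamma> b Z t = lift t z'"
proof
  fix c
  have tl: "t \<in> {0..l}" using t b by auto
  show "cov_deriv A g \<gamma> b Z t c = lift t z' c"
  proof (cases "c \<in> A \<and> \<gamma> t \<in> fst c")
    case True
    then have c: "c \<in> A" "\<gamma> t \<in> fst c" "t \<in> cdom 0 l c" using tl by (auto simp: cdom_def)
    have "((\<lambda>s. P s c) has_vector_derivative frame_deriv c t) (at t within {0..b})"
      by (rule has_vector_derivative_within_subset[OF P_deriv[OF c(1,3)]]) (use b in auto)
    then have "((\<lambda>s. P s c *v z s) has_vector_derivative P t c *v z' + frame_deriv c t *v z t) (at t within {0..b})"
      using z by (rule has_vector_derivative_matrix_vector)
    then have "((\<lambda>s. Z s c) has_vector_derivative P t c *v z' + frame_deriv c t *v z t) (at t within {0..b})"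
      by (rule has_vector_derivative_transform[OF t, rotated]) (simp add: Z lift_def)
    then have "vector_derivative (\<lambda>s. Z s c) (at t within {0..b}) = P t c *v z' + frame_deriv c t *v z t"
      by (intro vector_derivative_thick[OF _ t] thick_openin_interval[of 0 b]) (use b in auto)
    then show ?thesis
      using velocity_restrict[OF b t] Z[OF t] by (simp add: cov_deriv_eq[OF c(1,2)] frame_deriv_vec lift_def vel_def)
  next
    case False
    then have "cov_deriv A g \<gamma> b Z t c = 0" unfolding cov_deriv_def by (rule if_not_P)
    then show ?thesis using tangent_other[OF lift_tangent[OF tl] False] by simp
  qed
qed

text \<open>In a chart the coordinates are the inverse of P applied to the chart components of Z, a
  product of smooth maps; \<open>Ck_on_local\<close> patches the charts.\<close>

lemma coord_Ck_on:
  assumes ab: "0 \<le> a" "a < b" "b \<le> l" and Z: "\<And>t. t \<in> {a..b} \<Longrightarrow> Z t \<in> tangent_space A (\<gamma> t)"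
    and smooth: "field_smooth_on A \<gamma> Z {a..b}"
  shows "Ck_on k {a..b} (\<lambda>t. coord t (Z t))"
proof (rule Ck_on_local)
  fix t assume t: "t \<in> {a..b}"
  then have "t \<in> {0..l}" using ab by auto
  then obtain c where c: "c \<in> A" "\<gamma> t \<in> fst c" using \<gamma>_cover by blast
  have thick: "thick (cdom a b c)" by (rule thick_dom[OF c(1) ab])
  have Pi: "Ck_on k (cdom a b c) (\<lambda>t. matrix_inv (P t c))"
    by (rule Ck_on_subset[OF Ck_on_P_inv[OF c(1)] dom_subset thick]) (use ab in auto)
  have Zc: "Ck_on k (cdom a b c) (\<lambda>t. Z t c)"
    using smooth c(1) unfolding field_smooth_on_def smooth_on_def cdom_def by blast
  have "Ck_on k (cdom a b c) (\<lambda>t. coord t (Z t))"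
    by (rule Ck_on_cong[OF Ck_on_bilinear[OF bounded_bilinear_matrix_vector thick Pi Zc]])
       (rule coord_eq[symmetric], use Z c ab in \<open>auto simp: cdom_def\<close>)
  then show "\<exists>S. openin (top_of_set {a..b}) S \<and> t \<in> S \<and> Ck_on k S (\<lambda>t. coord t (Z t))"
    using openin_dom[OF c(1) ab(1,3)] t c(2) by (intro exI[of _ "cdom a b c"]) (auto simp: cdom_def)
qed

lemma coord_deriv:
  assumes ab: "0 \<le> a" "a < b" "b \<le> l" and Z: "\<And>t. t \<in> {a..b} \<Longrightarrow> Z t \<in> tangent_space A (\<gamma> t)"
    and smooth: "field_smooth_on A \<gamma> Z {a..b}"
  obtains z' z'' where "\<And>t. t \<in> {a..b} \<Longrightarrow> ((\<lambda>t. coord t (Z t)) has_vector_derivative z' t) (at t within {a..b})"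
    "continuous_on {a..b} z'" "\<And>t. t \<in> {a..b} \<Longrightarrow> (z' has_vector_derivative z'' t) (at t within {a..b})"
proof -
  have thick: "thick {a..b}" using thick_openin_interval[OF ab(2), of "{a..b}"] by simp
  note C = coord_Ck_on[OF ab Z smooth, of "Suc (Suc 0)"]
  note 1 = Ck_on_vector_derivative[OF thick C]
  note 2 = Ck_on_vector_derivative[OF thick 1(2)]
  show ?thesis by (rule that[OF 1(1) Ck_on_imp_continuous_on[OF 1(2)] 2(1)])
qed

definition "T t = velocity A \<gamma> l t"
text \<open>The Jacobi operator v \<mapsto> R(v, T) T in the frame.\<close>

definition "K t = matrix (\<lambda>z. coord t (curvature A g (\<gamma> t) (lift t z) (T t) (T t)))"

lemma T_tangent: "t \<in> {0..l} \<Longrightarrow> T t \<in> tangent_space A (\<gamma> t)"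
  unfolding T_def by (rule velocity_tangent)

lemma T_vel: "T t c = vel c t"
  by (simp add: T_def vel_def)

lemma bounded_linear_curvature: "bounded_linear (\<lambda>u. curv c x u v w)"
  unfolding linear_conv_bounded_linear[symmetric]
proof -
  note G = bounded_bilinear_connection and D = bounded_bilinear_connection_deriv
  show "linear (\<lambda>u. curv c x u v w)"
    by (rule linearI)
       (simp_all add: chart_curvature_def linear_add[OF linear_connection_deriv] linear_cmul[OF linear_connection_deriv]
         bounded_bilinear.add_left[OF G] bounded_bilinear.add_left[OF D] bounded_bilinear.scaleR_left[OF G] bounded_bilinear.scaleR_left[OF D]
         bounded_bilinear.add_right[OF G] bounded_bilinear.scaleR_right[OF G] algebra_simps)
qed

lemma jacobi_operator_tangent:
  "t \<in> {0..l} \<Longrightarrow> curvature A g (\<gamma> t) (lift t z) (T t) (T t) \<in> tangent_space A (\<gamma> t)"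
  by (intro curvature_tangent lift_tangent T_tangent)

lemma K_coord:
  assumes t: "t \<in> {0..l}"
  shows "K t *v z = coord t (curvature A g (\<gamma> t) (lift t z) (T t) (T t))"
  unfolding K_def
proof (rule matrix_vec, rule linear_coord[OF t jacobi_operator_tangent[OF t]])
  fix a b y z
  show "curvature A g (\<gamma> t) (lift t (a *\<^sub>R y + b *\<^sub>R z)) (T t) (T t) =
    (\<lambda>c. a *\<^sub>R curvature A g (\<gamma> t) (lift t y) (T t) (T t) c + b *\<^sub>R curvature A g (\<gamma> t) (lift t z) (T t) (T t) c)"
  proof
    fix c
    show "curvature A g (\<gamma> t) (lift t (a *\<^sub>R y + b *\<^sub>R z)) (T t) (T t) c =
      a *\<^sub>R curvature A g (\<gamma> t) (lift t y) (T t) (T t) c + b *\<^sub>R curvature A g (\<gamma> t) (lift t z) (T t) (T t) c"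
    proof (cases "c \<in> A \<and> \<gamma> t \<in> fst c")
      case True
      interpret bounded_linear "\<lambda>u. curv c (pos c t) u (T t c) (T t c)" by (rule bounded_linear_curvature)
      show ?thesis using True by (simp add: curvature_chart lift_comb add scaleR)
    next
      case False
      then have "curvature A g (\<gamma> t) u v w c = 0" for u v w unfolding curvature_def by (rule if_not_P)
      then show ?thesis by simp
    qed
  qed
qed

lemma lift_K: "t \<in> {0..l} \<Longrightarrow> lift t (K t *v z) = curvature A g (\<gamma> t) (lift t z) (T t) (T t)"
  by (simp add: K_coord lift_coord jacobi_operator_tangent)

lemma K_chart:
  assumes t: "t \<in> {0..l}" and c: "c \<in> A" "\<gamma> t \<in> fst c"
  shows "P t c *v (K t *v z) = curv c (pos c t) (P t c *v z) (vel c t) (vel c t)"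
  using fun_cong[OF lift_K[OF t, of z], of c] by (simp add: lift_def curvature_chart[OF c] T_vel)

lemma K_continuous: "continuous_on {0..l} K"
proof (rule Ck_on_imp_continuous_on[of 0], rule Ck_on_local)
  fix t assume t: "t \<in> {0..l}"
  then obtain c where c: "c \<in> A" "\<gamma> t \<in> fst c" using \<gamma>_cover by blast
  have thick: "thick (cdom 0 l c)" using thick_dom[OF c(1)] l_pos by simp
  have "Ck_on 0 (cdom 0 l c) (\<lambda>t. matrix_inv (P t c) *v curv c (pos c t) (P t c *v axis j 1) (vel c t) (vel c t))" for j
    by (intro Ck_on_bilinear[OF bounded_bilinear_matrix_vector] thick Ck_on_P_inv[OF c(1)] Ck_on_P[OF c(1)]
          Ck_on_curvature[OF c(1)] pos_image Ck_on_pos[OF c(1)] Ck_on_vel[OF c(1)] Ck_on_const)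
  moreover have "matrix_inv (P t c) *v curv c (pos c t) (P t c *v axis j 1) (vel c t) (vel c t) = K t *v axis j 1"
    if "t \<in> cdom 0 l c" for t j
    using that K_chart[of t c "axis j 1"] c P_inv by (simp add: cdom_def matrix_inv_cancel K_chart[symmetric])
  ultimately have "Ck_on 0 (cdom 0 l c) (\<lambda>t. K t *v axis j 1)" for j by (rule Ck_on_cong)
  then have "Ck_on 0 (cdom 0 l c) (\<lambda>t. (K t *v axis j 1) $ i)" for i j by (intro Ck_on_nth thick)
  then have "Ck_on 0 (cdom 0 l c) K"
    by (intro Ck_on_vec thick) (simp add: matrix_vector_mult_basis column_def)
  then show "\<exists>S. openin (top_of_set {0..l}) S \<and> t \<in> S \<and> Ck_on 0 S K"
    using openin_dom[OF c(1), of 0 l] t c(2) by (intro exI[of _ "cdom 0 l c"]) (auto simp: cdom_def)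
qed

text \<open>The frame is not assumed orthonormal; \<open>q\<close> is its Gram form, which is constant along the curve.\<close>

definition "q y z = g (\<gamma> 0) (lift 0 y) (lift 0 z)"

lemma lift_metric_chart:
  assumes t: "t \<in> {0..l}" and c: "c \<in> A" "\<gamma> t \<in> fst c"
  shows "g (\<gamma> t) (lift t y) (lift t z) = mform c (pos c t) (P t c *v y) (P t c *v z)"
  using metric_form_eq[OF c lift_tangent[OF t] lift_tangent[OF t]] by (simp add: lift_def)

text \<open>Parallel vectors have constant inner products by metric compatibility; the derivative is
  computed in a chart around each time.\<close>

lemma q_eq:
  assumes t: "t \<in> {0..l}" shows "g (\<gamma> t) (lift t y) (lift t z) = q y z"
  unfolding q_def
proof (rule has_vector_derivative_zero_imp_const[OF _ t, where f="\<lambda>t. g (\<gamma> t) (lift t y) (lift t z)"])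
  fix t assume t: "t \<in> {0..l}"
  then obtain c where c: "c \<in> A" "\<gamma> t \<in> fst c" using \<gamma>_cover by blast
  have tc: "t \<in> cdom 0 l c" using t c by (simp add: cdom_def)
  have w: "at t within cdom 0 l c = at t within {0..l}" by (rule at_within_dom[OF c(1) _ _ tc]) auto
  note G = bounded_bilinear_connection[of A g c "pos c t"]
  note h = bounded_bilinear_metric_form[of A g c "pos c t"]
  have xt: "pos c t \<in> snd c ` fst c" using c by blast
  have "((\<lambda>t. mform c (pos c t) (P t c *v y) (P t c *v z)) has_vector_derivative 0) (at t within cdom 0 l c)"
    unfolding has_vector_derivative_def w
    by (rule has_derivative_eq_rhs[OF metric_form_has_derivative[OF c(1) xt
          pos_has_vector_derivative[OF c(1) tc, unfolded has_vector_derivative_def]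
          P_vec_deriv[OF c(1) tc, unfolded has_vector_derivative_def] P_vec_deriv[OF c(1) tc, unfolded has_vector_derivative_def]]])
       (simp add: bounded_bilinear.scaleR_left[OF G] bounded_bilinear.zero_left[OF h] bounded_bilinear.zero_right[OF h])
  then have "((\<lambda>t. g (\<gamma> t) (lift t y) (lift t z)) has_vector_derivative 0) (at t within cdom 0 l c)"
    by (rule has_vector_derivative_transform[OF tc, rotated]) (rule lift_metric_chart, auto simp: cdom_def c)
  then show "((\<lambda>t. g (\<gamma> t) (lift t y) (lift t z)) has_vector_derivative 0) (at t within {0..l})" unfolding w .
qed

lemma bounded_bilinear_q: "bounded_bilinear q"
proof -
  have 0: "0 \<in> {0..l}" using l_pos by simp
  obtain c where c: "c \<in> A" "\<gamma> 0 \<in> fst c" using \<gamma>_cover[OF 0] by blast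
  have "bounded_bilinear (\<lambda>y z. mform c (pos c 0) (P 0 c *v y) (P 0 c *v z))"
    by (rule bounded_bilinear.comp[OF bounded_bilinear_metric_form]) auto
  then show ?thesis unfolding q_def lift_metric_chart[OF 0 c] .
qed

lemma q_sym: "q y z = q z y"
proof -
  have 0: "0 \<in> {0..l}" using l_pos by simp
  obtain c where c: "c \<in> A" "\<gamma> 0 \<in> fst c" using \<gamma>_cover[OF 0] by blast
  show ?thesis unfolding q_def lift_metric_chart[OF 0 c] by (rule metric_form_sym) (use c in auto)
qed

lemma q_pos: assumes "z \<noteq> 0" shows "q z z > 0"
proof -
  have 0: "0 \<in> {0..l}" using l_pos by simp
  obtain c where c: "c \<in> A" "\<gamma> 0 \<in> fst c" using \<gamma>_cover[OF 0] by blast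
  have "P 0 c *v z \<noteq> 0" using invertible_matrix_zero[OF P_inv[OF c(1) 0 c(2)]] assms by blast
  then show ?thesis unfolding q_def lift_metric_chart[OF 0 c] by (intro metric_form_pos) (use c in auto)
qed

lemma K_sym: assumes t: "t \<in> {0..l}" shows "q (K t *v y) z = q y (K t *v z)"
proof -
  obtain c where c: "c \<in> A" "\<gamma> t \<in> fst c" using \<gamma>_cover[OF t] by blast
  show ?thesis unfolding q_eq[OF t, symmetric] lift_metric_chart[OF t c] K_chart[OF t c]
    by (rule jacobi_operator_sym) (use c in auto)
qed

text \<open>R(T, Z) T = - R(Z, T) T is the sign that turns the index integrand into q(w', w') - q(K
  w, w).\<close>

lemma q_curvature:
  assumes t: "t \<in> {0..l}"
  shows "g (\<gamma> t) (curvature A g (\<gamma> t) (T t) (lift t z) (T t)) (lift t z) = - q (K t *v z) z"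
proof -
  obtain c where c: "c \<in> A" "\<gamma> t \<in> fst c" using \<gamma>_cover[OF t] by blast
  have "g (\<gamma> t) (curvature A g (\<gamma> t) (T t) (lift t z) (T t)) (lift t z) =
     mform c (pos c t) (curv c (pos c t) (vel c t) (P t c *v z) (vel c t)) (P t c *v z)"
    using metric_form_eq[OF c curvature_tangent[OF T_tangent[OF t] lift_tangent[OF t] T_tangent[OF t]] lift_tangent[OF t]]
    by (simp add: curvature_chart[OF c] T_vel lift_def)
  also have "\<dots> = - mform c (pos c t) (curv c (pos c t) (P t c *v z) (vel c t) (vel c t)) (P t c *v z)"
    by (subst curvature_antisym) (rule bounded_bilinear.minus_left[OF bounded_bilinear_metric_form])
  also have "\<dots> = - q (K t *v z) z"
    unfolding q_eq[OF t, symmetric] lift_metric_chart[OF t c] K_chart[OF t c] ..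
  finally show ?thesis .
qed

text \<open>The equation itself transfers by applying \<open>cov_deriv_lift\<close> twice. The work
  lies in smoothness in every chart, which continuity of \<open>K\<close> in the frame does not
  provide.\<close>

lemma jacobi_field_lift:
  assumes b: "0 < b" "b \<le> l" and J: "\<And>s. s \<in> {0..b} \<Longrightarrow> J s = lift s (f s)"
    and f: "\<And>t. t \<in> {0..b} \<Longrightarrow> (f has_vector_derivative f' t) (at t within {0..b})"
    and f': "\<And>t. t \<in> {0..b} \<Longrightarrow> (f' has_vector_derivative - (K t *v f t)) (at t within {0..b})"
  shows "jacobi_field A g \<gamma> b J"
  unfolding jacobi_field_def
proof (intro conjI ballI allI)
  have sub: "{0..b} \<subseteq> {0..l}" using b by auto
  show "field_along A \<gamma> b J" unfolding field_along_def using J lift_tangent sub by (metis subsetD)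
  show "field_smooth_on A \<gamma> J {0..b}" unfolding field_smooth_on_def
  proof
    fix c assume c: "c \<in> A"
    let ?S = "cdom 0 b c"
    have thick: "thick ?S" by (rule thick_dom[OF c _ b]) simp
    have w: "at t within ?S = at t within {0..b}" if "t \<in> ?S" for t by (rule at_within_dom[OF c _ b(2) that]) simp
    have pos: "Ck_on k ?S (pos c)" and vel: "Ck_on k ?S (vel c)" for k
      by (rule Ck_on_subset[OF Ck_on_pos[OF c] dom_subset thick], use b in auto,
          rule Ck_on_subset[OF Ck_on_vel[OF c] dom_subset thick], use b in auto)
    have der: "((\<lambda>s. P s c *v z s) has_vector_derivative P t c *v z' - conn c (pos c t) (vel c t) (P t c *v z t)) (at t within ?S)"
      if t: "t \<in> ?S" and z: "(z has_vector_derivative z') (at t within {0..b})" for z z' t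
    proof -
      have tl: "t \<in> cdom 0 l c" using t b by (auto simp: cdom_def)
      have "((\<lambda>s. P s c) has_vector_derivative frame_deriv c t) (at t within {0..b})"
        by (rule has_vector_derivative_within_subset[OF P_deriv[OF c tl]]) (use b in auto)
      from has_vector_derivative_matrix_vector[OF this z] show ?thesis by (simp add: w[OF t] frame_deriv_vec)
    qed
    have J': "((\<lambda>s. P s c *v f s) has_vector_derivative P t c *v f' t - conn c (pos c t) (vel c t) (P t c *v f t)) (at t within ?S)"
      if "t \<in> ?S" for t by (rule der[OF that f]) (use that in \<open>auto simp: cdom_def\<close>)
    have H': "((\<lambda>s. P s c *v f' s) has_vector_derivative - curv c (pos c t) (P t c *v f t) (vel c t) (vel c t)
        - conn c (pos c t) (vel c t) (P t c *v f' t)) (at t within ?S)" if t: "t \<in> ?S" for t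
    proof -
      have tl: "t \<in> {0..l}" "\<gamma> t \<in> fst c" using t b by (auto simp: cdom_def)
      have "P t c *v - (K t *v f t) = - curv c (pos c t) (P t c *v f t) (vel c t) (vel c t)"
        using K_chart[OF tl(1) c tl(2)] bounded_bilinear.minus_right[OF bounded_bilinear_matrix_vector] by metis
      moreover have "((\<lambda>s. P s c *v f' s) has_vector_derivative P t c *v - (K t *v f t)
        - conn c (pos c t) (vel c t) (P t c *v f' t)) (at t within ?S)"
        by (rule der[OF t f']) (use t in \<open>auto simp: cdom_def\<close>)
      ultimately show ?thesis by (simp only:)
    qed
    \<comment> \<open>In the chart, P f and P f' satisfy the first-order system \<open>J'\<close>,
      \<open>H'\<close>, whose coefficients are smooth, so both components gain orders
      simultaneously.\<close>
    have "Ck_on k ?S (\<lambda>s. P s c *v f s) \<and> Ck_on k ?S (\<lambda>s. P s c *v f' s)" for k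
    proof (induction k)
      case 0
      show ?case using J' H' has_vector_derivative_continuous unfolding Ck_on.simps continuous_on_eq_continuous_within by blast
    next
      case (Suc k)
      then show ?case
        by (intro conjI Ck_on_vector_derivativeI[OF thick J'] Ck_on_vector_derivativeI[OF thick H']
           Ck_on_diff Ck_on_minus Ck_on_connection[OF c] Ck_on_curvature[OF c] pos_image thick pos vel) auto
    qed
    then have "Ck_on k ?S (\<lambda>s. P s c *v f s)" for k by blast
    then have "Ck_on k ?S (\<lambda>s. J s c)" for k by (rule Ck_on_cong) (simp add: J lift_def cdom_def)
    then show "smooth_on {t \<in> {0..b}. \<gamma> t \<in> fst c} (\<lambda>t. J t c)" unfolding smooth_on_def cdom_def by blast
  qed
  fix t c assume t: "t \<in> {0..b}"
  have tl: "t \<in> {0..l}" using t sub by auto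
  have 1: "cov_deriv A g \<gamma> b J s = lift s (f' s)" if "s \<in> {0..b}" for s
    by (rule cov_deriv_lift[OF b that J f[OF that]])
  have 2: "cov_deriv A g \<gamma> b (cov_deriv A g \<gamma> b J) t = lift t (- (K t *v f t))"
    by (rule cov_deriv_lift[OF b t 1 f'[OF t]])
  have "lift t (- (K t *v f t)) c = - lift t (K t *v f t) c"
    unfolding lift_def by (rule bounded_bilinear.minus_right[OF bounded_bilinear_matrix_vector])
  then show "cov_deriv A g \<gamma> b (cov_deriv A g \<gamma> b J) t c + curvature A g (\<gamma> t) (J t) (velocity A \<gamma> b t) (velocity A \<gamma> b t) c = 0"
    unfolding 2 velocity_restrict[OF b t] J[OF t] T_def[symmetric] lift_K[OF tl, symmetric] by simp
qed

lemma jacobi_field_coord: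
  assumes J: "jacobi_field A g \<gamma> l J"
  obtains f' where "\<And>t. t \<in> {0..l} \<Longrightarrow> ((\<lambda>t. coord t (J t)) has_vector_derivative f' t) (at t within {0..l})"
    "\<And>t. t \<in> {0..l} \<Longrightarrow> (f' has_vector_derivative - (K t *v coord t (J t))) (at t within {0..l})"
    "\<And>t. t \<in> {0..l} \<Longrightarrow> cov_deriv A g \<gamma> l J t = lift t (f' t)"
proof -
  have Jt: "\<And>t. t \<in> {0..l} \<Longrightarrow> J t \<in> tangent_space A (\<gamma> t)" and Js: "field_smooth_on A \<gamma> J {0..l}"
    using J unfolding jacobi_field_def field_along_def by auto
  obtain f' f'' where f: "\<And>t. t \<in> {0..l} \<Longrightarrow> ((\<lambda>t. coord t (J t)) has_vector_derivative f' t) (at t within {0..l})"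
    and f': "\<And>t. t \<in> {0..l} \<Longrightarrow> (f' has_vector_derivative f'' t) (at t within {0..l})"
    using coord_deriv[OF order_refl l_pos order_refl Jt Js] by metis
  have L: "J s = lift s (coord s (J s))" if "s \<in> {0..l}" for s using lift_coord[OF Jt[OF that] that] by simp
  have 1: "cov_deriv A g \<gamma> l J s = lift s (f' s)" if "s \<in> {0..l}" for s
    by (rule cov_deriv_lift[OF l_pos order_refl that L f[OF that]])
  have "f'' t = - (K t *v coord t (J t))" if t: "t \<in> {0..l}" for t
  proof -
    have 2: "cov_deriv A g \<gamma> l (cov_deriv A g \<gamma> l J) t = lift t (f'' t)"
      by (rule cov_deriv_lift[OF l_pos order_refl t 1 f'[OF t]])
    have "lift t (f'' t) c = - lift t (K t *v coord t (J t)) c" for c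
    proof -
      have "cov_deriv A g \<gamma> l (cov_deriv A g \<gamma> l J) t c + curvature A g (\<gamma> t) (J t) (velocity A \<gamma> l t) (velocity A \<gamma> l t) c = 0"
        using J t unfolding jacobi_field_def by blast
      then show ?thesis unfolding lift_K[OF t] lift_coord[OF Jt[OF t] t] 2[symmetric] T_def eq_neg_iff_add_eq_0 .
    qed
    then have "lift t (f'' t) = lift t (- (K t *v coord t (J t)))"
      unfolding lift_def bounded_bilinear.minus_right[OF bounded_bilinear_matrix_vector] by blast
    then show ?thesis using coord_lift[OF t] by metis
  qed
  then show ?thesis using that[OF f _ 1] f' by simp
qed

text \<open>Apart from the excess S, the right-hand side depends on Z only through its value at l;
  this is what makes two fields with the same end value comparable.\<close>

lemma index_form_eq:
  assumes sys: "jacobi_system q K b l Y Y'" and B: "\<And>z. B (lift 0 z) = lift 0 (b *v z)"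
    and Z: "piecewise_smooth_field A \<gamma> l Z"
  shows "\<exists>S\<ge>0. index_form A g \<gamma> l B Z = q ((Y' l ** matrix_inv (Y l)) *v coord l (Z l)) (coord l (Z l)) + S \<and>
    (S = 0 \<longleftrightarrow> (\<forall>t\<in>{0..l}. coord t (Z t) = Y t *v coord 0 (Z 0)))"
proof -
  interpret jacobi_system q K b l Y Y' by (rule sys)
  let ?z = "\<lambda>t. coord t (Z t)"
  let ?h = "\<lambda>t. g (\<gamma> t) (cov_deriv A g \<gamma> l Z t) (cov_deriv A g \<gamma> l Z t)
       + g (\<gamma> t) (curvature A g (\<gamma> t) (velocity A \<gamma> l t) (Z t) (velocity A \<gamma> l t)) (Z t)"
  have Zt: "Z t \<in> tangent_space A (\<gamma> t)" if "t \<in> {0..l}" for t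
    using Z that unfolding piecewise_smooth_field_def field_along_def by blast
  have L: "Z t = lift t (?z t)" if "t \<in> {0..l}" for t using lift_coord[OF Zt[OF that] that] by simp
  obtain N and \<tau> :: "nat \<Rightarrow> real" where \<tau>: "\<tau> 0 = 0" "\<tau> N = l"
    "\<And>i. i < N \<Longrightarrow> \<tau> i < \<tau> (Suc i)" "\<And>i. i < N \<Longrightarrow> field_smooth_on A \<gamma> Z {\<tau> i..\<tau> (Suc i)}"
    using Z unfolding piecewise_smooth_field_def by metis
  have "\<exists>w'. continuous_on {\<tau> i..\<tau> (Suc i)} w' \<and>
      (\<forall>t\<in>{\<tau> i..\<tau> (Suc i)}. (?z has_vector_derivative w' t) (at t within {\<tau> i..\<tau> (Suc i)})) \<and>
      (\<forall>t\<in>{\<tau> i<..<\<tau> (Suc i)}. ?h t = q (w' t) (w' t) - q (K t *v ?z t) (?z t))" if i: "i < N" for i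
  proof -
    have i0: "0 \<le> \<tau> i" "\<tau> (Suc i) \<le> l"
      using partition_mono[where \<tau>=\<tau> and N=N, OF \<tau>(3), of 0 i] partition_mono[where \<tau>=\<tau> and N=N, OF \<tau>(3), of "Suc i" N] i \<tau>(1,2) by auto
    have "Z t \<in> tangent_space A (\<gamma> t)" if "t \<in> {\<tau> i..\<tau> (Suc i)}" for t
      using Zt that i0 by auto
    from coord_deriv[OF i0(1) \<tau>(3)[OF i] i0(2) this \<tau>(4)[OF i]]
    obtain w' where w': "\<And>t. t \<in> {\<tau> i..\<tau> (Suc i)} \<Longrightarrow> (?z has_vector_derivative w' t) (at t within {\<tau> i..\<tau> (Suc i)})"
      "continuous_on {\<tau> i..\<tau> (Suc i)} w'" by metis
    have "?h t = q (w' t) (w' t) - q (K t *v ?z t) (?z t)" if t: "t \<in> {\<tau> i<..<\<tau> (Suc i)}" for t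
    proof -
      have tl: "t \<in> {0..l}" and int: "0 < t" "t < l" using t i0 by auto
      \<comment> \<open>Inside a piece the derivative within the piece is two-sided, hence it is
        also the derivative within [0,l] used by \<open>cov_deriv\<close>.\<close>
      have "(?z has_vector_derivative w' t) (at t within {0..l})"
        using w'(1)[of t] t int by (simp add: at_within_Icc_at)
      from cov_deriv_lift[OF l_pos order_refl tl L this]
      have cd: "cov_deriv A g \<gamma> l Z t = lift t (w' t)" .
      have "g (\<gamma> t) (curvature A g (\<gamma> t) (T t) (Z t) (T t)) (Z t) = - q (K t *v ?z t) (?z t)"
        using q_curvature[OF tl, of "?z t"] L[OF tl] by simp
      then show ?thesis unfolding cd q_eq[OF tl] T_def by simp
    qed
    then show ?thesis using w' by blast
  qed
  from index_formula[of \<tau> N, OF \<tau>(1-3) this] obtain S where S: "S \<ge> 0"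
    "(?h has_integral q (U l *v ?z l) (?z l) - q (b *v ?z 0) (?z 0) + S) {0..l}"
    "S = 0 \<longleftrightarrow> (\<forall>t\<in>{0..l}. ?z t = Y t *v ?z 0)" by blast
  have 0: "0 \<in> {0..l}" using l_pos by simp
  have "g (\<gamma> 0) (B (Z 0)) (Z 0) = q (b *v ?z 0) (?z 0)"
    using L[OF 0] B[of "?z 0"] unfolding q_def by simp
  then have "index_form A g \<gamma> l B Z = q (U l *v ?z l) (?z l) + S"
    unfolding index_form_def integral_unique[OF S(2)] by simp
  then show ?thesis using S(1,3) unfolding U_def by blast
qed

lemma jacobi_field_piecewise_smooth:
  assumes "jacobi_field A g \<gamma> l J" shows "piecewise_smooth_field A \<gamma> l J"
  unfolding piecewise_smooth_field_def
proof (intro conjI)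
  have s: "field_smooth_on A \<gamma> J {0..l}" and "field_along A \<gamma> l J" using assms unfolding jacobi_field_def by auto
  then show "field_along A \<gamma> l J" by simp
  show "\<forall>c\<in>A. continuous_on {t \<in> {0..l}. \<gamma> t \<in> fst c} (\<lambda>t. J t c)"
    using s unfolding field_smooth_on_def smooth_on_def by (metis Ck_on.simps(1))
  show "\<exists>(N::nat) \<tau>. \<tau> 0 = 0 \<and> \<tau> N = l \<and> (\<forall>i<N. \<tau> i < \<tau> (Suc i) \<and> field_smooth_on A \<gamma> J {\<tau> i..\<tau> (Suc i)})"
    using s l_pos by (intro exI[of _ 1] exI[of _ "\<lambda>i. if i = 0 then 0 else l"]) auto
qed

section \<open>The comparison of index forms\<close>

theorem index_lemma:
  assumes W: "piecewise_smooth_field A \<gamma> l W" and B: "symmetric_transformation A g (\<gamma> 0) B"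
    and focal: "\<forall>t\<in>{0<..l}. \<not> focal_point A g \<gamma> B t"
  shows "\<exists>V. jacobi_field A g \<gamma> l V \<and> V l = W l \<and> cov_deriv A g \<gamma> l V 0 = B (V 0) \<and>
    (\<forall>U. jacobi_field A g \<gamma> l U \<and> U l = W l \<and> cov_deriv A g \<gamma> l U 0 = B (U 0) \<longrightarrow>
       (\<forall>t\<in>{0..l}. U t = V t)) \<and>
    index_form A g \<gamma> l B V \<le> index_form A g \<gamma> l B W \<and>
    (index_form A g \<gamma> l B V = index_form A g \<gamma> l B W \<longrightarrow> (\<forall>t\<in>{0..l}. V t = W t))"
proof -
  have 0: "0 \<in> {0..l}" and l: "l \<in> {0..l}" using l_pos by auto
  have Blin: "linear_on_tangent_space A (\<gamma> 0) B"
    and Bsym: "\<And>u v. u \<in> tangent_space A (\<gamma> 0) \<Longrightarrow> v \<in> tangent_space A (\<gamma> 0) \<Longrightarrow> g (\<gamma> 0) (B u) v = g (\<gamma> 0) u (B v)"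
    using B unfolding symmetric_transformation_def by auto
  have Bt: "B (lift 0 z) \<in> tangent_space A (\<gamma> 0)" for z
    using Blin lift_tangent[OF 0] unfolding linear_on_tangent_space_def by blast
  \<comment> \<open>The matrix of B in the frame at 0; B is known to be linear only on the tangent
    space, so its arguments pass through \<open>lift\<close>.\<close>
  define b where "b = matrix (\<lambda>z. coord 0 (B (lift 0 z)))"
  have "linear (\<lambda>z. coord 0 (B (lift 0 z)))"
    by (rule linear_coord[OF 0 Bt])
       (simp only: lift_comb linear_on_tangent_comb[OF Blin lift_tangent[OF 0] lift_tangent[OF 0]])
  then have "b *v z = coord 0 (B (lift 0 z))" for z unfolding b_def by (rule matrix_vec)
  then have b: "B (lift 0 z) = lift 0 (b *v z)" for z using lift_coord[OF Bt 0] by simp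
  have b_sym: "q (b *v y) z = q y (b *v z)" for y z
    unfolding q_def b[symmetric] by (rule Bsym[OF lift_tangent[OF 0] lift_tangent[OF 0]])
  obtain Y Y' where Y0: "Y 0 = mat 1" "Y' 0 = b"
    and Y: "\<And>t. t\<in>{0..l} \<Longrightarrow> (Y has_vector_derivative Y' t) (at t within {0..l})"
    and Y': "\<And>t. t\<in>{0..l} \<Longrightarrow> (Y' has_vector_derivative - (K t ** Y t)) (at t within {0..l})"
    using jacobi_matrix_exists[OF less_imp_le[OF l_pos] K_continuous, of b] by blast
  have Yv: "((\<lambda>t. Y t *v z) has_vector_derivative Y' t *v z) (at t within {0..l})"
    "((\<lambda>t. Y' t *v z) has_vector_derivative - (K t *v (Y t *v z))) (at t within {0..l})" if t: "t \<in> {0..l}" for t z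
    using has_vector_derivative_matrix_vector[OF Y[OF t] has_vector_derivative_const]
      has_vector_derivative_matrix_vector[OF Y'[OF t] has_vector_derivative_const]
    by (simp_all add: matrix_vector_minus_left matrix_vector_mul_assoc)
  have jac: "jacobi_field A g \<gamma> t (\<lambda>s. lift s (Y s *v z))" "cov_deriv A g \<gamma> t (\<lambda>s. lift s (Y s *v z)) 0 = B (lift 0 z)"
    if t: "0 < t" "t \<le> l" for t z
  proof -
    have sub: "{0..t} \<subseteq> {0..l}" using t by auto
    have d: "((\<lambda>s. Y s *v z) has_vector_derivative Y' s *v z) (at s within {0..t})"
      "((\<lambda>s. Y' s *v z) has_vector_derivative - (K s *v (Y s *v z))) (at s within {0..t})" if "s \<in> {0..t}" for s
      by (rule has_vector_derivative_within_subset[OF Yv(1) sub], use that sub in blast,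
          rule has_vector_derivative_within_subset[OF Yv(2) sub], use that sub in blast)
    show "jacobi_field A g \<gamma> t (\<lambda>s. lift s (Y s *v z))" by (rule jacobi_field_lift[OF t refl d])
    have 0: "0 \<in> {0..t}" using t by simp
    have "cov_deriv A g \<gamma> t (\<lambda>s. lift s (Y s *v z)) 0 = lift 0 (Y' 0 *v z)"
      by (rule cov_deriv_lift[OF t 0 refl d(1)[OF 0]])
    then show "cov_deriv A g \<gamma> t (\<lambda>s. lift s (Y s *v z)) 0 = B (lift 0 z)" unfolding Y0 b .
  qed
  \<comment> \<open>A nonzero z with Y(t) z = 0 forces t > 0, as Y(0) = 1, and the lift of Y z then
    witnesses a focal point at t.\<close>
  have Y_inv: "invertible (Y t)" if t: "t \<in> {0..l}" for t
  proof (rule invertible_matrixI, rule ccontr)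
    fix z assume z: "Y t *v z = 0" "z \<noteq> 0"
    have "t \<noteq> 0" using z Y0(1) by auto
    then have t': "0 < t" "t \<le> l" using t by auto
    have "lift 0 (Y 0 *v z) \<noteq> (\<lambda>_. 0)" using coord_lift[OF 0, of z] coord_lift[OF 0, of 0] z(2)
      unfolding lift_zero[of 0, symmetric] Y0(1) by auto
    then have "focal_point A g \<gamma> B t"
      using jac[OF t', of z] unfolding focal_point_def
      by (intro exI[of _ "\<lambda>s. lift s (Y s *v z)"]) (simp add: z(1) lift_zero Y0(1))
    then show False using focal t' by simp
  qed
  have sys: "jacobi_system q K b l Y Y'"
    by (rule jacobi_system.intro[OF bounded_bilinear_q q_sym q_pos l_pos K_sym b_sym Y0 Y Y' Y_inv])
  have Wt: "W t \<in> tangent_space A (\<gamma> t)" if "t \<in> {0..l}" for t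
    using W that unfolding piecewise_smooth_field_def field_along_def by blast
  \<comment> \<open>The initial coordinates that the prescribed value at l forces, because Y(l) is
    invertible.\<close>
  define z0 where "z0 = matrix_inv (Y l) *v coord l (W l)"
  have Yz0: "Y l *v z0 = coord l (W l)" unfolding z0_def by (rule matrix_inv_cancel(3)[OF Y_inv[OF l]])
  have z0_unique: "z = z0" if "Y l *v z = coord l (W l)" for z
    using matrix_inv_cancel(4)[OF Y_inv[OF l], of z] that by (simp add: z0_def)
  define V where "V t = lift t (Y t *v z0)" for t
  have V_jac: "jacobi_field A g \<gamma> l V" unfolding V_def[abs_def] by (rule jac[OF l_pos order_refl])
  have V0: "cov_deriv A g \<gamma> l V 0 = B (V 0)"
    using jac(2)[OF l_pos order_refl, of z0] by (simp add: V_def[abs_def] Y0(1))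
  have Vl: "V l = W l" unfolding V_def Yz0 by (rule lift_coord[OF Wt[OF l] l])
  have V_coord: "coord t (V t) = Y t *v z0" if "t \<in> {0..l}" for t unfolding V_def by (rule coord_lift[OF that])
  \<comment> \<open>A competitor is determined by its initial coordinates through
    \<open>solution_eq\<close>, and these must be \<open>z0\<close>.\<close>
  have unique: "U t = V t" if U: "jacobi_field A g \<gamma> l U" "U l = W l" "cov_deriv A g \<gamma> l U 0 = B (U 0)" and t: "t \<in> {0..l}" for U t
  proof -
    have Ut: "U t \<in> tangent_space A (\<gamma> t)" if "t \<in> {0..l}" for t
      using U(1) that unfolding jacobi_field_def field_along_def by blast
    obtain u' where u: "\<And>t. t \<in> {0..l} \<Longrightarrow> ((\<lambda>t. coord t (U t)) has_vector_derivative u' t) (at t within {0..l})"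
      "\<And>t. t \<in> {0..l} \<Longrightarrow> (u' has_vector_derivative - (K t *v coord t (U t))) (at t within {0..l})"
      "\<And>t. t \<in> {0..l} \<Longrightarrow> cov_deriv A g \<gamma> l U t = lift t (u' t)" by (rule jacobi_field_coord[OF U(1)]) (rule that)
    have "lift 0 (u' 0) = lift 0 (b *v coord 0 (U 0))"
      using u(3)[OF 0] U(3) b[of "coord 0 (U 0)"] lift_coord[OF Ut[OF 0] 0] by simp
    then have "u' 0 = b *v coord 0 (U 0)" using coord_lift[OF 0] by metis
    from jacobi_system.solution_eq[OF sys u(1,2) this] have e: "coord t (U t) = Y t *v coord 0 (U 0)" if "t \<in> {0..l}" for t
      using that by blast
    have "coord 0 (U 0) = z0" by (rule z0_unique) (use e[OF l] U(2) in simp)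
    then show ?thesis using lift_coord[OF Ut[OF t] t] e[OF t] by (simp add: V_def)
  qed
  obtain S where S: "S \<ge> 0" "index_form A g \<gamma> l B V = q ((Y' l ** matrix_inv (Y l)) *v coord l (V l)) (coord l (V l)) + S"
    "S = 0 \<longleftrightarrow> (\<forall>t\<in>{0..l}. coord t (V t) = Y t *v coord 0 (V 0))"
    using index_form_eq[OF sys b jacobi_field_piecewise_smooth[OF V_jac]] by blast
  have "S = 0" unfolding S(3) using V_coord 0 by (simp add: Y0(1))
  obtain R where R: "R \<ge> 0" "index_form A g \<gamma> l B W = q ((Y' l ** matrix_inv (Y l)) *v coord l (W l)) (coord l (W l)) + R"
    "R = 0 \<longleftrightarrow> (\<forall>t\<in>{0..l}. coord t (W t) = Y t *v coord 0 (W 0))"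
    using index_form_eq[OF sys b W] by blast
  \<comment> \<open>V and W agree at l, so their boundary terms coincide and only the excess of W
    remains.\<close>
  have diff: "index_form A g \<gamma> l B W = index_form A g \<gamma> l B V + R" using R(2) S(2) \<open>S = 0\<close> Vl by simp
  have eq: "V t = W t" if "R = 0" and t: "t \<in> {0..l}" for t
  proof -
    have e: "\<And>t. t \<in> {0..l} \<Longrightarrow> coord t (W t) = Y t *v coord 0 (W 0)" using R(3) that(1) by blast
    have "coord 0 (W 0) = z0" by (rule z0_unique) (use e[OF l] in simp)
    then show ?thesis using lift_coord[OF Wt[OF t] t] e[OF t] by (simp add: V_def)
  qed
  show ?thesis
  proof (intro exI[of _ V] conjI allI impI ballI V_jac Vl V0)
    show "index_form A g \<gamma> l B V \<le> index_form A g \<gamma> l B W" using diff R(1) by linarith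
    show "V t = W t" if "index_form A g \<gamma> l B V = index_form A g \<gamma> l B W" "t \<in> {0..l}" for t
      by (rule eq[OF _ that(2)]) (use diff that(1) in linarith)
    show "U t = V t" if "jacobi_field A g \<gamma> l U \<and> U l = W l \<and> cov_deriv A g \<gamma> l U 0 = B (U 0)" "t \<in> {0..l}" for U t
      using that unique by blast
  qed
qed

end

theorem lemmaA:
  fixes X :: "'a topology" and A :: "('a, 'n::finite) chart set"
    and g :: "('a, 'n) metric_tensor"
    and \<gamma> :: "real \<Rightarrow> 'a" and l :: real
    and W :: "real \<Rightarrow> ('a, 'n) tvec" and B :: "('a, 'n) tvec \<Rightarrow> ('a, 'n) tvec"
  assumes "riemannian_manifold X A g"
    and "normal_geodesic X A g \<gamma> l"
    and "piecewise_smooth_field A \<gamma> l W"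
    and "symmetric_transformation A g (\<gamma> 0) B"
    and "\<forall>t\<in>{0<..l}. \<not> focal_point A g \<gamma> B t"
  shows "\<exists>V. jacobi_field A g \<gamma> l V \<and> V l = W l \<and> cov_deriv A g \<gamma> l V 0 = B (V 0) \<and>
    (\<forall>U. jacobi_field A g \<gamma> l U \<and> U l = W l \<and> cov_deriv A g \<gamma> l U 0 = B (U 0) \<longrightarrow>
       (\<forall>t\<in>{0..l}. U t = V t)) \<and>
    index_form A g \<gamma> l B V \<le> index_form A g \<gamma> l B W \<and>
    (index_form A g \<gamma> l B V = index_form A g \<gamma> l B W \<longrightarrow> (\<forall>t\<in>{0..l}. V t = W t))"
proof -
  have "l > 0" "smooth_curve X A \<gamma> l" using assms(2) unfolding normal_geodesic_def by auto
  then interpret riemannian_curve X A g \<gamma> l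
    using assms(1) by (simp add: riemannian_curve_def riemannian_curve_axioms_def)
  obtain c where c: "c \<in> A" "\<gamma> 0 \<in> fst c" using \<gamma>_cover[of 0] l_pos by auto
  \<comment> \<open>The coordinate frame of any chart around \<gamma>(0) is an admissible
    start.\<close>
  have "frame (\<gamma> 0) (extend_frame c (\<gamma> 0) (mat 1))"
    by (rule frame_extend[OF c]) (simp add: invertible_def exI[of _ "mat 1"])
  then obtain P where "parallel_on 0 l P" using parallel_frame_exists by blast
  then interpret parallel_frame X A g \<gamma> l P
    by (simp add: parallel_frame_def parallel_frame_axioms_def riemannian_curve_axioms)
  show ?thesis by (rule index_lemma[OF assms(3-5)])
qed

end
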